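(* Let $X$ be a real-valued continuous random variable with density $f$. (i) $\sigma[X]\geq\sqrt2$, with equality if and only if $X$ is Gaussian. (ii) If $\sigma[X]\leq C$ and $X$ has finite variance $\sigma^2$ and finite Poincaré constant $R=R(X)$, then $$\tfrac12\|f-\phi\|_1^2\leq D(f\|\phi)\leq\Big(\frac{2R}{\sigma^2}+1\Big)\log\Big(\frac{C}{\sqrt2}\Big),$$ where $\phi$ is the Gaussian density with the same mean and variance as $X$.
   Context: Differential entropy $h$ is assumed to exist and be finite for all random variables considered. Doubling constant: $\sigma[X]=\exp\{h(X+X')-h(X)\}$ where $X'$ is an independent copy of $X$. Poincaré constant: $R(X)=\sup_{g}\frac{E[g(X)^2]}{E[g'(X)^2]}$, the supremum over all absolutely continuous $g$ with $E[g(X)]=0$ and $0<\mathrm{Var}(g(X))<\infty$. $D(f\|g)=\int f\log(f/g)$ is relative entropy; $\|\cdot\|_1$ is the $L^1$ norm; $\log$ is natural. *)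

theory Defs
  imports "HOL-Probability.Probability"
begin

text \<open>Differential entropy of a probability density p on the real line
  (natural logarithm; note ln 0 = 0 in Isabelle, so 0 * ln 0 = 0).\<close>
definition diff_entropy :: "(real \<Rightarrow> real) \<Rightarrow> real" where
  "diff_entropy p = - (\<integral>x. p x * ln (p x) \<partial>lborel)"

definition has_entropy :: "(real \<Rightarrow> real) \<Rightarrow> bool" where
  "has_entropy p \<longleftrightarrow> integrable lborel (\<lambda>x. p x * ln (p x))"

text \<open>Doubling constant sigma[X] = exp (h(X+X') - h(X)), where f is the density
  of X and g the density of X + X' (X' an independent copy of X).\<close>
definition doubling_const :: "(real \<Rightarrow> real) \<Rightarrow> (real \<Rightarrow> real) \<Rightarrow> real" where
  "doubling_const f g = exp (diff_entropy g - diff_entropy f)"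

definition abs_cont_deriv :: "(real \<Rightarrow> real) \<Rightarrow> (real \<Rightarrow> real) \<Rightarrow> bool" where
  "abs_cont_deriv g g' \<longleftrightarrow> g' \<in> borel_measurable lborel \<and>
     (\<forall>a b. a \<le> b \<longrightarrow> set_integrable lborel {a..b} g' \<and>
                       g b - g a = (LINT x:{a..b}|lborel. g' x))"

definition poincare_const :: "'a measure \<Rightarrow> ('a \<Rightarrow> real) \<Rightarrow> ennreal" where
  "poincare_const M X =
     (SUP gg \<in> {(g, g'). abs_cont_deriv g g' \<and>
                  integrable M (\<lambda>\<omega>. g (X \<omega>)) \<and> (\<integral>\<omega>. g (X \<omega>) \<partial>M) = 0 \<and>
                  integrable M (\<lambda>\<omega>. (g (X \<omega>))\<^sup>2) \<and> 0 < (\<integral>\<omega>. (g (X \<omega>))\<^sup>2 \<partial>M)}.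
        (\<integral>\<^sup>+\<omega>. ennreal ((fst gg (X \<omega>))\<^sup>2) \<partial>M) / (\<integral>\<^sup>+\<omega>. ennreal ((snd gg (X \<omega>))\<^sup>2) \<partial>M))"

definition rel_entropy :: "(real \<Rightarrow> real) \<Rightarrow> (real \<Rightarrow> real) \<Rightarrow> real" where
  "rel_entropy f g = (\<integral>x. f x * ln (f x / g x) \<partial>lborel)"

definition L1_dist :: "(real \<Rightarrow> real) \<Rightarrow> (real \<Rightarrow> real) \<Rightarrow> real" where
  "L1_dist f g = (\<integral>x. \<bar>f x - g x\<bar> \<partial>lborel)"

end

theory Submission
  imports Defs "HOL-Real_Asymp.Real_Asymp"
begin

text \<open>
  (i) Let \<open>T\<close> be the monotone map transporting a standard Gaussian \<open>N\<close> to \<open>X\<close>, and let \<open>N'\<close> be an independent copy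
  of \<open>N\<close>. Given the difference \<open>N' - N\<close>, the sum \<open>T N + T N'\<close>, which has the law of \<open>X + X'\<close>, is a monotone
  function of \<open>N + N'\<close>. Conditional Gibbs' inequality therefore bounds the entropy of \<open>X + X'\<close> below by the
  Gaussian entropy plus \<open>E ln ((T' N + T' N') / sqrt 2)\<close>, and the arithmetic-geometric mean inequality turns this into
  the entropy of \<open>X\<close> plus \<open>ln 2 / 2\<close> (Rioul's argument). The only property of \<open>T' = \<phi> / f(T)\<close> that enters is
  \<open>\<integral>\<^bsub>[a,b]\<^esub> T' \<le> T b - T a\<close>, so no regularity of \<open>f\<close> is needed. In the equality case the conditional law
  does not depend on the difference, which forces \<open>T x + T y\<close> to be a function of \<open>x + y\<close>; hence \<open>T\<close> is affine.

  (ii) Let \<open>Y = X + sqrt t N\<close> with score \<open>\<rho>\<close>, Fisher information \<open>J\<close>, variance \<open>V = v + t\<close> and Poincare constant at most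
  \<open>R + t\<close>, and let \<open>Y'\<close> be an independent copy. The score of \<open>Y + Y'\<close> is the \<open>L\<^sup>2\<close>-projection of
  \<open>(\<rho> Y + \<rho> Y') / 2\<close> onto functions of \<open>Y + Y'\<close>, and the argument of Johnson and Barron bounds the length of the
  remainder from below: the Fisher information of \<open>(Y + Y') / sqrt 2\<close> is at most
  \<open>J - (V J - 1) / (2 (R + t) + V)\<close>. Integrating over \<open>t\<close> by de Bruijn's identity shows that doubling contracts
  the entropy deficit relative to the Gaussian by the factor \<open>2 R / (2 R + v)\<close> at every positive time; lower
  semicontinuity of relative entropy carries this to time zero. The lower bound is Pinsker's inequality.
\<close>

section \<open>Monotone transport of the Gaussian\<close>

text \<open>Part (ii) amounts to a lower bound for the entropy of \<open>X + X'\<close>. A score for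
  \<open>X\<close> itself may not exist, so the Fisher information inequality is used only after
  Gaussian smoothing, and time zero is then reached by two one-sided facts: smoothing raises the
  entropy of \<open>X\<close>, so \<open>diff_entropy f\<close> may replace the smoothed value at
  each fixed time, while for \<open>X + X'\<close> Fatou's lemma works in the favourable direction.
  Convergence of either entropy is never claimed. Time is variance. Smoothing two copies with
  variance \<open>t\<close> each smooths their sum with variance \<open>2 * t\<close>, and dividing
  a variable by \<open>sqrt 2\<close> doubles its Fisher information; hence the expression
  \<open>2 * fisher \<mu>2 (2 * t)\<close>. The contraction rate found at time \<open>t\<close>
  depends on \<open>t\<close>. Since the variance is at most the Poincare constant, the rate at time
  zero, \<open>\<kappa> = 2 * R / (2 * R + v)\<close>, is valid throughout, and the factor
  \<open>2 * R / v + 1\<close> of the theorem is \<open>1 / (1 - \<kappa>)\<close>. In (i),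
  conditioning on the difference becomes a shear of coordinates, and Gibbs' inequality becomes the
  statement that the likelihood ratio \<open>\<Psi>\<close> has mean at most 1.\<close>

definition gauss :: "real measure" where
  "gauss = density lborel (\<lambda>x. ennreal (std_normal_density x))"

lemma prob_space_gauss: "prob_space gauss"
  unfolding gauss_def by (rule prob_space_normal_density) simp

lemma sets_gauss[measurable_cong, simp]: "sets gauss = sets borel"
  by (simp add: gauss_def)

lemma space_gauss[simp]: "space gauss = UNIV"
  by (simp add: gauss_def)

lemma real_distribution_gauss: "real_distribution gauss"
  unfolding real_distribution_def real_distribution_axioms_def using prob_space_gauss by simp

lemma isCont_cdf_density:
  fixes f :: "real \<Rightarrow> real"
  assumes "prob_space (density lborel (\<lambda>x. ennreal (f x)))" and [measurable]: "f \<in> borel_measurable borel"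
  shows "isCont (cdf (density lborel (\<lambda>x. ennreal (f x)))) x"
proof -
  interpret prob_space "density lborel (\<lambda>x. ennreal (f x))" by fact
  interpret finite_borel_measure "density lborel (\<lambda>x. ennreal (f x))" by standard simp
  have "emeasure (density lborel (\<lambda>x. ennreal (f x))) {x} = 0"
    by (subst emeasure_density)
      (auto intro!: nn_integral_0_iff_AE[THEN iffD2] AE_I'[of "{x}"] simp: indicator_def)
  then show ?thesis by (simp add: isCont_cdf measure_def)
qed

lemma emeasure_gauss_pos:
  assumes "A \<in> sets borel" "emeasure lborel A > 0"
  shows "emeasure gauss A > 0"
proof -
  have "emeasure gauss A \<noteq> 0"
  proof
    assume "emeasure gauss A = 0"
    then have "AE x in lborel. x \<in> A \<longrightarrow> ennreal (std_normal_density x) = 0"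
      using assms(1) by (simp add: gauss_def emeasure_density nn_integral_0_iff_AE indicator_def)
        (auto elim!: eventually_mono)
    moreover have "ennreal (std_normal_density x) \<noteq> 0" for x
      using normal_density_pos[of 1 0 x] by (simp add: ennreal_eq_0_iff not_le)
    ultimately have "AE x in lborel. x \<notin> A" by simp
    then show False
      using assms AE_iff_measurable[of A lborel "\<lambda>x. x \<notin> A"] by auto
  qed
  then show ?thesis by (simp add: zero_less_iff_neq_zero)
qed

lemma cdf_gauss_strict_mono: "strict_mono (cdf gauss)"
proof
  fix x y :: real assume "x < y"
  interpret real_distribution gauss by (rule real_distribution_gauss)
  have "emeasure gauss {x<..y} > 0" using \<open>x < y\<close> by (intro emeasure_gauss_pos) auto
  then have "measure gauss {x<..y} > 0" by (simp add: emeasure_eq_measure)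
  then show "cdf gauss x < cdf gauss y" using cdf_diff_eq[OF \<open>x < y\<close>] by simp
qed

lemma isCont_cdf_gauss: "isCont (cdf gauss) x"
  unfolding gauss_def by (rule isCont_cdf_density) (auto intro: prob_space_gauss[unfolded gauss_def])

lemma cdf_gauss_bounds: "0 < cdf gauss x" "cdf gauss x < 1"
proof -
  interpret real_distribution gauss by (rule real_distribution_gauss)
  show "0 < cdf gauss x"
    using strict_monoD[OF cdf_gauss_strict_mono, of "x-1" x] cdf_nonneg[of "x-1"] by simp
  show "cdf gauss x < 1"
    using strict_monoD[OF cdf_gauss_strict_mono, of x "x+1"] cdf_bounded_prob[of "x+1"] by simp
qed

text \<open>The monotone map pushing the standard Gaussian forward to the probability measure \<open>\<nu>\<close>.\<close>
definition transport :: "real measure \<Rightarrow> real \<Rightarrow> real" where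
  "transport \<nu> x = Inf {z. cdf gauss x \<le> cdf \<nu> z}"

context
  fixes \<nu> :: "real measure"
  assumes \<nu>: "real_distribution \<nu>"
begin

interpretation cdf_distribution \<nu> using \<nu> by (simp add: cdf_distribution_def)

text \<open>The Galois connection of a quantile map; monotonicity, left continuity and the law of
  \<open>transport\<close> are all read off from it. It holds at every \<open>x\<close> because
  \<open>cdf gauss x\<close> lies strictly between 0 and 1.\<close>

lemma transport_le_iff: "transport \<nu> x \<le> z \<longleftrightarrow> cdf gauss x \<le> cdf \<nu> z"
  unfolding transport_def by (rule pseudoinverse[OF cdf_gauss_bounds, symmetric])

lemma transport_mono: "x \<le> y \<Longrightarrow> transport \<nu> x \<le> transport \<nu> y"
  using strict_mono_mono[OF cdf_gauss_strict_mono, THEN monoD, of x y]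
  by (meson transport_le_iff order.refl order.trans)

lemma transport_measurable[measurable]: "transport \<nu> \<in> borel_measurable borel"
  by (intro borel_measurable_mono monoI transport_mono)

text \<open>Left continuity in order form, inherited from the continuity of
  \<open>cdf gauss\<close>. The equality case uses it to pass to the limit in strict inequalities
  between sums of transported points.\<close>

lemma transport_left_continuous:
  assumes "\<And>y. y < x \<Longrightarrow> transport \<nu> y \<le> z"
  shows "transport \<nu> x \<le> z"
  unfolding transport_le_iff
proof (rule tendsto_upperbound)
  show "(cdf gauss \<longlongrightarrow> cdf gauss x) (at_left x)"
    using isCont_cdf_gauss[of x] unfolding isCont_def by (rule tendsto_within_subset) simp
  show "\<forall>\<^sub>F y in at_left x. cdf gauss y \<le> cdf \<nu> z"
    unfolding eventually_at_filter using assms by (auto intro!: always_eventually simp: transport_le_iff)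
qed simp

lemma distr_transport: "distr gauss borel (transport \<nu>) = \<nu>"
proof (rule cdf_unique)
  interpret G: real_distribution gauss by (rule real_distribution_gauss)
  show "real_distribution (distr gauss borel (transport \<nu>))"
    by (intro G.real_distribution_distr) measurable
  show "real_distribution \<nu>" by (rule \<nu>)
  show "cdf (distr gauss borel (transport \<nu>)) = cdf \<nu>"
  proof
    fix z
    have *: "cdf (distr gauss borel (transport \<nu>)) z = measure gauss {x. cdf gauss x \<le> cdf \<nu> z}"
      by (subst cdf_def, subst measure_distr) (auto simp: transport_le_iff[symmetric] vimage_def)
    \<comment> \<open>The levels 0 and 1 are never attained by \<open>cdf gauss\<close> and are
      treated apart; in between, the intermediate value theorem supplies a preimage of the
      level.\<close>
    consider "cdf \<nu> z \<le> 0" | "cdf \<nu> z \<ge> 1" | "0 < cdf \<nu> z" "cdf \<nu> z < 1" by linarith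
    then show "cdf (distr gauss borel (transport \<nu>)) z = cdf \<nu> z"
    proof cases
      case 1
      then have "{x. cdf gauss x \<le> cdf \<nu> z} = {}" 
        by (metis (mono_tags, lifting) Collect_empty_eq cdf_gauss_bounds(1) leD order.trans)
      then show ?thesis using * 1 cdf_nonneg[of z] by simp
    next
      case 2
      then have "{x. cdf gauss x \<le> cdf \<nu> z} = UNIV" 
        by (metis (mono_tags, lifting) Collect_cong UNIV_def cdf_gauss_bounds(2) less_imp_le order.trans)
      then show ?thesis using * 2 cdf_bounded_prob[of z] G.prob_space by simp
    next
      case 3
      obtain a where a: "cdf gauss a < cdf \<nu> z"
        using eventually_happens'[OF trivial_limit_at_bot_linorder order_tendstoD(2)[OF G.cdf_lim_at_bot 3(1)]] by blast
      obtain b where b: "cdf gauss b > cdf \<nu> z"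
        using eventually_happens'[OF trivial_limit_at_top_linorder order_tendstoD(1)[OF G.cdf_lim_at_top_prob 3(2)]] by blast
      have "a \<le> b" using a b strict_mono_less[OF cdf_gauss_strict_mono, of a b] by linarith
      then obtain x0 where x0: "cdf gauss x0 = cdf \<nu> z"
        using IVT'[of "cdf gauss" a "cdf \<nu> z" b] a b isCont_cdf_gauss
        by (auto intro: continuous_at_imp_continuous_on)
      then have "{x. cdf gauss x \<le> cdf \<nu> z} = {..x0}"
        using strict_mono_less_eq[OF cdf_gauss_strict_mono] by (auto simp flip: x0)
      then show ?thesis using * x0 by (simp add: cdf_def)
    qed
  qed
qed

end

text \<open>The function \<open>V x = x - cdf \<nu> x\<close> is nondecreasing by hypothesis, hence
  the distribution function of a second measure \<open>\<kappa>\<close>. The sum of \<nu> and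
  \<kappa> agrees with Lebesgue measure on half-open intervals, therefore on all Borel sets.\<close>

lemma measure_le_lborel_of_intervals:
  fixes \<nu> :: "real measure"
  assumes "finite_borel_measure \<nu>"
    and le: "\<And>a b. a \<le> b \<Longrightarrow> measure \<nu> {a<..b} \<le> b - a" and A: "A \<in> sets borel"
  shows "emeasure \<nu> A \<le> emeasure lborel A"
proof -
  interpret finite_borel_measure \<nu> by fact
  define V where "V x = x - cdf \<nu> x" for x
  have V_mono: "V x \<le> V y" if "x \<le> y" for x y
    using le[OF that] cdf_diff_eq[of x y] that by (cases "x = y") (auto simp: V_def)
  have V_cont: "continuous (at_right a) V" for a
    unfolding V_def by (intro continuous_intros cdf_is_right_cont)
  define \<kappa> where "\<kappa> = interval_measure V"
  have [simp]: "sets \<kappa> = sets borel" "space \<kappa> = UNIV" by (simp_all add: \<kappa>_def)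
  define m where "m = measure_of UNIV (sets borel) (\<lambda>A. emeasure \<nu> A + emeasure \<kappa> A)"
  have m: "emeasure m B = emeasure \<nu> B + emeasure \<kappa> B" if "B \<in> sets borel" for B
  proof (rule emeasure_measure_of_sigma[of UNIV "sets borel" "\<lambda>A. emeasure \<nu> A + emeasure \<kappa> A", folded m_def])
    show "sigma_algebra UNIV (sets (borel :: real measure))" by (metis sets.sigma_algebra_axioms space_borel)
    show "positive (sets borel) (\<lambda>A. emeasure \<nu> A + emeasure \<kappa> A)" by (simp add: positive_def)
    show "countably_additive (sets borel) (\<lambda>A. emeasure \<nu> A + emeasure \<kappa> A)"
    proof (rule countably_additiveI)
      fix C :: "nat \<Rightarrow> real set" assume C: "range C \<subseteq> sets borel" "disjoint_family C"
      show "(\<Sum>i. emeasure \<nu> (C i) + emeasure \<kappa> (C i)) = emeasure \<nu> (\<Union> (range C)) + emeasure \<kappa> (\<Union> (range C))"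
        using suminf_emeasure[of C \<nu>] suminf_emeasure[of C \<kappa>] C by (subst suminf_add[symmetric]) auto
    qed
  qed fact
  have borel_sets: "sets borel = sigma_sets UNIV (range (\<lambda>(a, b). {a<..b::real}))"
    using arg_cong[OF borel_sigma_sets_Ioc, of sets] by (simp add: sets_measure_of)
  have "lborel = m"
  proof (rule measure_eqI_generator_eq[where E="range (\<lambda>(a, b). {a<..b::real})" and \<Omega>=UNIV and A="\<lambda>n. {- real n<..real n}"])
    show "Int_stable (range (\<lambda>(a, b). {a<..b::real}))"
      by (auto simp: Int_stable_def)
    show "emeasure lborel X = emeasure m X" if XX: "X \<in> range (\<lambda>(a, b). {a<..b::real})" for X
    proof -
      obtain a b where X: "X = {a<..b}" using XX by auto
      show ?thesis
      proof (cases "a < b")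
        case True
        have "emeasure \<kappa> X = ennreal (V b - V a)"
          unfolding \<kappa>_def X using True by (intro emeasure_interval_measure_Ioc V_mono V_cont) auto
        moreover have "emeasure \<nu> X = ennreal (cdf \<nu> b - cdf \<nu> a)"
          unfolding X using cdf_diff_eq[OF True] by (simp add: emeasure_eq_measure)
        moreover have "cdf \<nu> b - cdf \<nu> a \<ge> 0" "V b - V a \<ge> 0"
          using True V_mono[of a b] cdf_nondecreasing[of a b] by auto
        ultimately show ?thesis
          using True unfolding X by (subst m) (auto simp: V_def simp flip: ennreal_plus)
      qed (auto simp: X m)
    qed
    show "sets lborel = sigma_sets UNIV (range (\<lambda>(a, b). {a<..b::real}))"
      by (simp add: borel_sets)
    show "sets m = sigma_sets UNIV (range (\<lambda>(a, b). {a<..b::real}))"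
      by (simp add: m_def borel_sets sigma_sets_sigma_sets_eq)
    show "(\<Union>n. {- real n<..real n}) = UNIV"
    proof -
      have "\<exists>n. x \<in> {- real n<..real n}" for x
      proof -
        obtain n :: nat where "\<bar>x\<bar> < real n" using reals_Archimedean2 by blast
        then show ?thesis by (intro exI[of _ n]) auto
      qed
      then show ?thesis by blast
    qed
  qed auto
  then show ?thesis using m[OF A] by simp
qed

text \<open>Only the inequality half of a change of variables: \<open>\<Theta>\<close> may jump and \<open>D\<close> may miss a
  singular part of its Stieltjes measure.\<close>
lemma nn_integral_mono_substitution_le:
  fixes \<Theta> :: "real \<Rightarrow> real" and D :: "real \<Rightarrow> ennreal"
  assumes mono: "mono \<Theta>" and [measurable]: "D \<in> borel_measurable borel" "G \<in> borel_measurable borel"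
    and le: "\<And>a b. a \<le> b \<Longrightarrow> (\<integral>\<^sup>+x. D x * indicator {a..b} x \<partial>lborel) \<le> ennreal (\<Theta> b - \<Theta> a)"
  shows "(\<integral>\<^sup>+x. G (\<Theta> x) * D x \<partial>lborel) \<le> (\<integral>\<^sup>+z. G z \<partial>lborel)"
proof -
  have [measurable]: "\<Theta> \<in> borel_measurable borel" using mono by (rule borel_measurable_mono)
  \<comment> \<open>On a bounded window the weight \<open>D\<close> has mass at most the increment
    of \<Theta>, so its image under \<Theta> is a finite measure that can be compared with Lebesgue
    measure. Monotone convergence removes the window at the end.\<close>
  have bounded: "(\<integral>\<^sup>+x. G (\<Theta> x) * (D x * indicator {- real k..real k} x) \<partial>lborel) \<le> (\<integral>\<^sup>+z. G z \<partial>lborel)" for k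
  proof -
    define Dk where "Dk = (\<lambda>x. D x * indicator {- real k..real k} x)"
    have [measurable]: "Dk \<in> borel_measurable borel" by (simp add: Dk_def)
    define \<nu> where "\<nu> = distr (density lborel Dk) borel \<Theta>"
    have [simp]: "sets \<nu> = sets borel" "space \<nu> = UNIV" by (simp_all add: \<nu>_def)
    have em: "emeasure \<nu> A = (\<integral>\<^sup>+x. Dk x * indicator A (\<Theta> x) \<partial>lborel)" if "A \<in> sets borel" for A
      using that unfolding \<nu>_def
      by (simp add: emeasure_distr emeasure_density measurable_sets_borel[OF \<open>\<Theta> \<in> borel_measurable borel\<close>] indicator_vimage o_def)
    have fin: "emeasure \<nu> UNIV \<noteq> \<infinity>"
    proof -
      have "emeasure \<nu> UNIV \<le> ennreal (\<Theta> k - \<Theta> (- k))"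
        using le[of "- real k" "real k"] by (simp add: em Dk_def)
      then show ?thesis by (metis ennreal_less_top infinity_ennreal_def leD)
    qed
    interpret finite_measure \<nu> using fin by (intro finite_measureI) simp
    interpret finite_borel_measure \<nu> by standard simp
    have iv: "measure \<nu> {c<..d} \<le> d - c" if cd: "c \<le> d" for c d
    proof -
      define J where "J = {x. c < \<Theta> x \<and> \<Theta> x \<le> d} \<inter> {- real k..real k}"
      have J_conv: "z \<in> J" if "x \<in> J" "y \<in> J" "x \<le> z" "z \<le> y" for x y z
        using that monoD[OF mono, of x z] monoD[OF mono, of z y] by (auto simp: J_def)
      have eq: "emeasure \<nu> {c<..d} = (\<integral>\<^sup>+x. D x * indicator J x \<partial>lborel)"
        by (subst em) (auto simp: Dk_def J_def indicator_def intro!: nn_integral_cong)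
      have "(\<integral>\<^sup>+x. D x * indicator J x \<partial>lborel) \<le> ennreal (d - c)"
      proof (cases "J = {}")
        case False
        define \<alpha> where "\<alpha> = Inf J"
        define \<beta> where "\<beta> = Sup J"
        have bdd: "bdd_below J" "bdd_above J" by (auto simp: J_def bdd_below_def bdd_above_def)
        have sub: "J \<subseteq> {\<alpha>..\<beta>}"
          using bdd by (auto simp: \<alpha>_def \<beta>_def intro: cInf_lower cSup_upper)
        have int: "x \<in> J" if "\<alpha> < x" "x < \<beta>" for x
          using that False bdd J_conv cInf_less_iff[of J x] less_cSup_iff[of J x]
          unfolding \<alpha>_def \<beta>_def by (meson less_imp_le)
        \<comment> \<open>\<open>J\<close> is an interval by monotonicity, but its endpoints may lie
          outside it, where \<Theta> can jump out of \<open>{c<..d}\<close>. A nonempty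
          \<open>K n\<close> has both endpoints in \<open>J\<close>, so the increment of \<Theta>
          over it is at most \<open>d - c\<close>.\<close>
        define K where "K n = {\<alpha> + 1 / Suc n..\<beta> - 1 / Suc n}" for n :: nat
        have K_sub: "K n \<subseteq> J" for n
        proof
          fix x assume x: "x \<in> K n"
          have "0 < 1 / real (Suc n)" by simp
          moreover have "\<alpha> + 1 / real (Suc n) \<le> x" "x \<le> \<beta> - 1 / real (Suc n)" using x by (auto simp: K_def)
          ultimately have "\<alpha> < x" "x < \<beta>" by linarith+
          then show "x \<in> J" by (rule int)
        qed
        have K_mono: "incseq K"
          by (intro incseq_SucI) (auto simp: K_def field_simps intro: order_trans)
        have "AE x in lborel. x \<noteq> \<alpha> \<and> x \<noteq> \<beta>"
          using AE_lborel_singleton[of \<alpha>] AE_lborel_singleton[of \<beta>] by (rule AE_conjI)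
        then have "AE x in lborel. D x * indicator J x = (SUP n. D x * indicator (K n) x)"
        proof (rule AE_mp, intro AE_I2 impI)
          fix x assume x: "x \<noteq> \<alpha> \<and> x \<noteq> \<beta>"
          show "D x * indicator J x = (SUP n. D x * indicator (K n) x)"
          proof (cases "x \<in> J")
            case True
            then have "\<alpha> < x" "x < \<beta>" using sub x by force+
            then obtain n where "1 / real (Suc n) < min (x - \<alpha>) (\<beta> - x)"
              by (metis nat_approx_posE min_less_iff_conj diff_gt_0_iff_gt)
            then have "x \<in> K n" unfolding K_def by auto
            then have "D x * indicator J x \<le> D x * indicator (K n) x" using True by simp
            then have "D x * indicator J x \<le> (SUP n. D x * indicator (K n) x)"
              by (rule SUP_upper2[OF UNIV_I])
            moreover have "(SUP n. D x * indicator (K n) x) \<le> D x * indicator J x"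
              using True by (auto intro!: SUP_least simp: indicator_def)
            ultimately show ?thesis by (rule antisym)
          next
            case False
            then have "x \<notin> K n" for n using K_sub by blast
            then show ?thesis using False by simp
          qed
        qed
        then have "(\<integral>\<^sup>+x. D x * indicator J x \<partial>lborel) = (\<integral>\<^sup>+x. (SUP n. D x * indicator (K n) x) \<partial>lborel)"
          by (rule nn_integral_cong_AE)
        also have "\<dots> = (SUP n. \<integral>\<^sup>+x. D x * indicator (K n) x \<partial>lborel)"
        proof (rule nn_integral_monotone_convergence_SUP)
          show "incseq (\<lambda>n x. D x * indicator (K n) x)"
            using K_mono by (auto simp: incseq_def le_fun_def intro!: mult_left_mono indicator_leI)
        qed (simp add: K_def)
        also have "\<dots> \<le> ennreal (d - c)"
        proof (rule SUP_least)
          fix n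
          show "(\<integral>\<^sup>+x. D x * indicator (K n) x \<partial>lborel) \<le> ennreal (d - c)"
          proof (cases "K n = {}")
            case False
            then have le': "\<alpha> + 1 / Suc n \<le> \<beta> - 1 / Suc n" by (auto simp: K_def)
            then have "\<alpha> + 1 / Suc n \<in> J" "\<beta> - 1 / Suc n \<in> J"
              using K_sub[of n] by (auto simp: K_def)
            then have "\<Theta> (\<beta> - 1 / Suc n) - \<Theta> (\<alpha> + 1 / Suc n) \<le> d - c" by (auto simp: J_def)
            then show ?thesis using le[OF le'] unfolding K_def by (meson ennreal_leI order_trans)
          qed simp
        qed
        finally show ?thesis .
      qed simp
      then have "ennreal (measure \<nu> {c<..d}) \<le> ennreal (d - c)" using eq by (simp add: emeasure_eq_measure)
      then show ?thesis using cd by (simp add: ennreal_le_iff)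
    qed
    have meas_le: "emeasure \<nu> A \<le> emeasure lborel A" if "A \<in> sets borel" for A
      using measure_le_lborel_of_intervals[OF finite_borel_measure_axioms iv that] .
    have "(\<integral>\<^sup>+x. G (\<Theta> x) * Dk x \<partial>lborel) = (\<integral>\<^sup>+z. G z \<partial>\<nu>)"
      unfolding \<nu>_def by (subst nn_integral_distr, simp, simp, subst nn_integral_density) (auto simp: mult.commute)
    also have "\<dots> \<le> (\<integral>\<^sup>+z. G z \<partial>lborel)"
      using meas_le by (intro nn_integral_mono_measure) (auto simp: le_measure le_fun_def)
    finally show ?thesis by (simp add: Dk_def)
  qed
  have "(\<integral>\<^sup>+x. G (\<Theta> x) * D x \<partial>lborel) = (\<integral>\<^sup>+x. (SUP k. G (\<Theta> x) * (D x * indicator {- real k..real k} x)) \<partial>lborel)"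
  proof (rule nn_integral_cong)
    fix x :: real
    obtain k :: nat where "\<bar>x\<bar> \<le> real k" using real_arch_simple by blast
    then have "x \<in> {- real k..real k}" by auto
    then have "G (\<Theta> x) * D x \<le> G (\<Theta> x) * (D x * indicator {- real k..real k} x)" by simp
    then have "G (\<Theta> x) * D x \<le> (SUP k. G (\<Theta> x) * (D x * indicator {- real k..real k} x))"
      by (rule SUP_upper2[OF UNIV_I])
    moreover have "(SUP k. G (\<Theta> x) * (D x * indicator {- real k..real k} x)) \<le> G (\<Theta> x) * D x"
      by (auto intro!: SUP_least simp: indicator_def)
    ultimately show "G (\<Theta> x) * D x = (SUP k. G (\<Theta> x) * (D x * indicator {- real k..real k} x))"
      by (rule antisym)
  qed
  also have "\<dots> = (SUP k. \<integral>\<^sup>+x. G (\<Theta> x) * (D x * indicator {- real k..real k} x) \<partial>lborel)"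
    by (intro nn_integral_monotone_convergence_SUP) (auto simp: incseq_def le_fun_def indicator_def)
  also have "\<dots> \<le> (\<integral>\<^sup>+z. G z \<partial>lborel)" by (intro SUP_least bounded)
  finally show ?thesis .
qed

section \<open>The entropy power inequality under doubling\<close>

lemma real_distribution_density:
  fixes f :: "real \<Rightarrow> real"
  assumes "prob_space (density lborel (\<lambda>x. ennreal (f x)))"
  shows "real_distribution (density lborel (\<lambda>x. ennreal (f x)))"
  unfolding real_distribution_def real_distribution_axioms_def using assms by simp

lemma std_normal_rotate:
  "std_normal_density x * std_normal_density y =
     std_normal_density ((x + y) / sqrt 2) * std_normal_density ((y - x) / sqrt 2)"
  by (simp add: std_normal_density_def power_divide mult_exp_exp power2_eq_square field_simps)

locale density_doubling =
  fixes f g :: "real \<Rightarrow> real"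
  assumes f_meas[measurable]: "f \<in> borel_measurable borel" and g_meas[measurable]: "g \<in> borel_measurable borel"
    and f_nonneg: "\<And>x. 0 \<le> f x" and g_nonneg: "\<And>x. 0 \<le> g x"
    and f_prob: "prob_space (density lborel (\<lambda>x. ennreal (f x)))"
    and g_prob: "prob_space (density lborel (\<lambda>x. ennreal (g x)))"
    and fg: "distr (density lborel (\<lambda>x. ennreal (f x)) \<Otimes>\<^sub>M density lborel (\<lambda>x. ennreal (f x))) borel (\<lambda>(x, y). x + y)
          = density lborel (\<lambda>x. ennreal (g x))"
    and f_ent: "has_entropy f" and g_ent: "has_entropy g"
begin

abbreviation "\<mu>f \<equiv> density lborel (\<lambda>x. ennreal (f x))"
abbreviation "\<mu>g \<equiv> density lborel (\<lambda>x. ennreal (g x))"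

definition T :: "real \<Rightarrow> real" where "T = transport \<mu>f"

text \<open>The derivative that a formal change of variables assigns to \<open>T\<close>. Division
  by zero makes it 0 where \<open>f (T x) = 0\<close>, a null event for \<open>gauss\<close> by
  \<open>AE_f_T_pos\<close>.\<close>

definition D :: "real \<Rightarrow> real" where "D x = std_normal_density x / f (T x)"

text \<open>A likelihood ratio along a line of constant difference \<open>y - x\<close>. In the
  rotated coordinate \<open>(x + y) / sqrt 2\<close> the map \<open>T x + T y\<close> has derivative
  \<open>(D x + D y) / sqrt 2\<close>, so the numerator is the density \<open>g\<close> pulled back
  to that line, and the denominator is the Gaussian density of the coordinate.\<close>

definition \<Psi> :: "real \<Rightarrow> real \<Rightarrow> real" where
  "\<Psi> x y = g (T x + T y) * ((D x + D y) / sqrt 2) / std_normal_density ((x + y) / sqrt 2)"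

text \<open>The lower bound for \<open>\<Psi>\<close> given by the arithmetic-geometric mean inequality for \<open>D x\<close> and \<open>D y\<close>.\<close>
definition \<Psi>' :: "real \<Rightarrow> real \<Rightarrow> real" where
  "\<Psi>' x y = g (T x + T y) * (sqrt 2 * sqrt (D x * D y)) / std_normal_density ((x + y) / sqrt 2)"

lemma f_distr: "real_distribution \<mu>f" using f_prob by (rule real_distribution_density)
lemma g_distr: "real_distribution \<mu>g" using g_prob by (rule real_distribution_density)

lemma T_meas[measurable]: "T \<in> borel_measurable borel"
  unfolding T_def by (rule transport_measurable[OF f_distr])

lemma T_mono: "x \<le> y \<Longrightarrow> T x \<le> T y"
  unfolding T_def by (rule transport_mono[OF f_distr])

lemma T_left: "(\<And>y. y < x \<Longrightarrow> T y \<le> z) \<Longrightarrow> T x \<le> z"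
  unfolding T_def by (rule transport_left_continuous[OF f_distr])

lemma T_distr: "distr gauss borel T = \<mu>f"
  unfolding T_def by (rule distr_transport[OF f_distr])

lemma D_meas[measurable]: "D \<in> borel_measurable borel"
  unfolding D_def[abs_def] by measurable

lemma D_nonneg: "0 \<le> D x"
  by (simp add: D_def f_nonneg)

lemma \<Psi>_nonneg: "0 \<le> \<Psi> x y" and \<Psi>'_nonneg: "0 \<le> \<Psi>' x y"
  by (simp_all add: \<Psi>_def \<Psi>'_def D_nonneg g_nonneg)

lemma \<Psi>'_le_\<Psi>: "\<Psi>' x y \<le> \<Psi> x y"
proof -
  have "sqrt 2 * sqrt (D x * D y) \<le> (D x + D y) / sqrt 2"
    using arith_geo_mean_sqrt[OF D_nonneg D_nonneg, of x y]
    by (simp add: field_simps) (simp add: mult.assoc[symmetric])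
  then show ?thesis unfolding \<Psi>_def \<Psi>'_def
    by (intro divide_right_mono mult_left_mono) (auto simp: g_nonneg)
qed

lemma \<Psi>_meas[measurable]: "(\<lambda>(x, y). \<Psi> x y) \<in> borel_measurable (borel \<Otimes>\<^sub>M borel)"
  and \<Psi>'_meas[measurable]: "(\<lambda>(x, y). \<Psi>' x y) \<in> borel_measurable (borel \<Otimes>\<^sub>M borel)"
  unfolding \<Psi>_def \<Psi>'_def by measurable

lemma AE_f_T_pos: "AE x in gauss. f (T x) > 0"
proof -
  have "AE x in \<mu>f. f x > 0"
    by (subst AE_density) (auto simp: ennreal_less_zero_iff)
  then have "AE x in distr gauss borel T. f x > 0" by (simp only: T_distr)
  then show ?thesis by (subst (asm) AE_distr_iff) auto
qed

text \<open>No differentiation of \<open>T\<close> takes place: pushing \<open>gauss\<close> forward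
  by \<open>T\<close> turns the Gaussian weight into the weight \<open>f\<close>, which cancels
  \<open>1 / f\<close>. What is left is at most the Lebesgue measure of \<open>{T a..T b}\<close>;
  the inequality absorbs zeros of \<open>f\<close> and points outside \<open>{a..b}\<close> that are
  mapped into this interval.\<close>

lemma nn_integral_D_le:
  assumes "a \<le> b"
  shows "(\<integral>\<^sup>+x. ennreal (D x) * indicator {a..b} x \<partial>lborel) \<le> ennreal (T b - T a)"
proof -
  have "(\<integral>\<^sup>+x. ennreal (D x) * indicator {a..b} x \<partial>lborel)
      \<le> (\<integral>\<^sup>+x. ennreal (std_normal_density x) * (ennreal (1 / f (T x)) * indicator {T a..T b} (T x)) \<partial>lborel)"
  proof (rule nn_integral_mono)
    fix x
    have "ennreal (D x) = ennreal (std_normal_density x) * ennreal (1 / f (T x))"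
      by (simp add: D_def f_nonneg flip: ennreal_mult)
    then show "ennreal (D x) * indicator {a..b} x \<le> ennreal (std_normal_density x) * (ennreal (1 / f (T x)) * indicator {T a..T b} (T x))"
      by (auto simp: indicator_def T_mono mult.assoc)
  qed
  also have "\<dots> = (\<integral>\<^sup>+x. ennreal (1 / f (T x)) * indicator {T a..T b} (T x) \<partial>gauss)"
    unfolding gauss_def by (subst nn_integral_density) auto
  also have "\<dots> = (\<integral>\<^sup>+z. ennreal (1 / f z) * indicator {T a..T b} z \<partial>distr gauss borel T)"
    by (subst nn_integral_distr) auto
  also have "\<dots> = (\<integral>\<^sup>+z. ennreal (f z) * (ennreal (1 / f z) * indicator {T a..T b} z) \<partial>lborel)"
    unfolding T_distr by (subst nn_integral_density) auto
  also have "\<dots> \<le> (\<integral>\<^sup>+z. indicator {T a..T b} z \<partial>lborel)"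
  proof (rule nn_integral_mono)
    fix z
    show "ennreal (f z) * (ennreal (1 / f z) * indicator {T a..T b} z) \<le> indicator {T a..T b} z"
      using f_nonneg[of z] by (cases "f z = 0") (auto simp: mult.assoc[symmetric] simp flip: ennreal_mult)
  qed
  also have "\<dots> = ennreal (T b - T a)"
    using T_mono[OF assms] by simp
  finally show ?thesis .
qed

lemma nn_integral_shift_D_le:
  assumes "a \<le> b"
  shows "(\<integral>\<^sup>+x. ennreal (D (x + s)) * indicator {a..b} x \<partial>lborel) \<le> ennreal (T (b + s) - T (a + s))"
proof -
  have "(\<integral>\<^sup>+x. ennreal (D (x + s)) * indicator {a..b} x \<partial>lborel)
    = (\<integral>\<^sup>+x. ennreal (D (s + 1 * x)) * indicator {a + s..b + s} (s + 1 * x) \<partial>lborel)"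
    by (intro nn_integral_cong) (auto simp: indicator_def add.commute)
  also have "\<dots> = (\<integral>\<^sup>+x. ennreal (D x) * indicator {a + s..b + s} x \<partial>lborel)"
    by (subst nn_integral_real_affine[where c=1 and t=s]) auto
  also have "\<dots> \<le> ennreal (T (b + s) - T (a + s))"
    using assms by (intro nn_integral_D_le) simp
  finally show ?thesis .
qed

text \<open>Fixing the difference \<open>s\<close> of the two Gaussian arguments makes their sum a monotone function of one
  variable and replaces the rotation of the Gaussian pair.\<close>
lemma nn_integral_sum_le:
  assumes [measurable]: "G \<in> borel_measurable borel"
  shows "(\<integral>\<^sup>+x. G (T x + T (x + s)) * ennreal (D x + D (x + s)) \<partial>lborel) \<le> (\<integral>\<^sup>+z. G z \<partial>lborel)"
proof (rule nn_integral_mono_substitution_le)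
  show "mono (\<lambda>x. T x + T (x + s))" by (intro monoI add_mono T_mono) auto
  fix a b :: real assume ab: "a \<le> b"
  have "(\<integral>\<^sup>+x. ennreal (D x + D (x + s)) * indicator {a..b} x \<partial>lborel)
    = (\<integral>\<^sup>+x. ennreal (D x) * indicator {a..b} x + ennreal (D (x + s)) * indicator {a..b} x \<partial>lborel)"
    by (intro nn_integral_cong) (simp add: D_nonneg ennreal_plus distrib_right)
  also have "\<dots> = (\<integral>\<^sup>+x. ennreal (D x) * indicator {a..b} x \<partial>lborel) + (\<integral>\<^sup>+x. ennreal (D (x + s)) * indicator {a..b} x \<partial>lborel)"
    by (intro nn_integral_add) auto
  also have "\<dots> \<le> ennreal (T b - T a) + ennreal (T (b + s) - T (a + s))"
    by (intro add_mono nn_integral_D_le nn_integral_shift_D_le ab)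
  also have "\<dots> = ennreal ((T b + T (b + s)) - (T a + T (a + s)))"
    using ab by (subst ennreal_plus[symmetric]) (auto simp: T_mono algebra_simps)
  finally show "(\<integral>\<^sup>+x. ennreal (D x + D (x + s)) * indicator {a..b} x \<partial>lborel)
    \<le> ennreal ((T b + T (b + s)) - (T a + T (a + s)))" .
qed measurable

lemma gauss_pair_nn_integral:
  assumes [measurable]: "(\<lambda>(x, y). h x y) \<in> borel_measurable (borel \<Otimes>\<^sub>M borel)"
  shows "(\<integral>\<^sup>+z. h (fst z) (snd z) \<partial>(gauss \<Otimes>\<^sub>M gauss)) =
    (\<integral>\<^sup>+s. \<integral>\<^sup>+x. ennreal (std_normal_density x * std_normal_density (x + s)) * h x (x + s) \<partial>lborel \<partial>lborel)"
proof -
  interpret prob_space gauss by (rule prob_space_gauss)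
  have "(\<integral>\<^sup>+z. h (fst z) (snd z) \<partial>(gauss \<Otimes>\<^sub>M gauss)) = (\<integral>\<^sup>+x. \<integral>\<^sup>+y. h x y \<partial>gauss \<partial>gauss)"
    by (subst nn_integral_fst[symmetric]) (simp_all add: case_prod_beta')
  also have "\<dots> = (\<integral>\<^sup>+x. ennreal (std_normal_density x) * (\<integral>\<^sup>+y. ennreal (std_normal_density y) * h x y \<partial>lborel) \<partial>lborel)"
    unfolding gauss_def by (simp add: nn_integral_density)
  also have "\<dots> = (\<integral>\<^sup>+x. \<integral>\<^sup>+y. ennreal (std_normal_density x * std_normal_density y) * h x y \<partial>lborel \<partial>lborel)"
    by (simp add: nn_integral_cmult[symmetric] mult.assoc[symmetric] ennreal_mult)
  also have "\<dots> = (\<integral>\<^sup>+x. \<integral>\<^sup>+s. ennreal (std_normal_density x * std_normal_density (x + s)) * h x (x + s) \<partial>lborel \<partial>lborel)"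
  proof (rule nn_integral_cong)
    fix x
    show "(\<integral>\<^sup>+y. ennreal (std_normal_density x * std_normal_density y) * h x y \<partial>lborel) =
      (\<integral>\<^sup>+s. ennreal (std_normal_density x * std_normal_density (x + s)) * h x (x + s) \<partial>lborel)"
      by (subst nn_integral_real_affine[where c=1 and t=x]) auto
  qed
  also have "\<dots> = (\<integral>\<^sup>+s. \<integral>\<^sup>+x. ennreal (std_normal_density x * std_normal_density (x + s)) * h x (x + s) \<partial>lborel \<partial>lborel)"
    by (subst lborel_pair.Fubini') (simp_all add: case_prod_beta')
  finally show ?thesis .
qed

text \<open>The Gaussian pair density factors into the densities of the rotated sum and the rotated
  difference. The first factor is exactly the denominator of \<Psi>, and the second becomes the
  density of \<open>s\<close>, which is normal with variance 2.\<close>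

lemma \<Psi>_weight:
  "ennreal (std_normal_density x * std_normal_density (x + s)) * ennreal (\<Psi> x (x + s)) =
    ennreal (std_normal_density (s / sqrt 2) / sqrt 2) * (ennreal (g (T x + T (x + s))) * ennreal (D x + D (x + s)))"
proof -
  have "std_normal_density x * std_normal_density (x + s) =
    std_normal_density ((x + (x + s)) / sqrt 2) * std_normal_density (s / sqrt 2)"
    by (subst std_normal_rotate) simp
  moreover have "std_normal_density ((x + (x + s)) / sqrt 2) > 0" by (simp add: normal_density_pos)
  ultimately have "std_normal_density x * std_normal_density (x + s) * \<Psi> x (x + s) =
     std_normal_density (s / sqrt 2) / sqrt 2 * (g (T x + T (x + s)) * (D x + D (x + s)))"
    by (simp add: \<Psi>_def)
  then show ?thesis
    by (simp add: g_nonneg D_nonneg \<Psi>_nonneg del: ennreal_plus flip: ennreal_mult)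
qed

lemma nn_integral_gauss_scaled: "(\<integral>\<^sup>+s. ennreal (std_normal_density (s / sqrt 2) / sqrt 2) \<partial>lborel) = 1"
proof -
  have "std_normal_density (s / sqrt 2) / sqrt 2 = normal_density 0 (sqrt 2) s" for s
    by (simp add: normal_density_def power_divide real_sqrt_mult)
  then show ?thesis by (simp add: nn_integral_eq_integral)
qed

lemma g_total: "(\<integral>\<^sup>+z. ennreal (g z) \<partial>lborel) = 1"
  using prob_space.emeasure_space_1[OF g_prob] by (simp add: emeasure_density)

text \<open>For each fixed shift \<open>s\<close> the inner integral is at most the total mass of
  \<open>g\<close> by \<open>nn_integral_sum_le\<close>; averaging over the normal density of
  \<open>s\<close> preserves the bound.\<close>

lemma nn_integral_\<Psi>_le: "(\<integral>\<^sup>+z. ennreal (\<Psi> (fst z) (snd z)) \<partial>(gauss \<Otimes>\<^sub>M gauss)) \<le> 1"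
proof -
  have "(\<integral>\<^sup>+z. ennreal (\<Psi> (fst z) (snd z)) \<partial>(gauss \<Otimes>\<^sub>M gauss)) =
     (\<integral>\<^sup>+s. \<integral>\<^sup>+x. ennreal (std_normal_density (s / sqrt 2) / sqrt 2) * (ennreal (g (T x + T (x + s))) * ennreal (D x + D (x + s))) \<partial>lborel \<partial>lborel)"
    by (subst gauss_pair_nn_integral[where h="\<lambda>x y. ennreal (\<Psi> x y)"]) (simp_all add: \<Psi>_weight)
  also have "\<dots> \<le> (\<integral>\<^sup>+s. ennreal (std_normal_density (s / sqrt 2) / sqrt 2) * 1 \<partial>lborel)"
  proof (rule nn_integral_mono)
    fix s :: real
    have "(\<integral>\<^sup>+x. ennreal (g (T x + T (x + s))) * ennreal (D x + D (x + s)) \<partial>lborel) \<le> 1"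
      using nn_integral_sum_le[of "\<lambda>z. ennreal (g z)" s] by (simp add: g_total del: ennreal_plus)
    then show "(\<integral>\<^sup>+x. ennreal (std_normal_density (s / sqrt 2) / sqrt 2) * (ennreal (g (T x + T (x + s))) * ennreal (D x + D (x + s))) \<partial>lborel)
      \<le> ennreal (std_normal_density (s / sqrt 2) / sqrt 2) * 1"
      by (subst nn_integral_cmult) (auto intro!: mult_left_mono simp del: mult_1_right)
  qed
  also have "\<dots> = 1" by (simp add: nn_integral_gauss_scaled)
  finally show ?thesis .
qed

end

lemma distr_pair_snd_prob:
  assumes "prob_space N" "sigma_finite_measure M" shows "distr (N \<Otimes>\<^sub>M M) M snd = M"
proof (intro measure_eqI)
  interpret N: prob_space N by fact
  interpret M: sigma_finite_measure M by fact
  fix A assume "A \<in> sets (distr (N \<Otimes>\<^sub>M M) M snd)"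
  then have A: "A \<in> sets M" by simp
  then have "snd -` A \<inter> space (N \<Otimes>\<^sub>M M) = space N \<times> A"
    using sets.sets_into_space[OF A] by (auto simp: space_pair_measure)
  then show "emeasure (distr (N \<Otimes>\<^sub>M M) M snd) A = emeasure M A"
    using A by (simp add: emeasure_distr M.emeasure_pair_measure_Times N.emeasure_space_1)
qed simp

lemma AE_lborel_in_interval:
  fixes a b :: real
  assumes "AE s in lborel. P s" "a < b"
  obtains s where "a < s" "s < b" "P s"
proof -
  have "\<exists>s. a < s \<and> s < b \<and> P s"
  proof (rule ccontr)
    assume no: "\<not> (\<exists>s. a < s \<and> s < b \<and> P s)"
    have "AE s in lborel. s \<notin> {a<..<b}"
      using assms(1) by (rule eventually_mono) (use no in auto)
    then have "emeasure lborel {a<..<b} = 0"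
      by (subst (asm) AE_iff_measurable[where N="{a<..<b}"]) auto
    then show False using assms(2) by simp
  qed
  then show ?thesis using that by blast
qed

text \<open>Squeezing \<open>n * x\<close> between consecutive integers shows that
  \<open>n * \<bar>q x - x * q 1\<bar>\<close> is at most \<open>q 1\<close> for every
  \<open>n\<close>, so the deviation from linearity is zero.\<close>

lemma mono_additive_linear:
  fixes q :: "real \<Rightarrow> real"
  assumes mono: "\<And>x y. x \<le> y \<Longrightarrow> q x \<le> q y" and add: "\<And>x y. q (x + y) = q x + q y"
  shows "q x = x * q 1"
proof -
  have q0: "q 0 = 0" using add[of 0 0] by simp
  have nat: "q (of_nat n * x) = of_nat n * q x" for n x
    by (induction n) (simp_all add: q0 distrib_right add)
  have neg: "q (- x) = - q x" for x using add[of x "-x"] q0 by simp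
  have int: "q (of_int k) = of_int k * q 1" for k
  proof (cases k rule: int_cases2)
    case (nonneg n) then show ?thesis using nat[of n 1] by simp
  next
    case (nonpos n) then show ?thesis using nat[of n 1] neg[of "of_nat n"] by simp
  qed
  have bound: "of_nat n * \<bar>q x - x * q 1\<bar> \<le> q 1" for n
  proof -
    define k where "k = \<lfloor>of_nat n * x\<rfloor>"
    have k: "of_int k \<le> of_nat n * x" "of_nat n * x \<le> of_int k + 1" by (simp_all add: k_def)
    have q1: "0 \<le> q 1" using mono[of 0 1] q0 by simp
    have "q (of_int k) \<le> q (of_nat n * x)" "q (of_nat n * x) \<le> q (of_int (k + 1))"
      using k by (auto intro!: mono)
    then have "of_int k * q 1 \<le> of_nat n * q x" "of_nat n * q x \<le> (of_int k + 1) * q 1"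
      by (simp_all add: nat int del: of_int_add) (simp add: int)
    moreover have "of_int k * q 1 \<le> of_nat n * x * q 1" "of_nat n * x * q 1 \<le> (of_int k + 1) * q 1"
      using k q1 by (auto intro!: mult_right_mono)
    ultimately have "\<bar>of_nat n * q x - of_nat n * x * q 1\<bar> \<le> q 1"
      by (simp add: abs_le_iff distrib_right)
    moreover have "of_nat n * \<bar>q x - x * q 1\<bar> = \<bar>of_nat n * q x - of_nat n * x * q 1\<bar>"
      by (metis abs_mult abs_of_nat mult.assoc right_diff_distrib)
    ultimately show ?thesis by simp
  qed
  have "\<bar>q x - x * q 1\<bar> \<le> 0"
  proof (rule ccontr)
    assume "\<not> \<bar>q x - x * q 1\<bar> \<le> 0"
    then obtain n :: nat where "q 1 < of_nat n * \<bar>q x - x * q 1\<bar>"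
      using reals_Archimedean3[of "\<bar>q x - x * q 1\<bar>"] by auto
    then show False using bound[of n] by simp
  qed
  then show ?thesis by simp
qed

section \<open>Integration against a Gaussian pair: the entropy inequality and its equality
  case\<close>

context density_doubling
begin

abbreviation "P \<equiv> gauss \<Otimes>\<^sub>M gauss"

lemma P_prob: "prob_space P"
proof -
  interpret prob_space gauss by (rule prob_space_gauss)
  interpret pair_prob_space gauss gauss ..
  show ?thesis by (rule prob_space_axioms)
qed

lemma P_fst: "distr P gauss fst = gauss"
  by (rule prob_space.distr_pair_fst[OF prob_space_gauss])

lemma P_snd: "distr P gauss snd = gauss"
  by (intro distr_pair_snd_prob prob_space_gauss prob_space_imp_sigma_finite)

lemma integrable_P_marginal:
  fixes h :: "real \<Rightarrow> real"
  assumes h: "integrable gauss h"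
  shows "integrable P (\<lambda>z. h (fst z))" "(\<integral>z. h (fst z) \<partial>P) = (\<integral>x. h x \<partial>gauss)"
    "integrable P (\<lambda>z. h (snd z))" "(\<integral>z. h (snd z) \<partial>P) = (\<integral>x. h x \<partial>gauss)"
proof -
  have [measurable]: "h \<in> borel_measurable gauss" using h by simp
  have 1: "integrable (distr P gauss fst) h" and 2: "integrable (distr P gauss snd) h"
    using h by (simp_all only: P_fst P_snd)
  show "integrable P (\<lambda>z. h (fst z))" using 1 by (subst (asm) integrable_distr_eq) auto
  show "integrable P (\<lambda>z. h (snd z))" using 2 by (subst (asm) integrable_distr_eq) auto
  show "(\<integral>z. h (fst z) \<partial>P) = (\<integral>x. h x \<partial>gauss)"
    by (subst (2) P_fst[symmetric], subst integral_distr) auto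
  show "(\<integral>z. h (snd z) \<partial>P) = (\<integral>x. h x \<partial>gauss)"
    by (subst (2) P_snd[symmetric], subst integral_distr) auto
qed

lemma AE_P_marginal:
  assumes "AE x in gauss. Q x"
  shows "AE z in P. Q (fst z)" "AE z in P. Q (snd z)"
proof -
  have "AE x in distr P gauss fst. Q x" using assms by (simp only: P_fst)
  then show "AE z in P. Q (fst z)" by (rule AE_distrD[rotated]) simp
  have "AE x in distr P gauss snd. Q x" using assms by (simp only: P_snd)
  then show "AE z in P. Q (snd z)" by (rule AE_distrD[rotated]) simp
qed

lemma integrable_ln_f_T: "integrable gauss (\<lambda>x. ln (f (T x)))" "(\<integral>x. ln (f (T x)) \<partial>gauss) = - diff_entropy f"
proof -
  have "integrable \<mu>f (\<lambda>x. ln (f x))"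
    using f_ent f_nonneg by (subst integrable_density) (auto simp: has_entropy_def)
  then have "integrable (distr gauss borel T) (\<lambda>x. ln (f x))" by (simp only: T_distr)
  then show "integrable gauss (\<lambda>x. ln (f (T x)))" by (subst (asm) integrable_distr_eq) auto
  have "(\<integral>x. ln (f (T x)) \<partial>gauss) = (\<integral>x. ln (f x) \<partial>distr gauss borel T)"
    by (subst integral_distr) auto
  also have "\<dots> = - diff_entropy f"
    unfolding T_distr diff_entropy_def using f_nonneg by (subst integral_density) auto
  finally show "(\<integral>x. ln (f (T x)) \<partial>gauss) = - diff_entropy f" .
qed

lemma P_sum_distr: "distr P borel (\<lambda>z. T (fst z) + T (snd z)) = \<mu>g"
proof -
  have "\<mu>f \<Otimes>\<^sub>M \<mu>f = distr gauss borel T \<Otimes>\<^sub>M distr gauss borel T"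
    by (simp only: T_distr)
  also have "\<dots> = distr P (borel \<Otimes>\<^sub>M borel) (\<lambda>(x, y). (T x, T y))"
    using f_prob by (intro pair_measure_distr) (auto simp: T_distr intro: prob_space_imp_sigma_finite)
  finally have "\<mu>g = distr (distr P (borel \<Otimes>\<^sub>M borel) (\<lambda>(x, y). (T x, T y))) borel (\<lambda>(x, y). x + y)"
    using fg by simp
  also have "\<dots> = distr P borel (\<lambda>z. T (fst z) + T (snd z))"
    by (subst distr_distr) (auto simp: comp_def case_prod_beta')
  finally show ?thesis by simp
qed

lemma integrable_ln_g_sum:
  "integrable P (\<lambda>z. ln (g (T (fst z) + T (snd z))))"
  "(\<integral>z. ln (g (T (fst z) + T (snd z))) \<partial>P) = - diff_entropy g"
proof -
  have "integrable \<mu>g (\<lambda>x. ln (g x))"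
    using g_ent g_nonneg by (subst integrable_density) (auto simp: has_entropy_def)
  then have "integrable (distr P borel (\<lambda>z. T (fst z) + T (snd z))) (\<lambda>x. ln (g x))" by (simp only: P_sum_distr)
  then show "integrable P (\<lambda>z. ln (g (T (fst z) + T (snd z))))" by (subst (asm) integrable_distr_eq) auto
  have "(\<integral>z. ln (g (T (fst z) + T (snd z))) \<partial>P) = (\<integral>x. ln (g x) \<partial>distr P borel (\<lambda>z. T (fst z) + T (snd z)))"
    by (subst integral_distr) auto
  also have "\<dots> = - diff_entropy g"
    unfolding P_sum_distr diff_entropy_def using g_nonneg by (subst integral_density) auto
  finally show "(\<integral>z. ln (g (T (fst z) + T (snd z))) \<partial>P) = - diff_entropy g" .
qed

lemma AE_g_sum_pos: "AE z in P. g (T (fst z) + T (snd z)) > 0"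
proof -
  have "AE x in \<mu>g. g x > 0"
    by (subst AE_density) (auto simp: ennreal_less_zero_iff)
  then have "AE x in distr P borel (\<lambda>z. T (fst z) + T (snd z)). g x > 0" by (simp only: P_sum_distr)
  then show ?thesis by (subst (asm) AE_distr_iff) auto
qed

lemma gauss_mean: "integrable gauss (\<lambda>x. x)" "(\<integral>x. x \<partial>gauss) = 0"
proof -
  show "integrable gauss (\<lambda>x. x)" unfolding gauss_def
    using integrable_std_normal_moment[of 1] by (subst integrable_density) auto
  show "(\<integral>x. x \<partial>gauss) = 0" unfolding gauss_def
    using integral_std_normal_moment_odd[of 0] by (subst integral_density) auto
qed

lemma P_product: "integrable P (\<lambda>z. fst z * snd z)" "(\<integral>z. fst z * snd z \<partial>P) = 0"
proof -
  interpret G: prob_space gauss by (rule prob_space_gauss)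
  interpret pair_sigma_finite gauss gauss ..
  show int: "integrable P (\<lambda>z. fst z * snd z)"
  proof (rule Fubini_integrable)
    show "integrable gauss (\<lambda>x. \<integral>y. norm (fst (x, y) * snd (x, y)) \<partial>gauss)"
      using gauss_mean(1) by (simp add: abs_mult)
    show "AE x in gauss. integrable gauss (\<lambda>y. fst (x, y) * snd (x, y))"
      using gauss_mean(1) by simp
  qed simp
  have "(\<integral>z. fst z * snd z \<partial>P) = (\<integral>x. \<integral>y. x * y \<partial>gauss \<partial>gauss)"
    by (subst integral_fst'[symmetric, OF int]) simp
  then show "(\<integral>z. fst z * snd z \<partial>P) = 0" by (simp add: gauss_mean(2))
qed

text \<open>Half of the exponents of \<open>D x\<close> and \<open>D y\<close> contributes
  \<open>- (x^2 + y^2) / 4\<close> and the denominator contributes \<open>(x + y)^2 / 4\<close>.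
  Only the cross term survives, whose mean is zero by \<open>P_product\<close>; the constants
  containing \<open>pi\<close> cancel.\<close>

lemma AE_ln_\<Psi>':
  "AE z in P. \<Psi>' (fst z) (snd z) > 0 \<and> ln (\<Psi>' (fst z) (snd z)) = ln (g (T (fst z) + T (snd z))) + ln 2 / 2
     - ln (f (T (fst z))) / 2 - ln (f (T (snd z))) / 2 + fst z * snd z / 2"
  using AE_g_sum_pos AE_P_marginal[OF AE_f_T_pos]
proof eventually_elim
  case (elim z)
  obtain x y where z: "z = (x, y)" by (cases z)
  have pos: "g (T x + T y) > 0" "f (T x) > 0" "f (T y) > 0" using elim by (simp_all add: z)
  have n: "std_normal_density w > 0" for w by (simp add: normal_density_pos)
  have Dp: "D x > 0" "D y > 0" using pos n by (simp_all add: D_def)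
  have lnn: "ln (std_normal_density w) = - ln (2 * pi) / 2 - w\<^sup>2 / 2" for w
    by (simp add: std_normal_density_def ln_mult ln_div ln_sqrt add_divide_distrib)
  have lnD: "ln (D x) = ln (std_normal_density x) - ln (f (T x))" "ln (D y) = ln (std_normal_density y) - ln (f (T y))"
    unfolding D_def using pos n by (auto intro!: ln_divide_pos)
  have "\<Psi>' x y > 0" using pos Dp n by (simp add: \<Psi>'_def)
  moreover have "ln (\<Psi>' x y) = ln (g (T x + T y)) + (ln 2 / 2 + (ln (D x) + ln (D y)) / 2) - ln (std_normal_density ((x + y) / sqrt 2))"
    unfolding \<Psi>'_def using pos Dp n by (subst ln_divide_pos) (auto simp: ln_mult ln_sqrt)
  moreover have "((x + y) / sqrt 2)\<^sup>2 = (x + y)\<^sup>2 / 2" by (simp add: power_divide)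
  ultimately show ?case
    by (simp add: z lnD lnn) (simp add: power2_eq_square field_simps)
qed

lemma ln_\<Psi>':
  "integrable P (\<lambda>z. ln (\<Psi>' (fst z) (snd z)))"
  "(\<integral>z. ln (\<Psi>' (fst z) (snd z)) \<partial>P) = ln 2 / 2 - (diff_entropy g - diff_entropy f)"
proof -
  interpret P: prob_space P by (rule P_prob)
  define h where "h z = ln (g (T (fst z) + T (snd z))) + ln 2 / 2
     - ln (f (T (fst z))) / 2 - ln (f (T (snd z))) / 2 + fst z * snd z / 2" for z
  note * = integrable_ln_g_sum integrable_P_marginal[OF integrable_ln_f_T(1)] P_product
  have h: "integrable P h" unfolding h_def using * by auto
  have AE: "AE z in P. ln (\<Psi>' (fst z) (snd z)) = h z"
    using AE_ln_\<Psi>' by eventually_elim (simp add: h_def)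
  show "integrable P (\<lambda>z. ln (\<Psi>' (fst z) (snd z)))"
    using AE h by (subst integrable_cong_AE[OF _ _ AE]) auto
  have "(\<integral>z. ln (\<Psi>' (fst z) (snd z)) \<partial>P) = (\<integral>z. h z \<partial>P)"
    using AE h by (intro integral_cong_AE) auto
  also have "\<dots> = ln 2 / 2 - (diff_entropy g - diff_entropy f)"
    unfolding h_def using * by (simp add: integrable_ln_f_T(2) P.prob_space)
  finally show "(\<integral>z. ln (\<Psi>' (fst z) (snd z)) \<partial>P) = ln 2 / 2 - (diff_entropy g - diff_entropy f)" .
qed

lemma integrable_\<Psi>: "integrable P (\<lambda>z. \<Psi> (fst z) (snd z))" "(\<integral>z. \<Psi> (fst z) (snd z) \<partial>P) \<le> 1"
proof -
  show i: "integrable P (\<lambda>z. \<Psi> (fst z) (snd z))"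
  proof (rule integrableI_nonneg)
    show "(\<integral>\<^sup>+z. ennreal (\<Psi> (fst z) (snd z)) \<partial>P) < \<infinity>"
      using nn_integral_\<Psi>_le by (rule le_less_trans) simp
  qed (auto simp: \<Psi>_nonneg)
  have "ennreal (\<integral>z. \<Psi> (fst z) (snd z) \<partial>P) \<le> 1"
    using nn_integral_\<Psi>_le by (subst nn_integral_eq_integral[symmetric]) (auto simp: i \<Psi>_nonneg)
  then show "(\<integral>z. \<Psi> (fst z) (snd z) \<partial>P) \<le> 1" by (simp add: ennreal_le_1)
qed

lemma integrable_\<Psi>': "integrable P (\<lambda>z. \<Psi>' (fst z) (snd z))"
  by (rule Bochner_Integration.integrable_bound[OF integrable_\<Psi>(1)])
    (auto simp: \<Psi>'_nonneg \<Psi>_nonneg \<Psi>'_le_\<Psi>)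

lemma integral_\<Psi>'_le: "(\<integral>z. \<Psi>' (fst z) (snd z) \<partial>P) \<le> 1"
  using integral_mono[OF integrable_\<Psi>' integrable_\<Psi>(1)] \<Psi>'_le_\<Psi> integrable_\<Psi>(2)
  by (meson order_trans)

text \<open>Integrate \<open>ln r \<le> r - 1\<close> at \<open>r = \<Psi>'\<close>. The right side
  is at most 0 because the mean of \<Psi>' is bounded by that of \<Psi>, hence by 1, and the left
  side is \<open>ln 2 / 2\<close> minus the entropy increment.\<close>

theorem entropy_power_doubling: "diff_entropy g - diff_entropy f \<ge> ln 2 / 2"
proof -
  interpret P: prob_space P by (rule P_prob)
  have "(\<integral>z. ln (\<Psi>' (fst z) (snd z)) \<partial>P) \<le> (\<integral>z. \<Psi>' (fst z) (snd z) - 1 \<partial>P)"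
  proof (rule integral_mono_AE[OF ln_\<Psi>'(1)])
    show "AE z in P. ln (\<Psi>' (fst z) (snd z)) \<le> \<Psi>' (fst z) (snd z) - 1"
      using AE_ln_\<Psi>' by eventually_elim (use ln_le_minus_one in blast)
  qed (simp add: integrable_\<Psi>')
  also have "\<dots> \<le> 0" using integral_\<Psi>'_le by (simp add: integrable_\<Psi>' P.prob_space)
  finally show ?thesis by (simp add: ln_\<Psi>')
qed

text \<open>Equality makes the nonnegative function \<open>\<Psi>' - 1 - ln \<Psi>'\<close>
  integrate to zero, so \<Psi>' equals 1 almost surely. Then \<Psi> is at least 1 while its mean is
  at most 1, which forces \<Psi> to be 1 as well.\<close>

lemma equality_AE_\<Psi>:
  assumes "diff_entropy g - diff_entropy f = ln 2 / 2"
  shows "AE z in P. \<Psi> (fst z) (snd z) = 1"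
proof -
  interpret P: prob_space P by (rule P_prob)
  define k where "k z = \<Psi>' (fst z) (snd z) - 1 - ln (\<Psi>' (fst z) (snd z))" for z
  have k: "integrable P k" unfolding k_def using ln_\<Psi>' integrable_\<Psi>' by auto
  have nn: "AE z in P. 0 \<le> k z"
    using AE_ln_\<Psi>' by eventually_elim (unfold k_def, drule conjunct1, drule ln_le_minus_one, linarith)
  have "(\<integral>z. k z \<partial>P) = (\<integral>z. \<Psi>' (fst z) (snd z) \<partial>P) - 1 - (\<integral>z. ln (\<Psi>' (fst z) (snd z)) \<partial>P)"
    unfolding k_def using ln_\<Psi>' integrable_\<Psi>' by (simp add: P.prob_space)
  also have "\<dots> \<le> 0" using integral_\<Psi>'_le assms by (simp add: ln_\<Psi>')
  finally have "(\<integral>z. k z \<partial>P) = 0" using integral_nonneg_AE[OF nn] by simp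
  then have "AE z in P. k z = 0" using integral_nonneg_eq_0_iff_AE[OF k nn] by simp
  then have one: "AE z in P. \<Psi>' (fst z) (snd z) = 1"
    using AE_ln_\<Psi>' by eventually_elim (auto simp: k_def intro!: ln_eq_minus_one)
  have nn2: "AE z in P. 0 \<le> \<Psi> (fst z) (snd z) - 1"
    using one by eventually_elim (metis \<Psi>'_le_\<Psi> diff_ge_0_iff_ge)
  have i2: "integrable P (\<lambda>z. \<Psi> (fst z) (snd z) - 1)" using integrable_\<Psi> by auto
  have "(\<integral>z. \<Psi> (fst z) (snd z) - 1 \<partial>P) \<le> 0"
    using integrable_\<Psi> by (simp add: P.prob_space)
  then have "(\<integral>z. \<Psi> (fst z) (snd z) - 1 \<partial>P) = 0" using integral_nonneg_AE[OF nn2] by simp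
  then have "AE z in P. \<Psi> (fst z) (snd z) - 1 = 0" using integral_nonneg_eq_0_iff_AE[OF i2 nn2] by simp
  then show ?thesis by simp
qed

text \<open>The joint density of the Gaussian pair in the coordinates \<open>x\<close> and
  \<open>s\<close> is strictly positive, so its null sets are Lebesgue null sets, and these are
  sliced by \<open>s\<close>.\<close>

lemma equality_AE_shift:
  assumes "diff_entropy g - diff_entropy f = ln 2 / 2"
  shows "AE s in lborel. AE x in lborel. \<Psi> x (x + s) = 1"
proof -
  define h :: "real \<Rightarrow> real \<Rightarrow> ennreal" where "h x y = (if \<Psi> x y = 1 then 0 else 1)" for x y
  have [measurable]: "(\<lambda>(x, y). h x y) \<in> borel_measurable (borel \<Otimes>\<^sub>M borel)"
    unfolding h_def by measurable
  have "(\<integral>\<^sup>+z. h (fst z) (snd z) \<partial>P) = 0"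
    using equality_AE_\<Psi>[OF assms] by (subst nn_integral_0_iff_AE) (auto simp: h_def elim!: eventually_mono)
  then have "(\<integral>\<^sup>+s. \<integral>\<^sup>+x. ennreal (std_normal_density x * std_normal_density (x + s)) * h x (x + s) \<partial>lborel \<partial>lborel) = 0"
    by (subst (asm) gauss_pair_nn_integral) auto
  then have "AE s in lborel. (\<integral>\<^sup>+x. ennreal (std_normal_density x * std_normal_density (x + s)) * h x (x + s) \<partial>lborel) = 0"
    by (subst (asm) nn_integral_0_iff_AE) auto
  then show ?thesis
  proof eventually_elim
    case (elim s)
    then have "AE x in lborel. ennreal (std_normal_density x * std_normal_density (x + s)) * h x (x + s) = 0"
      by (subst (asm) nn_integral_0_iff_AE) auto
    then show ?case
    proof eventually_elim
      case (elim x)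
      have "ennreal (std_normal_density x * std_normal_density (x + s)) \<noteq> 0"
        by (simp add: ennreal_eq_0_iff not_le normal_density_pos)
      then show ?case using elim by (simp add: h_def split: if_splits)
    qed
  qed
qed

lemma nn_integral_normal_affine:
  fixes A :: "real set"
  assumes [measurable]: "A \<in> sets borel"
  shows "(\<integral>\<^sup>+x. ennreal (sqrt 2 * std_normal_density ((2 * x + s) / sqrt 2)) * indicator A ((2 * x + s) / sqrt 2) \<partial>lborel)
    = emeasure gauss A"
proof -
  have lin: "(2 * x + s) / sqrt 2 = s / sqrt 2 + sqrt 2 * x" for x
    by (simp add: field_simps)
  have "emeasure gauss A = (\<integral>\<^sup>+y. ennreal (std_normal_density y) * indicator A y \<partial>lborel)"
    unfolding gauss_def by (subst emeasure_density) auto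
  also have "\<dots> = ennreal (sqrt 2) * (\<integral>\<^sup>+x. ennreal (std_normal_density (s / sqrt 2 + sqrt 2 * x)) * indicator A (s / sqrt 2 + sqrt 2 * x) \<partial>lborel)"
    by (subst nn_integral_real_affine[where c="sqrt 2" and t="s / sqrt 2"]) auto
  also have "\<dots> = (\<integral>\<^sup>+x. ennreal (sqrt 2) * (ennreal (std_normal_density (s / sqrt 2 + sqrt 2 * x)) * indicator A (s / sqrt 2 + sqrt 2 * x)) \<partial>lborel)"
    by (subst nn_integral_cmult) auto
  also have "\<dots> = (\<integral>\<^sup>+x. ennreal (sqrt 2 * std_normal_density ((2 * x + s) / sqrt 2)) * indicator A ((2 * x + s) / sqrt 2) \<partial>lborel)"
    by (intro nn_integral_cong) (simp add: lin ennreal_mult mult.assoc)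
  finally show ?thesis by simp
qed

text \<open>In the equality case the sum \<open>T x + T (x + s)\<close> transports the Gaussian exactly, so it solves
  \<open>cdf \<mu>g (\<Theta> a) = cdf gauss (\<dots>)\<close> for almost every shift \<open>s\<close>.\<close>
lemma equality_cdf:
  assumes ae: "AE x in lborel. \<Psi> x (x + s) = 1"
  shows "cdf \<mu>g (T a + T (a + s)) = cdf gauss ((2 * a + s) / sqrt 2)"
proof -
  interpret Gg: real_distribution \<mu>g by (rule g_distr)
  interpret N: real_distribution gauss by (rule real_distribution_gauss)
  define \<Theta> where "\<Theta> x = T x + T (x + s)" for x
  have mono: "\<Theta> x \<le> \<Theta> y" if "x \<le> y" for x y
    unfolding \<Theta>_def using that by (intro add_mono T_mono) auto
  \<comment> \<open>When \<Psi> is 1, the Gaussian weight of the rotated sum equals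
    \<open>g (\<Theta> x) * (D x + D (x + s))\<close>, so \<open>nn_integral_sum_le\<close> compares
    a Gaussian mass directly with a mass of \<open>\<mu>g\<close>.\<close>
  have key: "emeasure gauss A \<le> emeasure \<mu>g B"
    if [measurable]: "A \<in> sets borel" "B \<in> sets borel" and AB: "\<And>x. (2 * x + s) / sqrt 2 \<in> A \<Longrightarrow> \<Theta> x \<in> B" for A B
  proof -
    have "emeasure gauss A = (\<integral>\<^sup>+x. ennreal (sqrt 2 * std_normal_density ((2 * x + s) / sqrt 2)) * indicator A ((2 * x + s) / sqrt 2) \<partial>lborel)"
      by (simp add: nn_integral_normal_affine)
    also have "\<dots> \<le> (\<integral>\<^sup>+x. (ennreal (g (\<Theta> x)) * indicator B (\<Theta> x)) * ennreal (D x + D (x + s)) \<partial>lborel)"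
    proof (rule nn_integral_mono_AE)
      show "AE x in lborel. ennreal (sqrt 2 * std_normal_density ((2 * x + s) / sqrt 2)) * indicator A ((2 * x + s) / sqrt 2)
        \<le> (ennreal (g (\<Theta> x)) * indicator B (\<Theta> x)) * ennreal (D x + D (x + s))"
        using ae
      proof eventually_elim
        case (elim x)
        have "std_normal_density ((x + (x + s)) / sqrt 2) > 0" by (simp add: normal_density_pos)
        then have "sqrt 2 * std_normal_density ((2 * x + s) / sqrt 2) = g (\<Theta> x) * (D x + D (x + s))"
          using elim by (simp add: \<Psi>_def \<Theta>_def field_simps)
        then show ?case using AB[of x]
          by (auto simp: indicator_def ennreal_mult g_nonneg D_nonneg simp del: ennreal_plus)
      qed
    qed
    also have "\<dots> \<le> (\<integral>\<^sup>+z. ennreal (g z) * indicator B z \<partial>lborel)"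
      unfolding \<Theta>_def by (rule nn_integral_sum_le[where G="\<lambda>z. ennreal (g z) * indicator B z"]) simp
    also have "\<dots> = emeasure \<mu>g B" by (subst emeasure_density) auto
    finally show ?thesis .
  qed
  define w where "w = (2 * a + s) / sqrt 2"
  have cmp: "(2 * x + s) / sqrt 2 \<le> w \<longleftrightarrow> x \<le> a" for x
    by (simp add: w_def divide_le_cancel)
  have "emeasure gauss {..w} \<le> emeasure \<mu>g {..\<Theta> a}"
    by (rule key) (auto simp: cmp mono)
  then have 1: "cdf gauss w \<le> cdf \<mu>g (\<Theta> a)"
    by (simp add: cdf_def N.emeasure_eq_measure Gg.emeasure_eq_measure)
  \<comment> \<open>The upper half-lines give the reverse inequality between the distribution
    functions, since both measures have mass 1 and \<open>\<mu>g\<close> has no atom at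
    \<open>\<Theta> a\<close>.\<close>
  have "emeasure gauss {w<..} \<le> emeasure \<mu>g {\<Theta> a..}"
    by (rule key) (auto simp: cmp mono not_le[symmetric])
  then have "measure gauss {w<..} \<le> measure \<mu>g {\<Theta> a..}"
    by (simp add: N.emeasure_eq_measure Gg.emeasure_eq_measure)
  moreover have "measure gauss {w<..} = 1 - cdf gauss w"
    using N.prob_compl[of "{..w}"] by (simp add: cdf_def Compl_eq_Diff_UNIV[symmetric])
  moreover have "measure \<mu>g {\<Theta> a..} = 1 - cdf \<mu>g (\<Theta> a)"
  proof -
    have "measure \<mu>g {\<Theta> a} = 0" using isCont_cdf_density[OF g_prob g_meas] Gg.isCont_cdf by blast
    moreover have "measure \<mu>g {..\<Theta> a} = measure \<mu>g {..<\<Theta> a} + measure \<mu>g {\<Theta> a}"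
      by (subst Gg.finite_measure_Union[symmetric]) (auto intro: arg_cong[where f="measure \<mu>g"])
    ultimately show ?thesis using Gg.prob_compl[of "{..<\<Theta> a}"] by (simp add: cdf_def Compl_eq_Diff_UNIV[symmetric])
  qed
  ultimately have "cdf \<mu>g (\<Theta> a) \<le> cdf gauss w" by simp
  with 1 show ?thesis by (simp add: \<Theta>_def w_def)
qed

theorem entropy_power_doubling_equality:
  assumes eq: "diff_entropy g - diff_entropy f = ln 2 / 2"
  shows "\<exists>m s. 0 < s \<and> \<mu>f = density lborel (\<lambda>x. ennreal (normal_density m s x))"
proof -
  interpret Gg: real_distribution \<mu>g by (rule g_distr)
  have good: "AE s in lborel. \<forall>a. cdf \<mu>g (T a + T (a + s)) = cdf gauss ((2 * a + s) / sqrt 2)"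
    using equality_AE_shift[OF eq] by eventually_elim (intro allI equality_cdf)
  \<comment> \<open>\<open>equality_cdf\<close> is available only for almost every shift. Good
    shifts \<open>s\<close> slightly above \<open>y - x\<close> and \<open>s'\<close> slightly below
    \<open>y' - x'\<close> bracket the given points; with \<open>e\<close> half of the gap between
    the sums, \<open>2 * x + s\<close> stays below \<open>2 * x' + s'\<close>, where
    \<open>cdf gauss\<close> is strictly increasing.\<close>
  have strict: "T x + T y < T x' + T y'" if lt: "x + y < x' + y'" for x y x' y'
  proof -
    define e where "e = (x' + y' - (x + y)) / 2"
    have e: "e > 0" using lt by (simp add: e_def)
    obtain s where s: "y - x < s" "s < y - x + e" "\<And>a. cdf \<mu>g (T a + T (a + s)) = cdf gauss ((2 * a + s) / sqrt 2)"
      using AE_lborel_in_interval[OF good, of "y - x" "y - x + e"] e by auto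
    obtain s' where s': "y' - x' - e < s'" "s' < y' - x'" "\<And>a. cdf \<mu>g (T a + T (a + s')) = cdf gauss ((2 * a + s') / sqrt 2)"
      using AE_lborel_in_interval[OF good, of "y' - x' - e" "y' - x'"] e by auto
    have "2 * x + s < 2 * x' + s'" using s s' by (simp add: e_def field_simps)
    then have "(2 * x + s) / sqrt 2 < (2 * x' + s') / sqrt 2" by (simp add: divide_strict_right_mono)
    then have "cdf gauss ((2 * x + s) / sqrt 2) < cdf gauss ((2 * x' + s') / sqrt 2)"
      by (rule strict_monoD[OF cdf_gauss_strict_mono])
    then have "cdf \<mu>g (T x + T (x + s)) < cdf \<mu>g (T x' + T (x' + s'))" by (simp only: s(3) s'(3))
    then have "T x + T (x + s) < T x' + T (x' + s')"
      using Gg.cdf_nondecreasing by (meson not_le)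
    moreover have "T y \<le> T (x + s)" "T (x' + s') \<le> T y'" using s s' by (auto intro!: T_mono)
    ultimately show ?thesis by linarith
  qed
  \<comment> \<open>Lowering \<open>x\<close> makes the sums strictly ordered; left continuity of
    \<open>T\<close> then recovers the case of equal sums. Used in both directions, this says that
    \<open>T x + T y\<close> depends on \<open>x + y\<close> alone.\<close>
  have le: "T x + T y \<le> T x' + T y'" if "x + y = x' + y'" for x y x' y'
  proof -
    have "T x \<le> T x' + T y' - T y"
    proof (rule T_left)
      fix z assume "z < x"
      then show "T z \<le> T x' + T y' - T y" using strict[of z y x' y'] that by simp
    qed
    then show ?thesis by simp
  qed
  define q where "q x = T x - T 0" for x
  have add: "q (x + y) = q x + q y" for x y
    using le[of "x + y" 0 x y] le[of x y "x + y" 0] by (simp add: q_def)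
  have q: "q x = x * q 1" for x
    by (rule mono_additive_linear[of q]) (auto simp: q_def T_mono add[unfolded q_def])
  have pos: "q 1 > 0" using strict[of 0 0 0 1] by (simp add: q_def)
  have T: "T = (\<lambda>x. T 0 + q 1 * x)" using q by (force simp: q_def fun_eq_iff algebra_simps)
  interpret N: prob_space gauss by (rule prob_space_gauss)
  have "distributed gauss lborel (\<lambda>x. x) std_normal_density"
    unfolding distributed_def by (simp add: gauss_def distr_id2)
  then have "distributed gauss lborel (\<lambda>x. T 0 + q 1 * x) (normal_density (T 0 + q 1 * 0) (\<bar>q 1\<bar> * 1))"
    using pos by (intro N.normal_density_affine) auto
  then have "distr gauss lborel T = density lborel (normal_density (T 0) (q 1))"
    using pos by (subst T) (simp add: distributed_def)
  moreover have "distr gauss lborel T = \<mu>f" using T_distr by (simp cong: distr_cong)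
  ultimately show ?thesis using pos by (intro exI[of _ "T 0"] exI[of _ "q 1"]) auto
qed

end

section \<open>Integration\<close>

lemma prob_density_integral:
  fixes f :: "real \<Rightarrow> real"
  assumes "prob_space (density lborel (\<lambda>x. ennreal (f x)))" and [measurable]: "f \<in> borel_measurable borel" and nn: "\<And>x. 0 \<le> f x"
  shows "integrable lborel f" "(\<integral>x. f x \<partial>lborel) = 1"
proof -
  have one: "(\<integral>\<^sup>+x. ennreal (f x) \<partial>lborel) = 1"
    using prob_space.emeasure_space_1[OF assms(1)] by (simp add: emeasure_density)
  show i: "integrable lborel f" using one by (intro integrableI_nonneg) (auto simp: nn)
  show "(\<integral>x. f x \<partial>lborel) = 1" using one nn_integral_eq_integral[OF i] by (simp add: nn)
qed

lemma integrable_pair_marginal: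
  fixes k :: "'a \<Rightarrow> real"
  assumes "prob_space M" "prob_space N" and k: "integrable M k"
  shows "integrable (M \<Otimes>\<^sub>M N) (\<lambda>(x, y). k x)" "integrable (N \<Otimes>\<^sub>M M) (\<lambda>(y, x). k x)"
proof -
  interpret M: prob_space M by fact
  interpret N: prob_space N by fact
  interpret MN: pair_sigma_finite M N ..
  interpret NM: pair_sigma_finite N M ..
  have [measurable]: "k \<in> borel_measurable M" using k by simp
  show "integrable (M \<Otimes>\<^sub>M N) (\<lambda>(x, y). k x)"
    by (rule MN.Fubini_integrable) (use k N.prob_space in simp_all)
  show "integrable (N \<Otimes>\<^sub>M M) (\<lambda>(y, x). k x)"
    by (rule NM.Fubini_integrable) (use k in simp_all)
qed

lemma integrable_pair_sum_square:
  fixes M N :: "real measure"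
  assumes MN: "prob_space M" "prob_space N" and [measurable_cong]: "sets M = sets borel" "sets N = sets borel"
    and M: "integrable M (\<lambda>x. x\<^sup>2)" and N: "integrable N (\<lambda>x. x\<^sup>2)"
  shows "integrable (M \<Otimes>\<^sub>M N) (\<lambda>(x, y). (x + y - c)\<^sup>2)"
proof (rule Bochner_Integration.integrable_bound)
  interpret M: prob_space M by fact
  interpret N: prob_space N by fact
  interpret P: pair_prob_space M N ..
  show "integrable (M \<Otimes>\<^sub>M N) (\<lambda>(x, y). 3 * x\<^sup>2 + 3 * y\<^sup>2 + 3 * c\<^sup>2)"
    using integrable_pair_marginal(1)[OF MN M] integrable_pair_marginal(2)[OF MN(2,1) N] by (simp add: case_prod_beta')
  have "(x + y - c)\<^sup>2 \<le> 3 * x\<^sup>2 + 3 * y\<^sup>2 + 3 * c\<^sup>2" for x y :: real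
  proof -
    have "0 \<le> (x - y)\<^sup>2 + (x + c)\<^sup>2 + (y + c)\<^sup>2" by simp
    then show ?thesis by (simp add: power2_eq_square algebra_simps)
  qed
  then show "AE w in M \<Otimes>\<^sub>M N. norm (case w of (x, y) \<Rightarrow> (x + y - c)\<^sup>2) \<le> norm (case w of (x, y) \<Rightarrow> 3 * x\<^sup>2 + 3 * y\<^sup>2 + 3 * c\<^sup>2)"
    by (intro AE_I2) (auto intro!: order_trans[OF _ abs_ge_self])
qed measurable

lemma integrable_bounded_shift:
  fixes u k :: "real \<Rightarrow> real" and \<nu> :: "real measure"
  assumes \<nu>: "prob_space \<nu>" "sets \<nu> = sets borel" and [measurable]: "u \<in> borel_measurable borel" and u: "\<And>s. \<bar>u s\<bar> \<le> B"
    and k: "integrable lborel k"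
  shows "integrable lborel (\<lambda>s. u s * k (s - x))" "integrable (\<nu> \<Otimes>\<^sub>M lborel) (\<lambda>(x, s). u s * k (s - x))"
proof -
  interpret prob_space \<nu> by fact
  interpret QL: pair_sigma_finite \<nu> lborel ..
  note \<nu>(2)[measurable_cong]
  have [measurable]: "k \<in> borel_measurable borel" using k by simp
  have B: "0 \<le> B" using u[of 0] by linarith
  have shift: "integrable lborel (\<lambda>s. k (s - x))" "(\<integral>s. \<bar>k (s - x)\<bar> \<partial>lborel) = (\<integral>s. \<bar>k s\<bar> \<partial>lborel)" for x
    using lborel_integrable_real_affine[OF k, of 1 "-x"] lborel_integral_real_affine[of 1 "\<lambda>s. \<bar>k s\<bar>" "-x"] by simp_all
  show ui: "integrable lborel (\<lambda>s. u s * k (s - x))" for x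
  proof (rule Bochner_Integration.integrable_bound)
    show "integrable lborel (\<lambda>s. B * k (s - x))" using shift by simp
    show "AE s in lborel. norm (u s * k (s - x)) \<le> norm (B * k (s - x))"
      using u B by (auto simp: abs_mult intro!: mult_right_mono)
  qed measurable
  show "integrable (\<nu> \<Otimes>\<^sub>M lborel) (\<lambda>(x, s). u s * k (s - x))"
  proof (rule QL.Fubini_integrable)
    show "AE x in \<nu>. integrable lborel (\<lambda>s. case (x, s) of (x, s) \<Rightarrow> u s * k (s - x))" using ui by simp
    have "\<bar>\<integral>s. norm (u s * k (s - x)) \<partial>lborel\<bar> \<le> B * (\<integral>s. \<bar>k s\<bar> \<partial>lborel)" for x
    proof -
      have "(\<integral>s. norm (u s * k (s - x)) \<partial>lborel) \<le> (\<integral>s. B * \<bar>k (s - x)\<bar> \<partial>lborel)"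
        using integrable_norm[OF ui[of x]] shift(1)[of x] u by (intro integral_mono) (auto simp: abs_mult intro!: mult_right_mono)
      then show ?thesis by (simp add: shift)
    qed
    then show "integrable \<nu> (\<lambda>x. \<integral>s. norm (case (x, s) of (x, s) \<Rightarrow> u s * k (s - x)) \<partial>lborel)"
      by (intro integrable_const_bound[of _ "B * (\<integral>s. \<bar>k s\<bar> \<partial>lborel)"]) auto
  qed measurable
qed

lemma integrable_mult_square:
  fixes f g :: "'a \<Rightarrow> real"
  assumes [measurable]: "f \<in> borel_measurable M" "g \<in> borel_measurable M"
    and "integrable M (\<lambda>x. (f x)\<^sup>2)" "integrable M (\<lambda>x. (g x)\<^sup>2)"
  shows "integrable M (\<lambda>x. f x * g x)"
proof (rule Bochner_Integration.integrable_bound)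
  show "integrable M (\<lambda>x. (f x)\<^sup>2 + (g x)\<^sup>2)" using assms by simp
  have "\<bar>a * b\<bar> \<le> a\<^sup>2 + b\<^sup>2" for a b :: real
  proof -
    have "2 * (\<bar>a\<bar> * \<bar>b\<bar>) \<le> \<bar>a\<bar>\<^sup>2 + \<bar>b\<bar>\<^sup>2" using sum_squares_bound[of "\<bar>a\<bar>" "\<bar>b\<bar>"] by (simp add: mult.assoc)
    moreover have "0 \<le> \<bar>a\<bar> * \<bar>b\<bar>" by simp
    ultimately have "\<bar>a\<bar> * \<bar>b\<bar> \<le> \<bar>a\<bar>\<^sup>2 + \<bar>b\<bar>\<^sup>2" by linarith
    then show ?thesis by (simp add: abs_mult)
  qed
  then show "AE x in M. norm (f x * g x) \<le> norm ((f x)\<^sup>2 + (g x)\<^sup>2)" by simp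
qed simp

lemma Cauchy_Schwarz_integral:
  fixes f g :: "'a \<Rightarrow> real"
  assumes [measurable]: "f \<in> borel_measurable M" "g \<in> borel_measurable M"
    and f: "integrable M (\<lambda>x. (f x)\<^sup>2)" and g: "integrable M (\<lambda>x. (g x)\<^sup>2)"
  shows "(\<integral>x. f x * g x \<partial>M)\<^sup>2 \<le> (\<integral>x. (f x)\<^sup>2 \<partial>M) * (\<integral>x. (g x)\<^sup>2 \<partial>M)"
proof -
  define F G I where "F = (\<integral>x. (f x)\<^sup>2 \<partial>M)" and "G = (\<integral>x. (g x)\<^sup>2 \<partial>M)" and "I = (\<integral>x. f x * g x \<partial>M)"
  have fg: "integrable M (\<lambda>x. f x * g x)" using assms by (rule integrable_mult_square)
  have q: "0 \<le> F - 2 * c * I + c\<^sup>2 * G" for c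
  proof -
    have "0 \<le> (\<integral>x. (f x - c * g x)\<^sup>2 \<partial>M)" by simp
    also have "(\<lambda>x. (f x - c * g x)\<^sup>2) = (\<lambda>x. (f x)\<^sup>2 - 2 * c * (f x * g x) + c\<^sup>2 * (g x)\<^sup>2)"
      by (rule ext) (simp add: power2_eq_square algebra_simps)
    also have "(\<integral>x. (f x)\<^sup>2 - 2 * c * (f x * g x) + c\<^sup>2 * (g x)\<^sup>2 \<partial>M) = F - 2 * c * I + c\<^sup>2 * G"
      using f g fg by (simp add: F_def G_def I_def)
    finally show ?thesis .
  qed
  have G0: "0 \<le> G" by (simp add: G_def)
  have "I\<^sup>2 \<le> F * G"
  proof (cases "G = 0")
    case True
    have "I = 0"
    proof (rule ccontr)
      assume "I \<noteq> 0"
      \<comment> \<open>With \<open>G = 0\<close> this value of \<open>c\<close> makes the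
        nonnegative quadratic equal to -1.\<close>
      then show False using q[of "(F + 1) / (2 * I)"] True by (simp add: field_simps)
    qed
    then show ?thesis using True by simp
  next
    case False
    then have "G > 0" using G0 by simp
    then show ?thesis using q[of "I / G"] by (simp add: field_simps power2_eq_square)
  qed
  then show ?thesis by (simp add: F_def G_def I_def)
qed

lemma tendsto_integral_bounded:
  fixes \<phi> :: "real \<Rightarrow> 'a \<Rightarrow> real"
  assumes "finite_measure \<mu>" and [measurable]: "\<And>s. \<phi> s \<in> borel_measurable \<mu>" "\<psi> \<in> borel_measurable \<mu>"
    and lim: "\<And>x. x \<in> space \<mu> \<Longrightarrow> ((\<lambda>s. \<phi> s x) \<longlongrightarrow> \<psi> x) (at s0 within S)"
    and bd: "\<And>x s. x \<in> space \<mu> \<Longrightarrow> s \<in> S \<Longrightarrow> s \<noteq> s0 \<Longrightarrow> \<bar>\<phi> s x\<bar> \<le> B"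
  shows "((\<lambda>s. \<integral>x. \<phi> s x \<partial>\<mu>) \<longlongrightarrow> (\<integral>x. \<psi> x \<partial>\<mu>)) (at s0 within S)"
  unfolding tendsto_at_iff_sequentially comp_def
proof (intro allI impI)
  interpret finite_measure \<mu> by fact
  fix X :: "nat \<Rightarrow> real" assume X: "\<forall>i. X i \<in> S - {s0}" "X \<longlonglongrightarrow> s0"
  show "(\<lambda>i. \<integral>x. \<phi> (X i) x \<partial>\<mu>) \<longlonglongrightarrow> (\<integral>x. \<psi> x \<partial>\<mu>)"
  proof (rule integral_dominated_convergence[where w="\<lambda>_. B"])
    show "AE x in \<mu>. (\<lambda>i. \<phi> (X i) x) \<longlonglongrightarrow> \<psi> x"
      using lim X by (auto simp: tendsto_at_iff_sequentially comp_def)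
    show "AE x in \<mu>. norm (\<phi> (X i) x) \<le> B" for i
      using bd X(1) by (auto)
  qed auto
qed

lemma has_derivative_integral_bounded:
  fixes \<phi> \<phi>' :: "real \<Rightarrow> 'a \<Rightarrow> real"
  assumes "finite_measure \<mu>" and [measurable]: "\<And>s. \<phi> s \<in> borel_measurable \<mu>" "\<And>s. \<phi>' s \<in> borel_measurable \<mu>"
    and int: "\<And>s. l < s \<Longrightarrow> s < u \<Longrightarrow> integrable \<mu> (\<phi> s)"
    and deriv: "\<And>x s. l < s \<Longrightarrow> s < u \<Longrightarrow> ((\<lambda>s. \<phi> s x) has_real_derivative \<phi>' s x) (at s)"
    and bd: "\<And>x s. l < s \<Longrightarrow> s < u \<Longrightarrow> \<bar>\<phi>' s x\<bar> \<le> B"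
    and s0: "l < s0" "s0 < u"
  shows "((\<lambda>s. \<integral>x. \<phi> s x \<partial>\<mu>) has_real_derivative (\<integral>x. \<phi>' s0 x \<partial>\<mu>)) (at s0)"
proof -
  have "((\<lambda>s. \<integral>x. \<phi> s x \<partial>\<mu>) has_real_derivative (\<integral>x. \<phi>' s0 x \<partial>\<mu>)) (at s0 within {l<..<u})"
    unfolding has_field_derivative_iff
  proof (rule Lim_transform_eventually)
    show "((\<lambda>s. \<integral>x. (\<phi> s x - \<phi> s0 x) / (s - s0) \<partial>\<mu>) \<longlongrightarrow> (\<integral>x. \<phi>' s0 x \<partial>\<mu>)) (at s0 within {l<..<u})"
    proof (rule tendsto_integral_bounded[OF assms(1)])
      show "((\<lambda>s. (\<phi> s x - \<phi> s0 x) / (s - s0)) \<longlongrightarrow> \<phi>' s0 x) (at s0 within {l<..<u})" for x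
        using deriv[OF s0, of x] by (auto simp: has_field_derivative_iff intro: tendsto_within_subset)
      fix x s assume s: "s \<in> {l<..<u}" "s \<noteq> s0"
      have "\<bar>\<phi> s x - \<phi> s0 x\<bar> \<le> B * \<bar>s - s0\<bar>"
        using field_differentiable_bound[of "{l<..<u}" "\<lambda>s. \<phi> s x" "\<lambda>s. \<phi>' s x" B s s0] bd s s0
          has_field_derivative_at_within[OF deriv] by auto
      then show "\<bar>(\<phi> s x - \<phi> s0 x) / (s - s0)\<bar> \<le> B" using s by (simp add: field_simps abs_mult)
    qed auto
    show "\<forall>\<^sub>F s in at s0 within {l<..<u}. (\<integral>x. (\<phi> s x - \<phi> s0 x) / (s - s0) \<partial>\<mu>) = ((\<integral>x. \<phi> s x \<partial>\<mu>) - (\<integral>x. \<phi> s0 x \<partial>\<mu>)) / (s - s0)"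
      unfolding eventually_at_filter using int s0 by (intro always_eventually) auto
  qed
  then show ?thesis using s0 at_within_open[of s0 "{l<..<u}"] by simp
qed

lemma integral_FTC_Icc_cont:
  fixes F F' :: "real \<Rightarrow> real"
  assumes "a \<le> b" and "\<And>x. a \<le> x \<Longrightarrow> x \<le> b \<Longrightarrow> (F has_real_derivative F' x) (at x)" and "continuous_on {a..b} F'"
  shows "set_integrable lborel {a..b} F'" "(LINT x:{a..b}|lborel. F' x) = F b - F a"
proof -
  show "set_integrable lborel {a..b} F'"
    unfolding set_integrable_def by (rule borel_integrable_compact) (use assms in auto)
  have "has_bochner_integral lborel (\<lambda>x. indicator {a..b} x *\<^sub>R F' x) (F b - F a)"
    by (rule has_bochner_integral_FTC_Icc)
      (use assms in \<open>auto intro: has_field_derivative_at_within simp: has_real_derivative_iff_has_vector_derivative[symmetric]\<close>)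
  then show "(LINT x:{a..b}|lborel. F' x) = F b - F a"
    unfolding set_lebesgue_integral_def by (rule has_bochner_integral_integral_eq)
qed

text \<open>Integrate \<open>F (y + 1) - F y = \<integral>\<^bsub>[0,1]\<^esub> F' (y + s) ds\<close> over \<open>y\<close>: by translation invariance the left
  side gives zero, so no boundary terms have to be estimated.\<close>
lemma integral_derivative_eq_0:
  fixes F F' :: "real \<Rightarrow> real"
  assumes deriv: "\<And>x. (F has_real_derivative F' x) (at x)" and cont: "continuous_on UNIV F'"
    and F: "integrable lborel F" and F': "integrable lborel F'"
  shows "(\<integral>x. F' x \<partial>lborel) = 0"
proof -
  have [measurable]: "F' \<in> borel_measurable borel" using cont by (rule borel_measurable_continuous_onI)
  define h where "h = (\<lambda>(y, s). indicator {0..1::real} s *\<^sub>R F' (y + s))"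
  have hs: "integrable lborel (\<lambda>y. F' (y + s))" for s
    using lborel_integrable_real_affine[OF F', of 1 s] by (simp add: add.commute)
  have shift: "(\<integral>y. k (y + s) \<partial>lborel) = (\<integral>y. k y \<partial>lborel)" for k :: "real \<Rightarrow> real" and s
    by (subst (2) lborel_integral_real_affine[where c=1 and t=s]) (auto simp: add.commute)
  have h: "integrable (lborel \<Otimes>\<^sub>M lborel) (\<lambda>(s, y). indicator {0..1::real} s *\<^sub>R F' (y + s))"
  proof (rule lborel_pair.Fubini_integrable)
    have "(\<lambda>s. \<integral>y. norm (indicator {0..1::real} s *\<^sub>R F' (y + s)) \<partial>lborel) = (\<lambda>s. indicator {0..1} s *\<^sub>R (\<integral>y. norm (F' y) \<partial>lborel))"
      using shift[of "\<lambda>y. norm (F' y)"] by (auto simp: abs_mult)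
    then show "integrable lborel (\<lambda>s. \<integral>y. norm (case (s, y) of (s, y) \<Rightarrow> indicator {0..1::real} s *\<^sub>R F' (y + s)) \<partial>lborel)"
      by simp
    show "AE s in lborel. integrable lborel (\<lambda>y. case (s, y) of (s, y) \<Rightarrow> indicator {0..1::real} s *\<^sub>R F' (y + s))"
      using hs by simp
  qed measurable
  have "0 = (\<integral>y. F (y + 1) - F y \<partial>lborel)"
    using lborel_integrable_real_affine[OF F, of 1 1] F shift[of F 1] by (simp add: add.commute)
  also have "\<dots> = (\<integral>y. \<integral>s. indicator {0..1::real} s *\<^sub>R F' (y + s) \<partial>lborel \<partial>lborel)"
  proof (rule Bochner_Integration.integral_cong[OF refl])
    fix y
    have "((\<lambda>s. F (y + s)) has_real_derivative F' (y + s)) (at s)" for s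
      using deriv[of "s + y"] by (simp add: DERIV_shift add.commute)
    moreover have "continuous_on {0..1} (\<lambda>s. F' (y + s))"
      using cont by (rule continuous_on_compose2) (auto intro!: continuous_intros)
    ultimately show "F (y + 1) - F y = (\<integral>s. indicator {0..1::real} s *\<^sub>R F' (y + s) \<partial>lborel)"
      using integral_FTC_Icc_cont(2)[of 0 1 "\<lambda>s. F (y + s)" "\<lambda>s. F' (y + s)"]
      by (simp add: set_lebesgue_integral_def)
  qed
  also have "\<dots> = (\<integral>s. \<integral>y. indicator {0..1::real} s *\<^sub>R F' (y + s) \<partial>lborel \<partial>lborel)"
    using lborel_pair.Fubini_integral[OF h] by simp
  also have "\<dots> = (\<integral>s. indicator {0..1::real} s *\<^sub>R (\<integral>y. F' y \<partial>lborel) \<partial>lborel)"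
    by (simp add: shift)
  also have "\<dots> = (\<integral>y. F' y \<partial>lborel)" by simp
  finally show ?thesis by simp
qed

lemma gibbs_inequality:
  fixes p q :: "real \<Rightarrow> real"
  assumes p: "integrable lborel p" "\<And>x. 0 \<le> p x" and q: "integrable lborel q" "\<And>x. 0 < q x"
    and le: "(\<integral>x. q x \<partial>lborel) \<le> (\<integral>x. p x \<partial>lborel)"
    and pp: "integrable lborel (\<lambda>x. p x * ln (p x))" and pq: "integrable lborel (\<lambda>x. p x * ln (q x))"
  shows "(\<integral>x. p x * ln (q x) \<partial>lborel) \<le> (\<integral>x. p x * ln (p x) \<partial>lborel)"
proof -
  have pt: "a * ln b - a * ln a \<le> b - a" if "0 \<le> a" "0 < b" for a b :: real
  proof (cases "a = 0")
    case False
    then have a: "a > 0" using that by simp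
    have "a * ln b - a * ln a = a * ln (b / a)" using a that by (simp add: ln_divide_pos right_diff_distrib)
    also have "\<dots> \<le> a * (b / a - 1)" using a that by (intro mult_left_mono ln_le_minus_one) auto
    also have "\<dots> = b - a" using a by (simp add: field_simps)
    finally show ?thesis .
  qed (use that in simp)
  have "(\<integral>x. p x * ln (q x) - p x * ln (p x) \<partial>lborel) \<le> (\<integral>x. q x - p x \<partial>lborel)"
    using p q pp pq by (intro integral_mono) (auto intro!: pt)
  then show ?thesis using le p q pp pq by simp
qed

section \<open>Fisher information of a sum\<close>

text \<open>Test functions have a bounded derivative and are centred inside the integral. They are
  Lipschitz, so both sides are genuine integrals once the second moment is finite. The class
  contains what is tested later: \<open>g\<close> minus a linear function, where
  \<open>\<gamma>_bdd\<close> bounds the derivative of \<open>g\<close>.\<close>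

definition poincare_bound :: "real measure \<Rightarrow> real \<Rightarrow> bool" where
  "poincare_bound \<mu> R \<longleftrightarrow> (\<forall>G G' B. abs_cont_deriv G G' \<longrightarrow> (\<forall>x. \<bar>G' x\<bar> \<le> B) \<longrightarrow>
     (\<integral>x. (G x - (\<integral>y. G y \<partial>\<mu>))\<^sup>2 \<partial>\<mu>) \<le> R * (\<integral>x. (G' x)\<^sup>2 \<partial>\<mu>))"

lemma integrable_indicator_Icc[simp]: "integrable lborel (indicat_real {a..b::real})"
  by (rule integrable_real_indicator) (auto simp: emeasure_lborel_Icc_eq)

lemma square_le_of_abs_le: "\<bar>x\<bar> \<le> C \<Longrightarrow> x\<^sup>2 \<le> C\<^sup>2" for x C :: real
  by (meson abs_le_square_iff abs_ge_self order_trans)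

lemma abs_cont_deriv_affine_diff:
  assumes g: "abs_cont_deriv g g'"
  shows "abs_cont_deriv (\<lambda>y. g y - a * (y - m)) (\<lambda>y. g' y - a)"
  unfolding abs_cont_deriv_def
proof (intro conjI allI impI)
  have g'[measurable]: "g' \<in> borel_measurable lborel" using g by (simp add: abs_cont_deriv_def)
  show "(\<lambda>y. g' y - a) \<in> borel_measurable lborel" by measurable
  fix c b :: real assume cb: "c \<le> b"
  have s: "set_integrable lborel {c..b} g'" "g b - g c = (LINT x:{c..b}|lborel. g' x)"
    using g cb by (auto simp: abs_cont_deriv_def)
  have k: "set_integrable lborel {c..b} (\<lambda>x. a)" by (simp add: set_integrable_def)
  show "set_integrable lborel {c..b} (\<lambda>y. g' y - a)" using s k by (intro set_integral_diff) auto
  have "(LINT x:{c..b}|lborel. g' x - a) = (g b - g c) - (LINT x:{c..b}|lborel. a)"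
    using s k by (simp add: set_integral_diff)
  then show "g b - a * (b - m) - (g c - a * (c - m)) = (LINT x:{c..b}|lborel. g' x - a)"
    using cb by (simp add: set_lebesgue_integral_def algebra_simps)
qed

lemma abs_cont_deriv_lipschitz:
  assumes g: "abs_cont_deriv g g'" and B: "\<And>x. \<bar>g' x\<bar> \<le> B"
  shows "\<bar>g x - g y\<bar> \<le> B * \<bar>x - y\<bar>"
proof -
  have *: "\<bar>g b - g a\<bar> \<le> B * (b - a)" if "a \<le> b" for a b
  proof -
    have s: "set_integrable lborel {a..b} g'" "g b - g a = (LINT x:{a..b}|lborel. g' x)"
      using g that by (auto simp: abs_cont_deriv_def)
    have k: "set_integrable lborel {a..b} (\<lambda>x. B)" by (simp add: set_integrable_def)
    have "\<bar>g b - g a\<bar> \<le> (LINT x:{a..b}|lborel. \<bar>g' x\<bar>)"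
      unfolding s(2) using set_integral_norm_bound[OF s(1)] by simp
    also have "\<dots> \<le> (LINT x:{a..b}|lborel. B)"
      using set_integrable_abs[OF s(1)] k B by (intro set_integral_mono) auto
    also have "\<dots> = B * (b - a)" using that by (simp add: set_lebesgue_integral_def)
    finally show ?thesis .
  qed
  show ?thesis using *[of x y] *[of y x] by (cases "x \<le> y") (auto simp: abs_minus_commute)
qed

lemma abs_cont_deriv_measurable:
  assumes g: "abs_cont_deriv g g'" and B: "\<And>x. \<bar>g' x\<bar> \<le> B"
  shows "g \<in> borel_measurable borel"
proof -
  have "B \<ge> 0" using B[of 0] by linarith
  then have "B-lipschitz_on UNIV g"
    using abs_cont_deriv_lipschitz[OF g B] by (auto simp: lipschitz_on_def dist_real_def)
  then show ?thesis by (intro borel_measurable_continuous_onI lipschitz_on_continuous_on)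
qed

text \<open>Regularity that every Gaussian-smoothed law of finite second moment enjoys, see
  \<open>score_density_heat\<close>; isolating it keeps the projection argument free of heat
  kernels.\<close>

locale score_density =
  fixes p p' :: "real \<Rightarrow> real" and B :: real
  assumes pos: "\<And>y. 0 < p y"
    and deriv: "\<And>y. (p has_real_derivative p' y) (at y)"
    and cont': "continuous_on UNIV p'"
    and int_p: "integrable lborel p" and tot: "(\<integral>y. p y \<partial>lborel) = 1"
    and int_p': "integrable lborel p'"
    and bdd: "\<And>y. \<bar>p' y\<bar> \<le> B"
    and int_J: "integrable lborel (\<lambda>y. (p' y)\<^sup>2 / p y)"
    and int_y2: "integrable lborel (\<lambda>y. y\<^sup>2 * p y)"
    and int_yp': "integrable lborel (\<lambda>y. y * p' y)"
begin

definition Q where "Q = density lborel (\<lambda>y. ennreal (p y))"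
definition \<rho> where "\<rho> y = p' y / p y"
definition m where "m = (\<integral>y. y \<partial>Q)"
definition v where "v = (\<integral>y. (y - m)\<^sup>2 \<partial>Q)"
definition J where "J = (\<integral>y. (p' y)\<^sup>2 / p y \<partial>lborel)"

lemma cont: "continuous_on UNIV p"
  using deriv by (meson DERIV_isCont continuous_at_imp_continuous_on)

lemma meas[measurable]: "p \<in> borel_measurable borel" "p' \<in> borel_measurable borel" "\<rho> \<in> borel_measurable borel"
proof -
  show [measurable]: "p \<in> borel_measurable borel" "p' \<in> borel_measurable borel"
    using cont cont' by (auto intro: borel_measurable_continuous_onI)
  show "\<rho> \<in> borel_measurable borel" unfolding \<rho>_def[abs_def] by measurable
qed

lemma sets_Q[measurable_cong, simp]: "sets Q = sets borel" and space_Q[simp]: "space Q = UNIV"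
  by (simp_all add: Q_def)

lemma prob_Q: "prob_space Q"
proof
  show "emeasure Q (space Q) = 1"
    unfolding Q_def using int_p tot pos
    by (simp add: emeasure_density nn_integral_eq_integral less_imp_le)
qed

sublocale Q: prob_space Q by (rule prob_Q)

lemma measure_Q_UNIV[simp]: "measure Q UNIV = 1" using Q.prob_space by simp

lemma p_nonneg: "0 \<le> p y" using pos[of y] by simp

lemma integrable_Q: "h \<in> borel_measurable borel \<Longrightarrow> integrable Q h \<longleftrightarrow> integrable lborel (\<lambda>y. p y * h y)"
  for h :: "real \<Rightarrow> real"
  unfolding Q_def by (subst integrable_density) (auto simp: p_nonneg)

lemma integral_Q: "h \<in> borel_measurable borel \<Longrightarrow> (\<integral>y. h y \<partial>Q) = (\<integral>y. p y * h y \<partial>lborel)"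
  for h :: "real \<Rightarrow> real"
  unfolding Q_def by (subst integral_density) (auto simp: p_nonneg)

lemma p_mult_\<rho>: "p y * (\<rho> y * h) = p' y * h" "p y * \<rho> y = p' y" "p y * (h * \<rho> y) = p' y * h"
  using pos[of y] by (simp_all add: \<rho>_def)

lemma \<rho>_sq: "integrable Q (\<lambda>y. (\<rho> y)\<^sup>2)" "(\<integral>y. (\<rho> y)\<^sup>2 \<partial>Q) = J"
proof -
  have *: "p y * (\<rho> y)\<^sup>2 = (p' y)\<^sup>2 / p y" for y using pos[of y] by (simp add: \<rho>_def power2_eq_square)
  show "integrable Q (\<lambda>y. (\<rho> y)\<^sup>2)" by (subst integrable_Q) (simp_all add: * int_J)
  show "(\<integral>y. (\<rho> y)\<^sup>2 \<partial>Q) = J" by (subst integral_Q) (simp_all add: * J_def)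
qed

lemma \<rho>_int: "integrable Q \<rho>" "(\<integral>y. \<rho> y \<partial>Q) = 0"
proof -
  show "integrable Q \<rho>" by (subst integrable_Q) (simp_all add: p_mult_\<rho> int_p')
  show "(\<integral>y. \<rho> y \<partial>Q) = 0"
    using integral_derivative_eq_0[OF deriv cont' int_p int_p'] by (subst integral_Q) (simp_all add: p_mult_\<rho>)
qed

lemma y_sq: "integrable Q (\<lambda>y. y\<^sup>2)"
  by (subst integrable_Q) (use int_y2 in \<open>simp_all add: mult.commute\<close>)

lemma y_int: "integrable Q (\<lambda>y. y)"
  using integrable_mult_square[of "\<lambda>y. y" Q "\<lambda>_. 1"] y_sq by simp

lemma ym_sq: "integrable Q (\<lambda>y. (y - m)\<^sup>2)"
  using y_sq y_int by (simp add: power2_diff)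

lemma ym_mean: "integrable Q (\<lambda>y. y - m)" "(\<integral>y. y - m \<partial>Q) = 0"
  using y_int by (auto simp: m_def)

text \<open>Stein's identity: the derivative of \<open>y * p y\<close> integrates to zero, and so
  does \<open>p'\<close>, which takes care of the centring.\<close>

lemma y\<rho>: "(\<integral>y. (y - m) * \<rho> y \<partial>Q) = -1"
proof -
  have yp: "integrable lborel (\<lambda>y. y * p y)"
    using y_int by (subst (asm) integrable_Q) (simp_all add: mult.commute)
  have "(\<integral>y. p y + y * p' y \<partial>lborel) = 0"
  proof (rule integral_derivative_eq_0)
    show "((\<lambda>y. y * p y) has_real_derivative p y + y * p' y) (at y)" for y
      by (auto intro!: derivative_eq_intros deriv)
    show "continuous_on UNIV (\<lambda>y. p y + y * p' y)" by (intro continuous_intros cont cont')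
    show "integrable lborel (\<lambda>y. p y + y * p' y)" using int_p int_yp' by simp
  qed (rule yp)
  then have *: "(\<integral>y. y * p' y \<partial>lborel) = -1" using int_p int_yp' tot by simp
  have **: "(\<integral>y. p' y \<partial>lborel) = 0" by (rule integral_derivative_eq_0[OF deriv cont' int_p int_p'])
  have "(\<integral>y. (y - m) * \<rho> y \<partial>Q) = (\<integral>y. y * p' y - m * p' y \<partial>lborel)"
    by (subst integral_Q) (simp_all add: p_mult_\<rho> algebra_simps)
  also have "\<dots> = -1" using int_yp' int_p' by (simp add: * **)
  finally show ?thesis .
qed

lemma cramer_rao: "1 \<le> v * J"
  using Cauchy_Schwarz_integral[of "\<lambda>y. y - m" Q \<rho>] ym_sq \<rho>_sq by (simp add: y\<rho> v_def)

lemma v_pos: "0 < v" and J_pos: "0 < J"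
proof -
  have "0 \<le> v" "0 \<le> J" using p_nonneg by (auto simp: v_def J_def)
  then show "0 < v" "0 < J" using cramer_rao by (auto simp: order.order_iff_strict)
qed

end

locale score_density_test = score_density +
  fixes u :: "real \<Rightarrow> real" and Bu :: real
  assumes u_meas[measurable]: "u \<in> borel_measurable borel" and u_bdd: "\<And>s. \<bar>u s\<bar> \<le> Bu"
begin

text \<open>With \<open>Y, Y'\<close> independent of density \<open>p\<close>: \<open>g\<close> is the centred conditional expectation of \<open>u (Y + Y')\<close> given
  \<open>Y\<close>, \<open>\<gamma>\<close> is its derivative after integration by parts, and \<open>r\<close> is the part of \<open>u\<close> with vanishing marginals.\<close>
definition c0 where "c0 = (\<integral>x. \<integral>y. u (x + y) \<partial>Q \<partial>Q)"
definition g where "g x = (\<integral>y. u (x + y) \<partial>Q) - c0"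
definition \<gamma> where "\<gamma> x = - (\<integral>y. u (x + y) * \<rho> y \<partial>Q)"
definition a where "a = (\<integral>x. \<gamma> x \<partial>Q)"
definition r where "r x y = u (x + y) - c0 - g x - g y"
definition Bg where "Bg = Bu + \<bar>c0\<bar>"
definition Br where "Br = 3 * Bg"

sublocale QQ: pair_prob_space Q Q ..

lemma g_meas[measurable]: "g \<in> borel_measurable borel" and \<gamma>_meas[measurable]: "\<gamma> \<in> borel_measurable borel"
  unfolding g_def[abs_def] \<gamma>_def[abs_def] by measurable

lemma r_meas[measurable]: "(\<lambda>(x, y). r x y) \<in> borel_measurable (borel \<Otimes>\<^sub>M borel)"
  unfolding r_def by measurable

lemma Bu_nonneg[simp]: "0 \<le> Bu" using u_bdd[of 0] by linarith

lemma int_bounded: "h \<in> borel_measurable borel \<Longrightarrow> (\<And>y. \<bar>h y\<bar> \<le> C) \<Longrightarrow> integrable Q h" for h :: "real \<Rightarrow> real" and C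
  by (rule Q.integrable_const_bound[of _ C]) auto

lemma int_bounded2: "(\<lambda>(x, y). h x y) \<in> borel_measurable (borel \<Otimes>\<^sub>M borel) \<Longrightarrow> (\<And>x y. \<bar>h x y\<bar> \<le> C) \<Longrightarrow>
    integrable (Q \<Otimes>\<^sub>M Q) (\<lambda>(x, y). h x y)" for h :: "real \<Rightarrow> real \<Rightarrow> real" and C
  by (rule QQ.integrable_const_bound[of _ C]) auto

lemma g_bdd: "\<bar>g x\<bar> \<le> Bg"
proof -
  have "\<bar>\<integral>y. u (x + y) \<partial>Q\<bar> \<le> (\<integral>y. \<bar>u (x + y)\<bar> \<partial>Q)" by (rule integral_abs_bound)
  also have "\<dots> \<le> (\<integral>y. Bu \<partial>Q)" using u_bdd by (intro integral_mono int_bounded[of _ Bu]) auto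
  finally show ?thesis by (simp add: Q.prob_space g_def Bg_def)
qed

lemma r_bdd: "\<bar>r x y\<bar> \<le> Br"
proof -
  have "\<bar>u (x + y) - c0\<bar> \<le> Bg" using u_bdd[of "x + y"] unfolding Bg_def by linarith
  then show ?thesis using g_bdd[of x] g_bdd[of y] unfolding r_def Br_def by linarith
qed

lemma u_shift_int: "integrable Q (\<lambda>y. u (x + y))" "integrable Q (\<lambda>y. (u (x + y))\<^sup>2)"
  "integrable Q (\<lambda>y. u (x + y) * \<rho> y)"
proof -
  show "integrable Q (\<lambda>y. u (x + y))" by (rule int_bounded[of _ Bu]) (auto simp: u_bdd)
  show 2: "integrable Q (\<lambda>y. (u (x + y))\<^sup>2)"
    by (rule int_bounded[of _ "Bu\<^sup>2"]) (auto simp: u_bdd power2_le_iff_abs_le Bu_nonneg)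
  show "integrable Q (\<lambda>y. u (x + y) * \<rho> y)" using 2 \<rho>_sq by (intro integrable_mult_square) auto
qed

lemma g_int: "integrable Q g" "integrable Q (\<lambda>y. (g y)\<^sup>2)" "(\<integral>y. g y \<partial>Q) = 0"
proof -
  show "integrable Q g" by (rule int_bounded[of _ Bg]) (auto simp: g_bdd)
  show "integrable Q (\<lambda>y. (g y)\<^sup>2)"
    by (rule int_bounded[of _ "Bg\<^sup>2"]) (auto intro!: square_le_of_abs_le g_bdd)
  have "integrable Q (\<lambda>x. \<integral>y. u (x + y) \<partial>Q)"
  proof (rule int_bounded[of _ "Bg + \<bar>c0\<bar>"])
    show "\<bar>\<integral>y. u (x + y) \<partial>Q\<bar> \<le> Bg + \<bar>c0\<bar>" for x using g_bdd[of x] unfolding g_def by linarith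
  qed measurable
  then show "(\<integral>y. g y \<partial>Q) = 0" unfolding g_def by (simp add: c0_def Q.prob_space)
qed

lemma product_int: "integrable Q (\<lambda>y. g y * \<rho> y)" "integrable Q (\<lambda>y. (y - m) * g y)" "integrable Q (\<lambda>y. (y - m) * \<rho> y)"
  using g_int \<rho>_sq ym_sq by (auto intro!: integrable_mult_square)

lemma \<gamma>_bdd: "\<bar>\<gamma> x\<bar> \<le> Bu * (\<integral>y. \<bar>\<rho> y\<bar> \<partial>Q)"
proof -
  have "\<bar>\<integral>y. u (x + y) * \<rho> y \<partial>Q\<bar> \<le> (\<integral>y. \<bar>u (x + y) * \<rho> y\<bar> \<partial>Q)" by (rule integral_abs_bound)
  also have "\<dots> \<le> (\<integral>y. Bu * \<bar>\<rho> y\<bar> \<partial>Q)"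
    using u_bdd \<rho>_int integrable_abs[OF u_shift_int(3)[of x]] by (intro integral_mono) (auto simp: abs_mult intro!: mult_right_mono)
  finally show ?thesis by (simp add: \<gamma>_def)
qed

lemma \<gamma>_int: "integrable Q \<gamma>" "integrable Q (\<lambda>y. (\<gamma> y - a)\<^sup>2)"
proof -
  show "integrable Q \<gamma>" by (rule int_bounded[OF _ \<gamma>_bdd]) simp
  define C where "C = Bu * (\<integral>y. \<bar>\<rho> y\<bar> \<partial>Q) + \<bar>a\<bar>"
  have "\<bar>\<gamma> y - a\<bar> \<le> C" for y using \<gamma>_bdd[of y] unfolding C_def by linarith
  then have "(\<gamma> y - a)\<^sup>2 \<le> C\<^sup>2" for y by (rule square_le_of_abs_le)
  then show "integrable Q (\<lambda>y. (\<gamma> y - a)\<^sup>2)" by (intro int_bounded[of _ "C\<^sup>2"]) auto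
qed

lemma uu\<rho>_int: "integrable (Q \<Otimes>\<^sub>M Q) (\<lambda>(x, y). u (x + y) * \<rho> y)"
proof (rule QQ.Fubini_integrable)
  show "AE x in Q. integrable Q (\<lambda>y. case (x, y) of (x, y) \<Rightarrow> u (x + y) * \<rho> y)" using u_shift_int(3) by simp
  have "\<bar>\<integral>y. \<bar>u (x + y) * \<rho> y\<bar> \<partial>Q\<bar> \<le> Bu * (\<integral>y. \<bar>\<rho> y\<bar> \<partial>Q)" for x
  proof -
    have "(\<integral>y. \<bar>u (x + y) * \<rho> y\<bar> \<partial>Q) \<le> (\<integral>y. Bu * \<bar>\<rho> y\<bar> \<partial>Q)"
      using u_bdd \<rho>_int integrable_abs[OF u_shift_int(3)[of x]] by (intro integral_mono) (auto simp: abs_mult intro!: mult_right_mono)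
    then show ?thesis by simp
  qed
  then show "integrable Q (\<lambda>x. \<integral>y. norm (case (x, y) of (x, y) \<Rightarrow> u (x + y) * \<rho> y) \<partial>Q)"
    by (intro int_bounded[of _ "Bu * (\<integral>y. \<bar>\<rho> y\<bar> \<partial>Q)"]) auto
qed measurable

text \<open>Integrate \<open>u (x + y) * \<rho> y\<close> over both variables. Averaging over
  \<open>x\<close> first gives \<open>(g y + c0) * \<rho> y\<close>, where \<open>c0\<close> drops
  out since the score has mean zero; averaging over \<open>y\<close> first gives
  \<open>- \<gamma> x\<close>.\<close>

lemma g\<rho>: "(\<integral>y. g y * \<rho> y \<partial>Q) = - a"
proof -
  have "(\<integral>y. g y * \<rho> y \<partial>Q) = (\<integral>y. (\<integral>x. u (x + y) * \<rho> y \<partial>Q) - c0 * \<rho> y \<partial>Q)"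
    by (simp add: g_def add.commute left_diff_distrib)
  also have "\<dots> = (\<integral>y. (\<integral>x. u (x + y) * \<rho> y \<partial>Q) \<partial>Q) - (\<integral>y. c0 * \<rho> y \<partial>Q)"
    using QQ.integrable_snd[OF uu\<rho>_int] \<rho>_int by (intro Bochner_Integration.integral_diff) auto
  also have "\<dots> = (\<integral>x. (\<integral>y. u (x + y) * \<rho> y \<partial>Q) \<partial>Q)"
    using QQ.Fubini_integral[OF uu\<rho>_int] \<rho>_int by simp
  also have "\<dots> = - a" by (simp add: a_def \<gamma>_def)
  finally show ?thesis .
qed

text \<open>Insert \<open>u (x + y) = c0 + g x + g y + r x y\<close> into \<gamma>. The first two
  terms vanish against the mean-zero score, and \<open>g y\<close> contributes the constant
  \<open>a\<close>. The fluctuation of the derivative of \<open>g\<close> is thus produced by the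
  remainder \<open>r\<close> alone.\<close>

lemma \<gamma>_minus_a: "\<gamma> x - a = - (\<integral>y. r x y * \<rho> y \<partial>Q)"
proof -
  have "(\<integral>y. r x y * \<rho> y \<partial>Q) = (\<integral>y. u (x + y) * \<rho> y - (c0 + g x) * \<rho> y - g y * \<rho> y \<partial>Q)"
    by (simp add: r_def algebra_simps)
  also have "\<dots> = - \<gamma> x + a"
    using u_shift_int(3)[of x] product_int(1) \<rho>_int by (simp add: g\<rho> \<gamma>_def)
  finally show ?thesis by simp
qed

definition U where "U = (\<integral>x. \<integral>y. (r x y)\<^sup>2 \<partial>Q \<partial>Q)"

lemma r_sq_le: "(r x y)\<^sup>2 \<le> Br\<^sup>2"
  by (intro square_le_of_abs_le r_bdd)

lemma r_sq_int: "integrable (Q \<Otimes>\<^sub>M Q) (\<lambda>(x, y). (r x y)\<^sup>2)"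
  by (rule int_bounded2[of _ "Br\<^sup>2"]) (auto simp: r_sq_le)

text \<open>Cauchy-Schwarz in \<open>y\<close> for each fixed \<open>x\<close>; \<open>J\<close> is
  the squared norm of the score and \<open>U\<close> that of the remainder.\<close>

lemma \<gamma>_var_le: "(\<integral>x. (\<gamma> x - a)\<^sup>2 \<partial>Q) \<le> J * U"
proof -
  have "(\<integral>x. (\<gamma> x - a)\<^sup>2 \<partial>Q) \<le> (\<integral>x. (\<integral>y. (r x y)\<^sup>2 \<partial>Q) * J \<partial>Q)"
  proof (rule integral_mono[OF \<gamma>_int(2)])
    show "integrable Q (\<lambda>x. (\<integral>y. (r x y)\<^sup>2 \<partial>Q) * J)"
      using QQ.integrable_fst[OF r_sq_int] by simp
    fix x
    have "integrable Q (\<lambda>y. (r x y)\<^sup>2)" by (rule int_bounded[of _ "Br\<^sup>2"]) (auto simp: r_sq_le)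
    then show "(\<gamma> x - a)\<^sup>2 \<le> (\<integral>y. (r x y)\<^sup>2 \<partial>Q) * J"
      using Cauchy_Schwarz_integral[of "r x" Q \<rho>] \<rho>_sq by (simp add: \<gamma>_minus_a)
  qed
  then show ?thesis by (simp add: U_def mult.commute)
qed

text \<open>Pythagoras for the orthogonal decomposition of \<open>u (x + y)\<close> into
  \<open>c0\<close>, \<open>g x\<close>, \<open>g y\<close> and \<open>r x y\<close>; the square of
  \<open>c0\<close> is discarded.\<close>

lemma U_le: "U \<le> (\<integral>x. \<integral>y. (u (x + y))\<^sup>2 \<partial>Q \<partial>Q) - 2 * (\<integral>y. (g y)\<^sup>2 \<partial>Q)"
proof -
  define A where "A = (\<integral>y. (g y)\<^sup>2 \<partial>Q)"
  have ui: "integrable Q (\<lambda>y. u (x + y))" for x by (rule u_shift_int)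
  have ug: "integrable Q (\<lambda>y. u (x + y) * g y)" for x using u_shift_int(2) g_int by (intro integrable_mult_square) auto
  have inner: "(\<integral>y. (r x y)\<^sup>2 \<partial>Q) = (\<integral>y. (u (x + y))\<^sup>2 \<partial>Q) - 2 * c0 * g x - c0\<^sup>2 - (g x)\<^sup>2 - 2 * (\<integral>y. u (x + y) * g y \<partial>Q) + A" for x
  proof -
    have "(r x y)\<^sup>2 = (u (x + y))\<^sup>2 - 2 * (c0 + g x) * u (x + y) + (c0 + g x)\<^sup>2 - 2 * (u (x + y) * g y) + 2 * (c0 + g x) * g y + (g y)\<^sup>2" for y
      by (simp add: r_def power2_eq_square algebra_simps)
    then have "(\<integral>y. (r x y)\<^sup>2 \<partial>Q) = (\<integral>y. (u (x + y))\<^sup>2 \<partial>Q) - 2 * (c0 + g x) * (\<integral>y. u (x + y) \<partial>Q) + (c0 + g x)\<^sup>2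
        - 2 * (\<integral>y. u (x + y) * g y \<partial>Q) + 2 * (c0 + g x) * (\<integral>y. g y \<partial>Q) + A"
      using ui ug u_shift_int(2) g_int(1,2) by (simp add: A_def Q.prob_space)
    moreover have "(\<integral>y. u (x + y) \<partial>Q) = g x + c0" by (simp add: g_def)
    ultimately show ?thesis by (simp add: g_int(3) power2_eq_square algebra_simps)
  qed
  have ugg: "integrable (Q \<Otimes>\<^sub>M Q) (\<lambda>(x, y). u (x + y) * g y)"
    by (rule int_bounded2[of _ "Bu * Bg"]) (auto simp: abs_mult u_bdd g_bdd intro!: mult_mono)
  have uu: "integrable (Q \<Otimes>\<^sub>M Q) (\<lambda>(x, y). (u (x + y))\<^sup>2)"
    by (rule int_bounded2[of _ "Bu\<^sup>2"]) (auto simp: u_bdd power2_le_iff_abs_le Bu_nonneg)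
  have "(\<integral>x. \<integral>y. u (x + y) * g y \<partial>Q \<partial>Q) = (\<integral>y. \<integral>x. u (x + y) * g y \<partial>Q \<partial>Q)"
    using QQ.Fubini_integral[OF ugg] by simp
  also have "\<dots> = (\<integral>y. (g y + c0) * g y \<partial>Q)"
    by (simp add: g_def add.commute)
  also have "\<dots> = A" using g_int by (simp add: distrib_right power2_eq_square[symmetric] A_def)
  finally have ug2: "(\<integral>x. \<integral>y. u (x + y) * g y \<partial>Q \<partial>Q) = A" .
  have "U = (\<integral>x. \<integral>y. (u (x + y))\<^sup>2 \<partial>Q \<partial>Q) - 2 * c0 * 0 - c0\<^sup>2 - A - 2 * A + A"
    unfolding U_def inner
    using QQ.integrable_fst[OF ugg] QQ.integrable_fst[OF uu] g_int
    by (simp add: ug2 Q.prob_space) (simp add: A_def)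
  then show ?thesis by (simp add: A_def)
qed

lemma \<gamma>_alt: "\<gamma> x = - (\<integral>s. u s * p' (s - x) \<partial>lborel)"
proof -
  have "(\<integral>s. u s * p' (s - x) \<partial>lborel) = (\<integral>y. u (x + y) * p' y \<partial>lborel)"
    by (subst lborel_integral_real_affine[where c=1 and t=x]) auto
  then show ?thesis unfolding \<gamma>_def by (subst integral_Q) (auto simp: p_mult_\<rho> mult.commute)
qed

text \<open>The test function \<open>u\<close> is merely bounded and measurable, so smoothness has
  to come from \<open>p\<close>. Substituting \<open>s = x + y\<close> moves the dependence on
  \<open>x\<close> into \<open>p (s - x)\<close>; Fubini and the fundamental theorem of calculus in
  \<open>x\<close> then give the increments of \<open>g\<close>.\<close>

lemma abs_cont_g: "abs_cont_deriv g \<gamma>"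
  unfolding abs_cont_deriv_def
proof (intro conjI allI impI)
  show "\<gamma> \<in> borel_measurable lborel" by simp
  fix \<alpha> \<beta> :: real assume ab: "\<alpha> \<le> \<beta>"
  have "integrable lborel (\<lambda>x. indicator {\<alpha>..\<beta>} x *\<^sub>R (Bu * (\<integral>y. \<bar>\<rho> y\<bar> \<partial>Q)))" by simp
  then show "set_integrable lborel {\<alpha>..\<beta>} \<gamma>"
    unfolding set_integrable_def
    by (rule Bochner_Integration.integrable_bound) (auto simp: indicator_def intro!: AE_I2 order_trans[OF \<gamma>_bdd])
  have shift: "(\<integral>y. k (x + y) \<partial>lborel) = (\<integral>y. k y \<partial>lborel)" for k :: "real \<Rightarrow> real" and x
    by (subst (2) lborel_integral_real_affine[where c=1 and t=x]) auto
  have g_eq: "g x = (\<integral>s. u s * p (s - x) \<partial>lborel) - c0" for x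
    unfolding g_def using shift[of "\<lambda>s. u s * p (s - x)" x] by (subst integral_Q) (auto simp: mult.commute)
  have up: "integrable lborel (\<lambda>s. u s * k (s - x))" if "integrable lborel k" for k x
    by (rule integrable_bounded_shift(1)[OF prob_Q _ _ u_bdd that]) simp_all
  define h where "h x s = indicator {\<alpha>..\<beta>} x * (u s * p' (s - x))" for x s
  have shift': "(\<integral>s. k (s - x) \<partial>lborel) = (\<integral>s. k s \<partial>lborel)" for k :: "real \<Rightarrow> real" and x
    using shift[of k "-x"] by simp
  have h_int: "integrable (lborel \<Otimes>\<^sub>M lborel) (\<lambda>(x, s). h x s)"
  proof (rule lborel_pair.Fubini_integrable)
    show "(\<lambda>(x, s). h x s) \<in> borel_measurable (lborel \<Otimes>\<^sub>M lborel)" unfolding h_def by measurable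
    show "AE x in lborel. integrable lborel (\<lambda>s. case (x, s) of (x, s) \<Rightarrow> h x s)"
      using up[OF int_p'] by (simp add: h_def)
    show "integrable lborel (\<lambda>x. \<integral>s. norm (case (x, s) of (x, s) \<Rightarrow> h x s) \<partial>lborel)"
    proof (rule Bochner_Integration.integrable_bound)
      show "integrable lborel (\<lambda>x. indicator {\<alpha>..\<beta>} x *\<^sub>R (Bu * (\<integral>s. \<bar>p' s\<bar> \<partial>lborel)))" by simp
      show "(\<lambda>x. \<integral>s. norm (case (x, s) of (x, s) \<Rightarrow> h x s) \<partial>lborel) \<in> borel_measurable lborel"
        unfolding h_def by measurable
      have "(\<integral>s. \<bar>u s * p' (s - x)\<bar> \<partial>lborel) \<le> Bu * (\<integral>s. \<bar>p' s\<bar> \<partial>lborel)" for x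
      proof -
        have "(\<integral>s. \<bar>u s * p' (s - x)\<bar> \<partial>lborel) \<le> (\<integral>s. Bu * \<bar>p' (s - x)\<bar> \<partial>lborel)"
          using integrable_abs[OF up[OF int_p', of x]] lborel_integrable_real_affine[OF int_p', of 1 "-x"] u_bdd
          by (intro integral_mono) (auto simp: abs_mult intro!: mult_right_mono)
        also have "\<dots> = Bu * (\<integral>s. \<bar>p' s\<bar> \<partial>lborel)" using shift'[of "\<lambda>s. \<bar>p' s\<bar>" x] by simp
        finally show ?thesis .
      qed
      then show "AE x in lborel. norm (\<integral>s. norm (case (x, s) of (x, s) \<Rightarrow> h x s) \<partial>lborel) \<le> norm (indicator {\<alpha>..\<beta>} x *\<^sub>R (Bu * (\<integral>s. \<bar>p' s\<bar> \<partial>lborel)))"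
        by (intro AE_I2) (auto simp: h_def indicator_def Bu_nonneg)
    qed
  qed
  have "(LINT x:{\<alpha>..\<beta>}|lborel. \<gamma> x) = - (\<integral>x. \<integral>s. h x s \<partial>lborel \<partial>lborel)"
    unfolding set_lebesgue_integral_def \<gamma>_alt h_def by simp
  also have "\<dots> = - (\<integral>s. \<integral>x. h x s \<partial>lborel \<partial>lborel)"
    using lborel_pair.Fubini_integral[OF h_int] by simp
  also have "\<dots> = - (\<integral>s. u s * (p (s - \<alpha>) - p (s - \<beta>)) \<partial>lborel)"
  proof -
    have "(\<integral>x. h x s \<partial>lborel) = u s * (p (s - \<alpha>) - p (s - \<beta>))" for s
    proof -
      have "((\<lambda>x. - p (s - x)) has_real_derivative p' (s - x)) (at x)" for x
      proof -
        have d: "((\<lambda>x. s - x) has_real_derivative - 1) (at x)" by (auto intro!: derivative_eq_intros)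
        show ?thesis using DERIV_minus[OF DERIV_chain2[OF deriv d]] by simp
      qed
      moreover have "continuous_on {\<alpha>..\<beta>} (\<lambda>x. p' (s - x))"
        using cont' by (rule continuous_on_compose2) (auto intro!: continuous_intros)
      ultimately have "(LINT x:{\<alpha>..\<beta>}|lborel. p' (s - x)) = p (s - \<alpha>) - p (s - \<beta>)"
        using integral_FTC_Icc_cont(2)[OF ab, of "\<lambda>x. - p (s - x)" "\<lambda>x. p' (s - x)"] by simp
      moreover have "(\<integral>x. h x s \<partial>lborel) = u s * (LINT x:{\<alpha>..\<beta>}|lborel. p' (s - x))"
        unfolding h_def set_lebesgue_integral_def by (simp add: mult.left_commute)
      ultimately show ?thesis by simp
    qed
    then show ?thesis by simp
  qed
  also have "\<dots> = g \<beta> - g \<alpha>"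
    using up[OF int_p, of \<alpha>] up[OF int_p, of \<beta>] by (simp add: g_eq right_diff_distrib)
  finally show "g \<beta> - g \<alpha> = (LINT x:{\<alpha>..\<beta>}|lborel. \<gamma> x)" by simp
qed

text \<open>The right-hand side is \<open>E (\<rho> Y + \<rho> Y' - u (Y + Y'))\<^sup>2\<close>. Its part with vanishing marginals
  controls the derivative of \<open>g\<close>, hence by the Poincare inequality the distance of \<open>g\<close> from a linear
  function, while its additive part is the distance of \<open>g\<close> from the score. Both cannot be small: for
  \<open>g = \<rho>\<close> the slope \<open>a\<close> is \<open>- J\<close>, and \<open>\<rho> + J (Y - m)\<close> has squared norm \<open>J (v J - 1)\<close>.\<close>
lemma projection_gap:
  assumes R: "poincare_bound Q R" "0 < R"
  shows "2 * (v * J - 1) / (2 * R + v) \<le> 2 * J + 4 * a + (\<integral>x. \<integral>y. (u (x + y))\<^sup>2 \<partial>Q \<partial>Q)"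
proof -
  define L where "L = v * J - 1"
  define G where "G y = g y - a * (y - m)" for y
  define A where "A = (\<integral>y. (g y)\<^sup>2 \<partial>Q)"
  define b where "b = (\<integral>y. (y - m) * g y \<partial>Q)"
  define q where "q = b - a * v"
  have [measurable]: "G \<in> borel_measurable borel" unfolding G_def[abs_def] by measurable
  have G_ac: "abs_cont_deriv G (\<lambda>y. \<gamma> y - a)"
    unfolding G_def[abs_def] by (rule abs_cont_deriv_affine_diff[OF abs_cont_g])
  have G_mean: "(\<integral>y. G y \<partial>Q) = 0" unfolding G_def using g_int ym_mean by simp
  have G_sq: "integrable Q (\<lambda>y. (G y)\<^sup>2)"
  proof -
    have "(\<lambda>y. (G y)\<^sup>2) = (\<lambda>y. (g y)\<^sup>2 - 2 * a * ((y - m) * g y) + a\<^sup>2 * (y - m)\<^sup>2)"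
      by (rule ext) (simp add: G_def power2_eq_square algebra_simps)
    then show ?thesis using g_int(2) product_int(2) ym_sq by simp
  qed
  have "\<bar>\<gamma> y - a\<bar> \<le> Bu * (\<integral>y. \<bar>\<rho> y\<bar> \<partial>Q) + \<bar>a\<bar>" for y using \<gamma>_bdd[of y] by linarith
  from R(1)[unfolded poincare_bound_def, rule_format, OF G_ac this]
  have "(\<integral>y. (G y)\<^sup>2 \<partial>Q) \<le> R * (\<integral>y. (\<gamma> y - a)\<^sup>2 \<partial>Q)" by (simp add: G_mean)
  also have "\<dots> \<le> R * (J * U)" using R(2) \<gamma>_var_le by (intro mult_left_mono) auto
  finally have G_le: "(\<integral>y. (G y)\<^sup>2 \<partial>Q) \<le> R * (J * U)" .
  have yG: "(\<integral>y. (y - m) * G y \<partial>Q) = q"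
  proof -
    have "(\<lambda>y. (y - m) * G y) = (\<lambda>y. (y - m) * g y - a * (y - m)\<^sup>2)"
      by (rule ext) (simp add: G_def power2_eq_square algebra_simps)
    then show ?thesis using product_int(2) ym_sq by (simp add: q_def b_def v_def)
  qed
  \<comment> \<open>The slope \<open>a\<close> is the one that makes \<open>G\<close> orthogonal to
    the score, since both \<open>g\<close> and \<open>a * (y - m)\<close> have scalar product
    \<open>- a\<close> with it.\<close>
  have \<rho>G: "(\<integral>y. \<rho> y * G y \<partial>Q) = 0"
  proof -
    have "(\<lambda>y. \<rho> y * G y) = (\<lambda>y. g y * \<rho> y - a * ((y - m) * \<rho> y))"
      by (rule ext) (simp add: G_def algebra_simps)
    then show ?thesis using product_int by (simp add: g\<rho> y\<rho>)
  qed
  \<comment> \<open>As \<open>G\<close> is orthogonal to \<rho>, a multiple of \<rho> may be added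
    to \<open>y - m\<close> without changing the product with \<open>G\<close>. The multiple
    \<open>1 / J\<close> makes the sum orthogonal to \<rho>, which gives the least norm,
    \<open>v - 1 / J\<close>.\<close>
  have cs1: "q\<^sup>2 \<le> (v - 1 / J) * (\<integral>y. (G y)\<^sup>2 \<partial>Q)"
  proof -
    have e: "(\<lambda>y. ((y - m) + \<rho> y / J)\<^sup>2) = (\<lambda>y. (y - m)\<^sup>2 + 2 / J * ((y - m) * \<rho> y) + 1 / J\<^sup>2 * (\<rho> y)\<^sup>2)"
      by (rule ext) (simp add: power2_eq_square field_simps J_pos[THEN less_imp_neq, symmetric])
    have n: "integrable Q (\<lambda>y. ((y - m) + \<rho> y / J)\<^sup>2)" unfolding e using ym_sq product_int \<rho>_sq by simp
    have "(\<integral>y. ((y - m) + \<rho> y / J)\<^sup>2 \<partial>Q) = v + 2 / J * (-1) + 1 / J\<^sup>2 * J"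
      unfolding e using ym_sq product_int \<rho>_sq by (simp add: y\<rho> v_def)
    also have "\<dots> = v - 1 / J" using J_pos by (simp add: power2_eq_square field_simps)
    finally have n2: "(\<integral>y. ((y - m) + \<rho> y / J)\<^sup>2 \<partial>Q) = v - 1 / J" .
    have i1: "integrable Q (\<lambda>y. (y - m) * G y)" using ym_sq G_sq by (intro integrable_mult_square) auto
    have i2: "integrable Q (\<lambda>y. \<rho> y * G y)" using \<rho>_sq G_sq by (intro integrable_mult_square) auto
    have "(\<lambda>y. ((y - m) + \<rho> y / J) * G y) = (\<lambda>y. (y - m) * G y + 1 / J * (\<rho> y * G y))"
      by (rule ext) (simp add: algebra_simps)
    then have "(\<integral>y. ((y - m) + \<rho> y / J) * G y \<partial>Q) = q"
      using i1 i2 by (simp add: yG \<rho>G)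
    then show ?thesis using Cauchy_Schwarz_integral[of "\<lambda>y. (y - m) + \<rho> y / J" Q G] n G_sq by (simp add: n2)
  qed
  \<comment> \<open>The vector \<open>(y - m) + v * \<rho>\<close> is the part of
    \<open>v * \<rho>\<close> orthogonal to \<open>y - m\<close>; its squared norm is
    \<open>v * L\<close>. Its product with \<open>g\<close> is \<open>q\<close>, with \<rho> it is
    \<open>L\<close>, so it measures how far \<open>g\<close> is from the score.\<close>
  have cs2: "(q - L)\<^sup>2 \<le> (A + 2 * a + J) * (v * L)"
  proof -
    have e1: "(\<lambda>y. (g y - \<rho> y)\<^sup>2) = (\<lambda>y. (g y)\<^sup>2 - 2 * (g y * \<rho> y) + (\<rho> y)\<^sup>2)"
      by (rule ext) (simp add: power2_eq_square algebra_simps)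
    have n1: "integrable Q (\<lambda>y. (g y - \<rho> y)\<^sup>2)" unfolding e1 using g_int product_int \<rho>_sq by simp
    have v1: "(\<integral>y. (g y - \<rho> y)\<^sup>2 \<partial>Q) = A + 2 * a + J"
      unfolding e1 using g_int product_int \<rho>_sq by (simp add: A_def g\<rho>)
    have e2: "(\<lambda>y. ((y - m) + v * \<rho> y)\<^sup>2) = (\<lambda>y. (y - m)\<^sup>2 + 2 * v * ((y - m) * \<rho> y) + v\<^sup>2 * (\<rho> y)\<^sup>2)"
      by (rule ext) (simp add: power2_eq_square algebra_simps)
    have n2: "integrable Q (\<lambda>y. ((y - m) + v * \<rho> y)\<^sup>2)" unfolding e2 using ym_sq product_int \<rho>_sq by simp
    have v2: "(\<integral>y. ((y - m) + v * \<rho> y)\<^sup>2 \<partial>Q) = v * L"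
      unfolding e2 using ym_sq product_int \<rho>_sq by (simp add: y\<rho> v_def[symmetric]) (simp add: L_def power2_eq_square algebra_simps)
    have e3: "(\<lambda>y. (g y - \<rho> y) * ((y - m) + v * \<rho> y)) =
      (\<lambda>y. (y - m) * g y + v * (g y * \<rho> y) - (y - m) * \<rho> y - v * (\<rho> y)\<^sup>2)"
      by (rule ext) (simp add: power2_eq_square algebra_simps)
    have "(\<integral>y. (g y - \<rho> y) * ((y - m) + v * \<rho> y) \<partial>Q) = q - L"
      unfolding e3 using product_int \<rho>_sq by (simp add: g\<rho> y\<rho> b_def[symmetric]) (simp add: q_def L_def algebra_simps)
    then show ?thesis
      using Cauchy_Schwarz_integral[of "\<lambda>y. g y - \<rho> y" Q "\<lambda>y. (y - m) + v * \<rho> y"] n1 n2 by (simp add: v1 v2)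
  qed
  define Z where "Z = A + 2 * a + J"
  have fin: "2 * J + 4 * a + (\<integral>x. \<integral>y. (u (x + y))\<^sup>2 \<partial>Q \<partial>Q) \<ge> U + 2 * Z"
    using U_le by (simp add: A_def Z_def)
  have U0: "0 \<le> U" by (simp add: U_def)
  have L0: "0 \<le> L" using cramer_rao by (simp add: L_def)
  have Z0: "0 \<le> Z"
  proof -
    have "0 \<le> (\<integral>y. (g y - \<rho> y)\<^sup>2 \<partial>Q)" by simp
    also have "(\<integral>y. (g y - \<rho> y)\<^sup>2 \<partial>Q) = (\<integral>y. (g y)\<^sup>2 - 2 * (g y * \<rho> y) + (\<rho> y)\<^sup>2 \<partial>Q)"
      by (rule Bochner_Integration.integral_cong) (auto simp: power2_eq_square algebra_simps)
    also have "\<dots> = Z" using g_int product_int \<rho>_sq by (simp add: A_def g\<rho> Z_def)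
    finally show ?thesis .
  qed
  have "2 * L / (2 * R + v) \<le> U + 2 * Z"
  proof (cases "L = 0")
    case True
    then show ?thesis using U0 Z0 by simp
  next
    case False
    then have L: "L > 0" using L0 by simp
    have J: "J > 0" and v: "v > 0" by (fact J_pos, fact v_pos)
    have "q\<^sup>2 \<le> (v - 1 / J) * (R * (J * U))"
      using cramer_rao J by (intro order_trans[OF cs1 mult_left_mono[OF G_le]]) (simp add: field_simps)
    also have "\<dots> = L * R * U" using J by (simp add: L_def field_simps)
    finally have q1: "q\<^sup>2 \<le> L * R * U" .
    have q2: "(q - L)\<^sup>2 \<le> v * L * Z" using cs2 by (simp add: Z_def mult_ac)
    have "q\<^sup>2 / (L * R) \<le> U" using q1 L R(2) by (simp add: field_simps)
    moreover have "2 * ((q - L)\<^sup>2 / (v * L)) \<le> 2 * Z" using q2 L v by (simp add: field_simps)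
    \<comment> \<open>The right side is a quadratic in \<open>q\<close> whose minimum, at
      \<open>q = 2 * R * L / (2 * R + v)\<close>, equals the left side; the difference is the
      completed square displayed below.\<close>
    moreover have "2 * L / (2 * R + v) \<le> q\<^sup>2 / (L * R) + 2 * ((q - L)\<^sup>2 / (v * L))"
    proof -
      have "q\<^sup>2 / (L * R) + 2 * ((q - L)\<^sup>2 / (v * L)) - 2 * L / (2 * R + v)
         = ((v + 2 * R) * q - 2 * R * L)\<^sup>2 / (R * v * L * (2 * R + v))"
        using L v R(2) add_pos_pos[of "2 * R" v]
        by (simp add: divide_simps) (simp add: power2_eq_square algebra_simps)
      also have "\<dots> \<ge> 0" using L v R(2) by simp
      finally show ?thesis by simp
    qed
    ultimately show ?thesis by linarith
  qed
  then show ?thesis using fin by (simp add: L_def)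
qed

end

section \<open>Poincare inequalities\<close>

lemma abs_cont_deriv_diff_const:
  "abs_cont_deriv G G' \<Longrightarrow> abs_cont_deriv (\<lambda>x. G x - c) G'"
  unfolding abs_cont_deriv_def by auto

lemma lipschitz_integrable:
  fixes \<mu> :: "real measure"
  assumes \<mu>: "prob_space \<mu>" "sets \<mu> = sets borel" "integrable \<mu> (\<lambda>x. x\<^sup>2)"
    and G: "abs_cont_deriv G G'" "\<And>x. \<bar>G' x\<bar> \<le> B"
  shows "integrable \<mu> (\<lambda>x. (G (x + z))\<^sup>2)" "integrable \<mu> (\<lambda>x. G (x + z))"
    "integrable \<mu> (\<lambda>x. (G (x + z) - c)\<^sup>2)"
proof -
  interpret prob_space \<mu> by fact
  note \<mu>(2)[measurable_cong]
  have [measurable]: "G \<in> borel_measurable borel" by (rule abs_cont_deriv_measurable[OF G])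
  have bound: "(G (x + z))\<^sup>2 \<le> 2 * (G z)\<^sup>2 + 2 * B\<^sup>2 * x\<^sup>2" for x
  proof -
    have "\<bar>G (x + z)\<bar> \<le> \<bar>G z\<bar> + B * \<bar>x\<bar>" using abs_cont_deriv_lipschitz[OF G, of "x + z" z] by simp
    then have "(G (x + z))\<^sup>2 \<le> (\<bar>G z\<bar> + B * \<bar>x\<bar>)\<^sup>2" by (rule square_le_of_abs_le)
    also have "\<dots> \<le> 2 * (G z)\<^sup>2 + 2 * (B * \<bar>x\<bar>)\<^sup>2"
      using sum_squares_bound[of "\<bar>G z\<bar>" "B * \<bar>x\<bar>"] by (simp add: power2_sum)
    finally show ?thesis by (simp add: power_mult_distrib)
  qed
  show 1: "integrable \<mu> (\<lambda>x. (G (x + z))\<^sup>2)"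
  proof (rule Bochner_Integration.integrable_bound)
    show "integrable \<mu> (\<lambda>x. 2 * (G z)\<^sup>2 + 2 * B\<^sup>2 * x\<^sup>2)" using \<mu>(3) by simp
    show "AE x in \<mu>. norm ((G (x + z))\<^sup>2) \<le> norm (2 * (G z)\<^sup>2 + 2 * B\<^sup>2 * x\<^sup>2)"
      using bound by (auto intro!: AE_I2 order_trans[OF _ abs_ge_self])
  qed measurable
  then show 2: "integrable \<mu> (\<lambda>x. G (x + z))"
    using integrable_mult_square[of "\<lambda>x. G (x + z)" \<mu> "\<lambda>_. 1"] by simp
  show "integrable \<mu> (\<lambda>x. (G (x + z) - c)\<^sup>2)" using 1 2 by (simp add: power2_diff)
qed

text \<open>A bounded-derivative test function, centred, is one of the competitors in the supremum
  unless its variance \<open>V\<close> is zero, in which case the bound is trivial.\<close>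

lemma poincare_bound_of_const:
  assumes M: "prob_space M" and X[measurable]: "X \<in> borel_measurable M" and X2: "integrable M (\<lambda>\<omega>. (X \<omega>)\<^sup>2)"
    and R: "poincare_const M X = ennreal R" "0 \<le> R"
  shows "poincare_bound (distr M borel X) R"
  unfolding poincare_bound_def
proof (intro allI impI)
  interpret prob_space M by fact
  fix G G' :: "real \<Rightarrow> real" and B assume G: "abs_cont_deriv G G'" and B: "\<forall>x. \<bar>G' x\<bar> \<le> B"
  define \<mu> where "\<mu> = distr M borel X"
  have [measurable]: "G \<in> borel_measurable borel" using abs_cont_deriv_measurable[OF G] B by blast
  have [measurable]: "G' \<in> borel_measurable borel" using G by (simp add: abs_cont_deriv_def)
  interpret \<mu>: prob_space \<mu> unfolding \<mu>_def by (rule prob_space_distr) simp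
  have \<mu>2: "integrable \<mu> (\<lambda>x. x\<^sup>2)" unfolding \<mu>_def using X2 by (subst integrable_distr_eq) auto
  have [simp]: "sets \<mu> = sets borel" by (simp add: \<mu>_def)
  define c where "c = (\<integral>y. G y \<partial>\<mu>)"
  note int = lipschitz_integrable[OF \<mu>.prob_space_axioms _ \<mu>2 G B[rule_format], of 0, simplified]
  define h where "h x = G x - c" for x
  have [measurable]: "h \<in> borel_measurable borel" unfolding h_def[abs_def] by measurable
  have h: "abs_cont_deriv h G'" unfolding h_def[abs_def] by (rule abs_cont_deriv_diff_const[OF G])
  have h1: "integrable \<mu> h" unfolding h_def[abs_def] using int(2) by simp
  have h0: "(\<integral>x. h x \<partial>\<mu>) = 0" unfolding h_def using int(2) \<mu>.prob_space by (simp add: c_def)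
  have h2: "integrable \<mu> (\<lambda>x. (h x)\<^sup>2)" unfolding h_def by (rule int(3))
  have G'2: "integrable \<mu> (\<lambda>x. (G' x)\<^sup>2)"
    using B by (intro \<mu>.integrable_const_bound[of _ "B\<^sup>2"]) (auto simp: \<mu>_def intro!: square_le_of_abs_le)
  have tr: "integrable M (\<lambda>\<omega>. k (X \<omega>))" "(\<integral>\<omega>. k (X \<omega>) \<partial>M) = (\<integral>x. k x \<partial>\<mu>)" if "integrable \<mu> k" for k :: "real \<Rightarrow> real"
  proof -
    have [measurable]: "k \<in> borel_measurable borel" using that by (simp add: \<mu>_def)
    show "integrable M (\<lambda>\<omega>. k (X \<omega>))" using that unfolding \<mu>_def by (subst (asm) integrable_distr_eq) auto
    show "(\<integral>\<omega>. k (X \<omega>) \<partial>M) = (\<integral>x. k x \<partial>\<mu>)" unfolding \<mu>_def by (subst integral_distr) auto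
  qed
  define V where "V = (\<integral>x. (h x)\<^sup>2 \<partial>\<mu>)"
  define W where "W = (\<integral>x. (G' x)\<^sup>2 \<partial>\<mu>)"
  have VW: "0 \<le> V" "0 \<le> W" by (simp_all add: V_def W_def)
  have "V \<le> R * W"
  proof (cases "V = 0")
    case True then show ?thesis using VW R by simp
  next
    case False
    then have V: "V > 0" using VW by simp
    have nV: "(\<integral>\<^sup>+\<omega>. ennreal ((h (X \<omega>))\<^sup>2) \<partial>M) = ennreal V"
      using tr[OF h2] by (subst nn_integral_eq_integral) (auto simp: V_def)
    have nW: "(\<integral>\<^sup>+\<omega>. ennreal ((G' (X \<omega>))\<^sup>2) \<partial>M) = ennreal W"
      using tr[OF G'2] by (subst nn_integral_eq_integral) (auto simp: W_def)
    have "(\<integral>\<^sup>+\<omega>. ennreal ((fst (h, G') (X \<omega>))\<^sup>2) \<partial>M) / (\<integral>\<^sup>+\<omega>. ennreal ((snd (h, G') (X \<omega>))\<^sup>2) \<partial>M) \<le> poincare_const M X"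
      unfolding poincare_const_def
      using h tr[OF h1] tr[OF h2] V h0 by (intro SUP_upper) (auto simp: V_def)
    then have le: "ennreal V / ennreal W \<le> ennreal R" by (simp add: nV nW R)
    \<comment> \<open>Positive variance with zero derivative energy would make the quotient infinite
      in \<open>ennreal\<close>, against the finiteness of the supremum.\<close>
    have W: "W > 0"
    proof (rule ccontr)
      assume "\<not> W > 0"
      then have "ennreal V / ennreal W = \<infinity>" using VW V by (simp add: ennreal_divide_zero)
      then show False using le by (simp add: top_unique)
    qed
    then have "V / W \<le> R" using le V R by (simp add: divide_ennreal)
    then show ?thesis using W by (simp add: field_simps)
  qed
  then show "(\<integral>x. (G x - (\<integral>y. G y \<partial>distr M borel X))\<^sup>2 \<partial>distr M borel X) \<le> R * (\<integral>x. (G' x)\<^sup>2 \<partial>distr M borel X)"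
    by (simp add: V_def W_def h_def c_def \<mu>_def)
qed

section \<open>Poincare inequalities for the Gaussian and for convolutions\<close>

definition normal_measure :: "real \<Rightarrow> real measure" where
  "normal_measure t = density lborel (\<lambda>x. ennreal (normal_density 0 (sqrt t) x))"

lemma sets_normal_measure[measurable_cong, simp]: "sets (normal_measure t) = sets borel"
  and space_normal_measure[simp]: "space (normal_measure t) = UNIV"
  by (simp_all add: normal_measure_def)

lemma prob_normal_measure: "0 < t \<Longrightarrow> prob_space (normal_measure t)"
  unfolding normal_measure_def by (rule prob_space_normal_density) simp

lemma normal_measure_moments:
  assumes "0 < t"
  shows "integrable (normal_measure t) (\<lambda>x. x\<^sup>2)" "(\<integral>x. x\<^sup>2 \<partial>normal_measure t) = t"
    "integrable (normal_measure t) (\<lambda>x. x)" "(\<integral>x. x \<partial>normal_measure t) = 0"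
proof -
  show "integrable (normal_measure t) (\<lambda>x. x\<^sup>2)" unfolding normal_measure_def
    using integrable_normal_moment[of "sqrt t" 0 2] assms by (subst integrable_density) auto
  show "(\<integral>x. x\<^sup>2 \<partial>normal_measure t) = t" unfolding normal_measure_def
    using integral_normal_moment_even[of "sqrt t" 0 1] assms by (subst integral_density) auto
  show "integrable (normal_measure t) (\<lambda>x. x)" unfolding normal_measure_def
    using integrable_normal_moment[of "sqrt t" 0 1] assms by (subst integrable_density) auto
  show "(\<integral>x. x \<partial>normal_measure t) = 0" unfolding normal_measure_def
    using integral_normal_moment_odd[of "sqrt t" 0 0] assms by (subst integral_density) auto
qed

lemma normal_density_deriv:
  assumes "0 < t"
  shows "(normal_density 0 (sqrt t) has_real_derivative - (z / t) * normal_density 0 (sqrt t) z) (at z)"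
  unfolding normal_density_def[abs_def] using assms
  by (auto intro!: derivative_eq_intros simp: field_simps power2_eq_square)

lemma normal_tail_mean:
  assumes t: "0 < t"
  shows "(\<integral>x. x * indicator {s<..} x \<partial>normal_measure t) = t * normal_density 0 (sqrt t) s"
proof -
  let ?k = "normal_density 0 (sqrt t)"
  have cont: "isCont ?k x" for x using normal_density_deriv[OF t, of x] by (rule DERIV_isCont)
  have int: "integrable lborel (\<lambda>x. x * ?k x)" using integrable_normal_moment[of "sqrt t" 0 1] t by (simp add: mult.commute)
  have "(LBINT x=ereal s..\<infinity>. x * ?k x) = 0 - (- t * ?k s)"
  proof (rule interval_integral_FTC_integrable)
    show "((\<lambda>x. - t * ?k x) has_vector_derivative x * ?k x) (at x)" for x
      using DERIV_cmult[OF normal_density_deriv[OF t, of x], of "- t"] t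
      by (simp add: has_real_derivative_iff_has_vector_derivative)
    show "isCont (\<lambda>x. x * ?k x) x" for x by (intro continuous_intros cont)
    show "set_integrable lborel (einterval (ereal s) \<infinity>) (\<lambda>x. x * ?k x)"
      using int unfolding set_integrable_def by (intro integrable_mult_indicator) auto
    show "(((\<lambda>x. - t * ?k x) \<circ> real_of_ereal) \<longlongrightarrow> - t * ?k s) (at_right (ereal s))"
      using cont[of s] by (simp add: ereal_tendsto_simps isCont_def) (auto intro!: tendsto_intros intro: tendsto_within_subset)
    have "(?k \<longlongrightarrow> 0) at_top" unfolding normal_density_def[abs_def] using t by real_asymp
    then show "(((\<lambda>x. - t * ?k x) \<circ> real_of_ereal) \<longlongrightarrow> 0) (at_left \<infinity>)"
      by (simp add: ereal_tendsto_simps) (auto intro!: tendsto_eq_intros)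
  qed simp
  then have *: "(LINT x:{s<..}|lborel. x * ?k x) = t * ?k s" by (simp add: interval_integral_to_infinity_eq)
  have "(\<integral>x. x * indicator {s<..} x \<partial>normal_measure t) = (\<integral>x. ?k x * (x * indicator {s<..} x) \<partial>lborel)"
    unfolding normal_measure_def by (subst integral_density) auto
  also have "\<dots> = (LINT x:{s<..}|lborel. x * ?k x)" unfolding set_lebesgue_integral_def
    by (intro Bochner_Integration.integral_cong) auto
  finally show ?thesis using * by simp
qed

text \<open>This is the total weight received by a point \<open>s\<close> when the squared increment
  of a function over the segment between two independent Gaussian points is bounded by the length of
  the segment times the energy on it. It is proportional to the Gaussian density at
  \<open>s\<close>, which makes \<open>t\<close> the Poincare constant. The calculation uses the
  first absolute moments on the two sides of \<open>s\<close> and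
  \<open>normal_tail_mean\<close>.\<close>

lemma normal_crossing:
  assumes t: "0 < t"
  shows "(\<integral>\<^sup>+x. \<integral>\<^sup>+y. ennreal (\<bar>x - y\<bar> * (if min x y \<le> s \<and> s \<le> max x y then 1 else 0)) \<partial>normal_measure t \<partial>normal_measure t)
     \<le> ennreal (2 * t * normal_density 0 (sqrt t) s)"
proof -
  let ?N = "normal_measure t"
  interpret N: prob_space ?N using t by (rule prob_normal_measure)
  define P where "P x = max (x - s) 0" for x
  define M where "M x = max (s - x) 0" for x
  define A where "A x = indicat_real {..s} x" for x
  define C where "C x = indicat_real {s..} x" for x
  have [measurable]: "P \<in> borel_measurable borel" "M \<in> borel_measurable borel" "A \<in> borel_measurable borel" "C \<in> borel_measurable borel"
    unfolding P_def[abs_def] M_def[abs_def] A_def[abs_def] C_def[abs_def] by measurable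
  have nn: "0 \<le> P x" "0 \<le> M x" "0 \<le> A x" "0 \<le> C x" for x by (auto simp: P_def M_def A_def C_def)
  note mom = normal_measure_moments[OF t]
  have Pi: "integrable ?N P" unfolding P_def[abs_def] using mom(3) by (intro integrable_max) auto
  have Mi: "integrable ?N M" unfolding M_def[abs_def] using mom(3) by (intro integrable_max) auto
  have Ai: "integrable ?N A" unfolding A_def[abs_def] by (intro integrable_real_indicator) (auto simp: N.emeasure_eq_measure)
  have Ci: "integrable ?N C" unfolding C_def[abs_def] by (intro integrable_real_indicator) (auto simp: N.emeasure_eq_measure)
  define p where "p = (\<integral>x. P x \<partial>?N)"
  define mm where "mm = (\<integral>x. M x \<partial>?N)"
  define \<alpha> where "\<alpha> = (\<integral>x. A x \<partial>?N)"
  define \<beta> where "\<beta> = (\<integral>x. C x \<partial>?N)"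
  have no_atom: "AE x in ?N. x \<noteq> s"
    unfolding normal_measure_def by (subst AE_density) (use AE_lborel_singleton[of s] in \<open>auto elim!: eventually_mono\<close>)
  have ab: "\<alpha> + \<beta> = 1"
  proof -
    have "\<alpha> + \<beta> = (\<integral>x. A x + C x \<partial>?N)" using Ai Ci by (simp add: \<alpha>_def \<beta>_def)
    also have "\<dots> = (\<integral>x. 1 \<partial>?N)"
      by (rule integral_cong_AE) (use no_atom in \<open>auto simp: A_def C_def indicator_def elim!: eventually_mono\<close>)
    finally show ?thesis using N.prob_space by simp
  qed
  have pm: "p - mm = - s"
  proof -
    have "p - mm = (\<integral>x. P x - M x \<partial>?N)" using Pi Mi by (simp add: p_def mm_def)
    also have "\<dots> = (\<integral>x. x - s \<partial>?N)"
      by (rule Bochner_Integration.integral_cong) (auto simp: P_def M_def)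
    finally show ?thesis using mom N.prob_space by simp
  qed
  have tail: "p + s * \<beta> = t * normal_density 0 (sqrt t) s"
  proof -
    have "p + s * \<beta> = (\<integral>x. P x + s * C x \<partial>?N)" using Pi Ci by (simp add: p_def \<beta>_def)
    also have "\<dots> = (\<integral>x. x * indicator {s<..} x \<partial>?N)"
      by (rule integral_cong_AE) (use no_atom in \<open>auto simp: P_def C_def indicator_def elim!: eventually_mono\<close>)
    finally show ?thesis using normal_tail_mean[OF t] by simp
  qed
  have ni: "(\<integral>\<^sup>+x. ennreal (h x) \<partial>?N) = ennreal (\<integral>x. h x \<partial>?N)" if "integrable ?N h" "\<And>x. 0 \<le> h x" for h
    using that by (intro nn_integral_eq_integral) auto
  \<comment> \<open>If \<open>s\<close> separates the points, their distance is the distance of one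
    above \<open>s\<close> plus that of the other below; the four products list these contributions
    for both orders and factor over the two variables.\<close>
  have "(\<integral>\<^sup>+x. \<integral>\<^sup>+y. ennreal (\<bar>x - y\<bar> * (if min x y \<le> s \<and> s \<le> max x y then 1 else 0)) \<partial>?N \<partial>?N)
     \<le> (\<integral>\<^sup>+x. \<integral>\<^sup>+y. ennreal (P x * A y + C x * M y + M x * C y + A x * P y) \<partial>?N \<partial>?N)"
    by (intro nn_integral_mono ennreal_leI) (auto simp: P_def A_def C_def M_def indicator_def min_def max_def)
  also have "\<dots> = (\<integral>\<^sup>+x. ennreal (\<alpha> * P x + mm * C x + \<beta> * M x + p * A x) \<partial>?N)"
  proof (rule nn_integral_cong)
    fix x
    have "(\<integral>\<^sup>+y. ennreal (P x * A y + C x * M y + M x * C y + A x * P y) \<partial>?N)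
       = ennreal (\<integral>y. P x * A y + C x * M y + M x * C y + A x * P y \<partial>?N)"
      using Pi Mi Ai Ci nn by (intro ni) auto
    also have "(\<integral>y. P x * A y + C x * M y + M x * C y + A x * P y \<partial>?N) = P x * \<alpha> + C x * mm + M x * \<beta> + A x * p"
      using Pi Mi Ai Ci by (simp add: \<alpha>_def mm_def \<beta>_def p_def)
    finally show "(\<integral>\<^sup>+y. ennreal (P x * A y + C x * M y + M x * C y + A x * P y) \<partial>?N) = ennreal (\<alpha> * P x + mm * C x + \<beta> * M x + p * A x)"
      by (simp add: mult.commute)
  qed
  also have "\<dots> = ennreal (\<integral>x. \<alpha> * P x + mm * C x + \<beta> * M x + p * A x \<partial>?N)"
    using Pi Mi Ai Ci nn by (intro ni) (auto simp: \<alpha>_def \<beta>_def p_def mm_def intro!: add_nonneg_nonneg mult_nonneg_nonneg integral_nonneg_AE)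
  also have "(\<integral>x. \<alpha> * P x + mm * C x + \<beta> * M x + p * A x \<partial>?N) = 2 * (\<alpha> * p + mm * \<beta>)"
    using Pi Mi Ai Ci by (simp add: \<alpha>_def[symmetric] \<beta>_def[symmetric] p_def[symmetric] mm_def[symmetric])
  also have "\<alpha> * p + mm * \<beta> = p + s * \<beta>"
  proof -
    have "mm = p + s" using pm by simp
    then have "\<alpha> * p + mm * \<beta> = (\<alpha> + \<beta>) * p + s * \<beta>" by (simp add: algebra_simps)
    then show ?thesis by (simp add: ab)
  qed
  finally show ?thesis by (simp add: tail mult.assoc)
qed

lemma abs_cont_deriv_shift:
  assumes G: "abs_cont_deriv G G'"
  shows "abs_cont_deriv (\<lambda>x. G (x + z)) (\<lambda>x. G' (x + z))"
  unfolding abs_cont_deriv_def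
proof (intro conjI allI impI)
  have [measurable]: "G' \<in> borel_measurable borel" using G by (simp add: abs_cont_deriv_def)
  show "(\<lambda>x. G' (x + z)) \<in> borel_measurable lborel" by measurable
  fix a b :: real assume "a \<le> b"
  then have s: "set_integrable lborel {a + z..b + z} G'" "G (b + z) - G (a + z) = (LINT x:{a + z..b + z}|lborel. G' x)"
    using G by (auto simp: abs_cont_deriv_def)
  have ind: "indicator {a + z..b + z} (x + z) = indicat_real {a..b} x" for x by (auto simp: indicator_def)
  show "set_integrable lborel {a..b} (\<lambda>x. G' (x + z))"
    using lborel_integrable_real_affine[OF s(1)[unfolded set_integrable_def], of 1 z]
    by (simp add: set_integrable_def ind add.commute[of z])
  have "(LINT x:{a + z..b + z}|lborel. G' x) = (LINT x:{a..b}|lborel. G' (x + z))"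
    unfolding set_lebesgue_integral_def
    by (subst lborel_integral_real_affine[where c=1 and t=z]) (auto simp: ind add.commute[of z])
  then show "G (b + z) - G (a + z) = (LINT x:{a..b}|lborel. G' (x + z))" using s(2) by simp
qed

text \<open>Cauchy-Schwarz for the derivative against 1 on the segment from \<open>x\<close> to
  \<open>y\<close>. The segment is encoded as a condition on \<open>s\<close> so that integration
  over the endpoints can later be carried out first.\<close>

lemma abs_cont_deriv_diff_square_le:
  assumes G: "abs_cont_deriv G G'" and B: "\<And>x. \<bar>G' x\<bar> \<le> B"
  shows "ennreal ((G x - G y)\<^sup>2) \<le>
    (\<integral>\<^sup>+s. ennreal ((G' s)\<^sup>2) * ennreal (\<bar>x - y\<bar> * (if min x y \<le> s \<and> s \<le> max x y then 1 else 0)) \<partial>lborel)"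
proof -
  have [measurable]: "G' \<in> borel_measurable borel" using G by (simp add: abs_cont_deriv_def)
  have *: "ennreal ((G b - G a)\<^sup>2) \<le> (\<integral>\<^sup>+s. ennreal ((G' s)\<^sup>2) * ennreal ((b - a) * indicat_real {a..b} s) \<partial>lborel)" if ab: "a \<le> b" for a b
  proof -
    let ?i = "indicat_real {a..b}"
    have i2: "(?i s)\<^sup>2 = ?i s" for s by (simp add: indicator_def)
    have "integrable lborel (\<lambda>s. B\<^sup>2 * ?i s)" by simp
    then have I: "integrable lborel (\<lambda>s. (G' s * ?i s)\<^sup>2)"
      by (rule Bochner_Integration.integrable_bound)
        (auto simp: power_mult_distrib i2 intro!: AE_I2 mult_right_mono square_le_of_abs_le B)
    have gd: "G b - G a = (\<integral>s. (G' s * ?i s) * ?i s \<partial>lborel)"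
      using G ab unfolding abs_cont_deriv_def set_lebesgue_integral_def
      by (auto intro!: Bochner_Integration.integral_cong simp: indicator_def)
    have "(G b - G a)\<^sup>2 \<le> (\<integral>s. (G' s * ?i s)\<^sup>2 \<partial>lborel) * (\<integral>s. (?i s)\<^sup>2 \<partial>lborel)"
      unfolding gd using I by (intro Cauchy_Schwarz_integral) (auto simp: i2)
    also have "\<dots> = (\<integral>s. (G' s)\<^sup>2 * ((b - a) * ?i s) \<partial>lborel)"
      using ab by (simp add: i2 power_mult_distrib mult.left_commute mult.commute)
    finally have "ennreal ((G b - G a)\<^sup>2) \<le> ennreal (\<integral>s. (G' s)\<^sup>2 * ((b - a) * ?i s) \<partial>lborel)" by (rule ennreal_leI)
    also have "\<dots> = (\<integral>\<^sup>+s. ennreal ((G' s)\<^sup>2 * ((b - a) * ?i s)) \<partial>lborel)"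
    proof (rule nn_integral_eq_integral[symmetric])
      have "integrable lborel (\<lambda>s. (b - a) * (G' s * ?i s)\<^sup>2)" using I by simp
      then show "integrable lborel (\<lambda>s. (G' s)\<^sup>2 * ((b - a) * ?i s))"
        by (simp add: i2 power_mult_distrib mult_ac)
    qed (use ab in auto)
    finally show ?thesis using ab by (simp add: ennreal_mult')
  qed
  show ?thesis
  proof (cases "x \<le> y")
    case True
    then show ?thesis using *[OF True]
      by (simp add: min_absorb1 max_absorb2 power2_commute[of "G x"] indicator_def of_bool_def abs_minus_commute[of x])
  next
    case False
    then have yx: "y \<le> x" by simp
    show ?thesis using *[OF yx] yx
      by (simp add: min_absorb2 max_absorb1 indicator_def of_bool_def)
  qed
qed

text \<open>Twice the variance of \<open>G\<close> is the mean squared difference of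
  \<open>G\<close> at two independent points. Bound it by
  \<open>abs_cont_deriv_diff_square_le\<close>, exchange the integrals, and
  \<open>normal_crossing\<close> leaves \<open>2 * t\<close> times the energy.\<close>

lemma poincare_bound_normal:
  assumes t: "0 < t"
  shows "poincare_bound (normal_measure t) t"
  unfolding poincare_bound_def
proof (intro allI impI)
  let ?N = "normal_measure t"
  let ?k = "normal_density 0 (sqrt t)"
  interpret N: prob_space ?N using t by (rule prob_normal_measure)
  interpret NN: pair_prob_space ?N ?N ..
  interpret NL: pair_sigma_finite ?N lborel ..
  fix G G' :: "real \<Rightarrow> real" and B assume G: "abs_cont_deriv G G'" and B: "\<forall>x. \<bar>G' x\<bar> \<le> B"
  have [measurable]: "G \<in> borel_measurable borel" using abs_cont_deriv_measurable[OF G] B by blast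
  have [measurable]: "G' \<in> borel_measurable borel" using G by (simp add: abs_cont_deriv_def)
  define c where "c = (\<integral>y. G y \<partial>?N)"
  define V where "V = (\<integral>x. (G x - c)\<^sup>2 \<partial>?N)"
  note int = lipschitz_integrable[OF N.prob_space_axioms _ normal_measure_moments(1)[OF t] G B[rule_format], of 0, simplified]
  have G'2: "integrable ?N (\<lambda>x. (G' x)\<^sup>2)"
    using B by (intro N.integrable_const_bound[of _ "B\<^sup>2"]) (auto intro!: square_le_of_abs_le)
  have V2: "(\<integral>\<^sup>+y. ennreal ((G x - G y)\<^sup>2) \<partial>?N) = ennreal ((G x - c)\<^sup>2 + V)" for x
  proof -
    have e: "(G x - G y)\<^sup>2 = (G x - c)\<^sup>2 - 2 * (G x - c) * (G y - c) + (G y - c)\<^sup>2" for y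
      by (simp add: power2_eq_square algebra_simps)
    have "(\<integral>y. (G x - G y)\<^sup>2 \<partial>?N) = (G x - c)\<^sup>2 + V"
      unfolding e using int N.prob_space by (simp add: V_def c_def)
    moreover have "integrable ?N (\<lambda>y. (G x - G y)\<^sup>2)" unfolding e using int by simp
    ultimately show ?thesis by (subst nn_integral_eq_integral) auto
  qed
  have V0: "0 \<le> V" by (simp add: V_def)
  have "ennreal (2 * V) = (\<integral>\<^sup>+x. \<integral>\<^sup>+y. ennreal ((G x - G y)\<^sup>2) \<partial>?N \<partial>?N)"
  proof -
    have "(\<integral>\<^sup>+x. ennreal ((G x - c)\<^sup>2 + V) \<partial>?N) = ennreal (\<integral>x. (G x - c)\<^sup>2 + V \<partial>?N)"
      using int V0 by (intro nn_integral_eq_integral) auto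
    also have "(\<integral>x. (G x - c)\<^sup>2 + V \<partial>?N) = 2 * V" using int N.prob_space by (simp add: V_def)
    finally show ?thesis by (simp add: V2)
  qed
  also have "\<dots> \<le> (\<integral>\<^sup>+x. \<integral>\<^sup>+y. \<integral>\<^sup>+s. ennreal ((G' s)\<^sup>2) * ennreal (\<bar>x - y\<bar> * (if min x y \<le> s \<and> s \<le> max x y then 1 else 0)) \<partial>lborel \<partial>?N \<partial>?N)"
    by (intro nn_integral_mono abs_cont_deriv_diff_square_le[OF G B[rule_format]])
  also have "\<dots> = (\<integral>\<^sup>+x. \<integral>\<^sup>+s. \<integral>\<^sup>+y. ennreal ((G' s)\<^sup>2) * ennreal (\<bar>x - y\<bar> * (if min x y \<le> s \<and> s \<le> max x y then 1 else 0)) \<partial>?N \<partial>lborel \<partial>?N)"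
    by (intro nn_integral_cong NL.Fubini'[symmetric]) measurable
  also have "\<dots> = (\<integral>\<^sup>+s. \<integral>\<^sup>+x. \<integral>\<^sup>+y. ennreal ((G' s)\<^sup>2) * ennreal (\<bar>x - y\<bar> * (if min x y \<le> s \<and> s \<le> max x y then 1 else 0)) \<partial>?N \<partial>?N \<partial>lborel)"
    by (intro NL.Fubini'[symmetric]) measurable
  also have "\<dots> = (\<integral>\<^sup>+s. ennreal ((G' s)\<^sup>2) * (\<integral>\<^sup>+x. \<integral>\<^sup>+y. ennreal (\<bar>x - y\<bar> * (if min x y \<le> s \<and> s \<le> max x y then 1 else 0)) \<partial>?N \<partial>?N) \<partial>lborel)"
    by (simp add: nn_integral_cmult)
  also have "\<dots> \<le> (\<integral>\<^sup>+s. ennreal ((G' s)\<^sup>2) * ennreal (2 * t * ?k s) \<partial>lborel)"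
    by (intro nn_integral_mono mult_left_mono normal_crossing t) auto
  also have "\<dots> = (\<integral>\<^sup>+s. ennreal (?k s) * ennreal (2 * t * (G' s)\<^sup>2) \<partial>lborel)"
    using t by (intro nn_integral_cong) (simp add: ennreal_mult[symmetric] mult_ac)
  also have "\<dots> = (\<integral>\<^sup>+s. ennreal (2 * t * (G' s)\<^sup>2) \<partial>?N)"
    unfolding normal_measure_def by (subst nn_integral_density) auto
  also have "\<dots> = ennreal (\<integral>s. 2 * t * (G' s)\<^sup>2 \<partial>?N)"
    using G'2 t by (intro nn_integral_eq_integral) auto
  finally have "2 * V \<le> 2 * t * (\<integral>s. (G' s)\<^sup>2 \<partial>?N)"
    using t by (subst (asm) ennreal_le_iff) auto
  then show "(\<integral>x. (G x - (\<integral>y. G y \<partial>?N))\<^sup>2 \<partial>?N) \<le> t * (\<integral>x. (G' x)\<^sup>2 \<partial>?N)"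
    by (simp add: V_def c_def)
qed

text \<open>Total variance: given \<open>z\<close>, the variance over \<open>x\<close> is bounded by
  \<open>R\<close> times the conditional energy, and the conditional mean \<open>H\<close> has
  variance at most \<open>t\<close> times the energy of its derivative \<open>h\<close>. By
  Cauchy-Schwarz the square of \<open>h\<close> is at most the conditional mean of the square of
  \<open>G'\<close>.\<close>

lemma poincare_bound_convolution:
  fixes \<mu> :: "real measure"
  assumes \<mu>: "prob_space \<mu>" "sets \<mu> = sets borel" "integrable \<mu> (\<lambda>x. x\<^sup>2)"
    and N: "prob_space N" "sets N = sets borel" "integrable N (\<lambda>x. x\<^sup>2)"
    and pb: "poincare_bound \<mu> R" "poincare_bound N t" "0 \<le> t"
  shows "poincare_bound (distr (\<mu> \<Otimes>\<^sub>M N) borel (\<lambda>(x, z). x + z)) (R + t)"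
  unfolding poincare_bound_def
proof (intro allI impI)
  interpret \<mu>: prob_space \<mu> by fact
  interpret N: prob_space N by fact
  interpret MN: pair_prob_space \<mu> N ..
  interpret MB: pair_sigma_finite \<mu> lborel ..
  note \<mu>(2)[measurable_cong] N(2)[measurable_cong]
  have [simp]: "space \<mu> = UNIV" "space N = UNIV" using sets_eq_imp_space_eq[OF \<mu>(2)] sets_eq_imp_space_eq[OF N(2)] by simp_all
  define \<nu> where "\<nu> = distr (\<mu> \<Otimes>\<^sub>M N) borel (\<lambda>(x, z). x + z)"
  fix G G' :: "real \<Rightarrow> real" and B assume G: "abs_cont_deriv G G'" and B: "\<forall>x. \<bar>G' x\<bar> \<le> B"
  have Gm[measurable]: "G \<in> borel_measurable borel" using abs_cont_deriv_measurable[OF G] B by blast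
  have G'm[measurable]: "G' \<in> borel_measurable borel" using G by (simp add: abs_cont_deriv_def)
  have lip: "\<bar>G x - G y\<bar> \<le> B * \<bar>x - y\<bar>" for x y by (rule abs_cont_deriv_lipschitz[OF G B[rule_format]])
  define c where "c = (\<integral>y. G y \<partial>\<nu>)"
  note int = lipschitz_integrable[OF \<mu> G B[rule_format]]
  define H where "H z = (\<integral>x. G (x + z) \<partial>\<mu>)" for z
  define h where "h z = (\<integral>x. G' (x + z) \<partial>\<mu>)" for z
  have [measurable]: "H \<in> borel_measurable borel" "h \<in> borel_measurable borel"
    unfolding H_def[abs_def] h_def[abs_def] by measurable
  have G'i: "integrable \<mu> (\<lambda>x. G' (x + z))" "integrable \<mu> (\<lambda>x. (G' (x + z))\<^sup>2)" for z
  proof -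
    show "integrable \<mu> (\<lambda>x. G' (x + z))" using B by (intro \<mu>.integrable_const_bound[of _ B]) auto
    show "integrable \<mu> (\<lambda>x. (G' (x + z))\<^sup>2)"
      using B by (intro \<mu>.integrable_const_bound[of _ "B\<^sup>2"] AE_I2) (auto intro!: square_le_of_abs_le)
  qed
  have h_bdd: "\<bar>h z\<bar> \<le> B" for z
  proof -
    have "\<bar>h z\<bar> \<le> (\<integral>x. \<bar>G' (x + z)\<bar> \<partial>\<mu>)" unfolding h_def by (rule integral_abs_bound)
    also have "\<dots> \<le> (\<integral>x. B \<partial>\<mu>)" using B integrable_abs[OF G'i(1)] by (intro integral_mono) auto
    finally show ?thesis using \<mu>.prob_space by simp
  qed
  have H_ac: "abs_cont_deriv H h"
    unfolding abs_cont_deriv_def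
  proof (intro conjI allI impI)
    fix a b :: real assume ab: "a \<le> b"
    have "integrable lborel (\<lambda>z. B * indicat_real {a..b} z)" by simp
    then show "set_integrable lborel {a..b} h" unfolding set_integrable_def
      by (rule Bochner_Integration.integrable_bound) (use h_bdd in \<open>auto simp: indicator_def intro!: AE_I2 order_trans[OF _ abs_ge_self]\<close>)
    have F: "integrable (\<mu> \<Otimes>\<^sub>M lborel) (\<lambda>(x, z). indicator {a..b} z *\<^sub>R G' (x + z))"
    proof (rule MB.Fubini_integrable)
      have i: "integrable lborel (\<lambda>z. indicator {a..b} z *\<^sub>R G' (x + z))" for x
        using abs_cont_deriv_shift[OF G, of x] ab by (simp add: abs_cont_deriv_def set_integrable_def add.commute)
      then show "AE x in \<mu>. integrable lborel (\<lambda>z. case (x, z) of (x, z) \<Rightarrow> indicator {a..b} z *\<^sub>R G' (x + z))" by simp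
      have "\<bar>\<integral>z. norm (indicator {a..b} z *\<^sub>R G' (x + z)) \<partial>lborel\<bar> \<le> B * (b - a)" for x
      proof -
        have "(\<integral>z. norm (indicator {a..b} z *\<^sub>R G' (x + z)) \<partial>lborel) \<le> (\<integral>z. B * indicat_real {a..b} z \<partial>lborel)"
        proof (rule integral_mono)
          show "integrable lborel (\<lambda>z. norm (indicator {a..b} z *\<^sub>R G' (x + z)))" by (rule integrable_norm[OF i])
          show "norm (indicator {a..b} z *\<^sub>R G' (x + z)) \<le> B * indicat_real {a..b} z" for z
            using B by (simp add: indicator_def)
        qed simp
        then show ?thesis using ab by (simp add: abs_mult)
      qed
      then show "integrable \<mu> (\<lambda>x. \<integral>z. norm (case (x, z) of (x, z) \<Rightarrow> indicator {a..b} z *\<^sub>R G' (x + z)) \<partial>lborel)"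
        by (intro \<mu>.integrable_const_bound[of _ "B * (b - a)"]) auto
    qed measurable
    have "H b - H a = (\<integral>x. G (x + b) - G (x + a) \<partial>\<mu>)" unfolding H_def using int(2) by simp
    also have "\<dots> = (\<integral>x. \<integral>z. indicator {a..b} z *\<^sub>R G' (x + z) \<partial>lborel \<partial>\<mu>)"
      using abs_cont_deriv_shift[OF G] ab
      by (intro Bochner_Integration.integral_cong) (auto simp: abs_cont_deriv_def set_lebesgue_integral_def add.commute)
    also have "\<dots> = (\<integral>z. \<integral>x. indicator {a..b} z *\<^sub>R G' (x + z) \<partial>\<mu> \<partial>lborel)"
      using MB.Fubini_integral[OF F] by simp
    also have "\<dots> = (LINT z:{a..b}|lborel. h z)" unfolding set_lebesgue_integral_def h_def by simp
    finally show "H b - H a = (LINT z:{a..b}|lborel. h z)" .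
  qed simp
  have \<nu>_int: "(\<integral>y. k y \<partial>\<nu>) = (\<integral>z. \<integral>x. k (x + z) \<partial>\<mu> \<partial>N)" if k: "integrable (\<mu> \<Otimes>\<^sub>M N) (\<lambda>(x, z). k (x + z))" and [measurable]: "k \<in> borel_measurable borel" for k :: "real \<Rightarrow> real"
  proof -
    have "(\<integral>y. k y \<partial>\<nu>) = (\<integral>w. k (fst w + snd w) \<partial>(\<mu> \<Otimes>\<^sub>M N))" unfolding \<nu>_def
      by (subst integral_distr) (auto simp: case_prod_beta')
    also have "\<dots> = (\<integral>z. \<integral>x. k (x + z) \<partial>\<mu> \<partial>N)" using MN.integral_snd[OF k] by (simp add: case_prod_beta')
    finally show ?thesis .
  qed
  have sq: "integrable (\<mu> \<Otimes>\<^sub>M N) (\<lambda>(x, z). (G (x + z) - d)\<^sup>2)" for d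
  proof (rule Bochner_Integration.integrable_bound)
    show "integrable (\<mu> \<Otimes>\<^sub>M N) (\<lambda>(x, z). 2 * (G 0 - d)\<^sup>2 + 2 * B\<^sup>2 * (x + z)\<^sup>2)"
      using integrable_pair_sum_square[OF \<mu>(1) N(1) \<mu>(2) N(2) \<mu>(3) N(3), of 0] by (simp add: case_prod_beta')
    have "(G (x + z) - d)\<^sup>2 \<le> 2 * (G 0 - d)\<^sup>2 + 2 * B\<^sup>2 * (x + z)\<^sup>2" for x z
    proof -
      have "\<bar>G (x + z) - d\<bar> \<le> \<bar>G 0 - d\<bar> + B * \<bar>x + z\<bar>" using lip[of "x + z" 0] by simp
      then have "(G (x + z) - d)\<^sup>2 \<le> (\<bar>G 0 - d\<bar> + B * \<bar>x + z\<bar>)\<^sup>2" by (rule square_le_of_abs_le)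
      also have "\<dots> \<le> 2 * (G 0 - d)\<^sup>2 + 2 * (B * \<bar>x + z\<bar>)\<^sup>2"
        using sum_squares_bound[of "\<bar>G 0 - d\<bar>" "B * \<bar>x + z\<bar>"] by (simp add: power2_sum)
      finally show ?thesis by (simp add: power_mult_distrib)
    qed
    then show "AE w in \<mu> \<Otimes>\<^sub>M N. norm (case w of (x, z) \<Rightarrow> (G (x + z) - d)\<^sup>2) \<le> norm (case w of (x, z) \<Rightarrow> 2 * (G 0 - d)\<^sup>2 + 2 * B\<^sup>2 * (x + z)\<^sup>2)"
      by (intro AE_I2) (auto intro!: order_trans[OF _ abs_ge_self])
  qed measurable
  have G1: "integrable (\<mu> \<Otimes>\<^sub>M N) (\<lambda>(x, z). G (x + z))"
    using MN.square_integrable_imp_integrable[of "\<lambda>(x, z). G (x + z)"] sq[of 0] by (simp add: case_prod_beta')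
  have G'2: "integrable (\<mu> \<Otimes>\<^sub>M N) (\<lambda>(x, z). (G' (x + z))\<^sup>2)"
    using B by (intro MN.integrable_const_bound[of _ "B\<^sup>2"] AE_I2) (auto intro!: square_le_of_abs_le)
  have Hc: "(\<integral>z. H z \<partial>N) = c" unfolding c_def H_def using \<nu>_int[OF G1] by simp
  have H2: "integrable N (\<lambda>z. (H z - c)\<^sup>2)"
    using lipschitz_integrable(3)[OF N H_ac h_bdd, of 0 c] by simp
  have h2: "integrable N (\<lambda>z. (h z)\<^sup>2)"
    by (intro N.integrable_const_bound[of _ "B\<^sup>2"]) (auto intro!: square_le_of_abs_le h_bdd)
  define W where "W = (\<integral>z. \<integral>x. (G' (x + z))\<^sup>2 \<partial>\<mu> \<partial>N)"
  have W_int: "integrable N (\<lambda>z. \<integral>x. (G' (x + z))\<^sup>2 \<partial>\<mu>)" using MN.integrable_snd[OF G'2] by simp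
  have inner: "(\<integral>x. (G (x + z) - c)\<^sup>2 \<partial>\<mu>) \<le> R * (\<integral>x. (G' (x + z))\<^sup>2 \<partial>\<mu>) + (H z - c)\<^sup>2" for z
  proof -
    have "(\<lambda>x. (G (x + z) - c)\<^sup>2) = (\<lambda>x. (G (x + z) - H z)\<^sup>2 + 2 * (H z - c) * (G (x + z) - H z) + (H z - c)\<^sup>2)"
      by (rule ext) (simp add: power2_eq_square algebra_simps)
    then have "(\<integral>x. (G (x + z) - c)\<^sup>2 \<partial>\<mu>) = (\<integral>x. (G (x + z) - H z)\<^sup>2 \<partial>\<mu>) + (H z - c)\<^sup>2"
      using int \<mu>.prob_space by (simp add: H_def)
    moreover have "(\<integral>x. (G (x + z) - H z)\<^sup>2 \<partial>\<mu>) \<le> R * (\<integral>x. (G' (x + z))\<^sup>2 \<partial>\<mu>)"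
      unfolding H_def using pb(1)[unfolded poincare_bound_def, rule_format, OF abs_cont_deriv_shift[OF G]] B by blast
    ultimately show ?thesis by simp
  qed
  have "(\<integral>y. (G y - c)\<^sup>2 \<partial>\<nu>) = (\<integral>z. \<integral>x. (G (x + z) - c)\<^sup>2 \<partial>\<mu> \<partial>N)" by (rule \<nu>_int[OF sq]) simp
  also have "\<dots> \<le> (\<integral>z. R * (\<integral>x. (G' (x + z))\<^sup>2 \<partial>\<mu>) + (H z - c)\<^sup>2 \<partial>N)"
    using MN.integrable_snd[OF sq[of c]] W_int H2 inner by (intro integral_mono) auto
  also have "\<dots> = R * W + (\<integral>z. (H z - c)\<^sup>2 \<partial>N)" using W_int H2 by (simp add: W_def)
  also have "(\<integral>z. (H z - c)\<^sup>2 \<partial>N) \<le> t * (\<integral>z. (h z)\<^sup>2 \<partial>N)"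
    using pb(2)[unfolded poincare_bound_def, rule_format, OF H_ac h_bdd] by (simp add: Hc)
  also have "(\<integral>z. (h z)\<^sup>2 \<partial>N) \<le> W"
    unfolding W_def
  proof (rule integral_mono[OF h2 W_int])
    fix z
    show "(h z)\<^sup>2 \<le> (\<integral>x. (G' (x + z))\<^sup>2 \<partial>\<mu>)"
      unfolding h_def using Cauchy_Schwarz_integral[of "\<lambda>x. G' (x + z)" \<mu> "\<lambda>_. 1"] G'i \<mu>.prob_space by simp
  qed
  finally have "(\<integral>y. (G y - c)\<^sup>2 \<partial>\<nu>) \<le> R * W + t * W" using pb(3) by (simp add: mult_left_mono)
  moreover have "W = (\<integral>y. (G' y)\<^sup>2 \<partial>\<nu>)" unfolding W_def using \<nu>_int[OF G'2] by simp
  ultimately show "(\<integral>x. (G x - (\<integral>y. G y \<partial>distr (\<mu> \<Otimes>\<^sub>M N) borel (\<lambda>(x, z). x + z)))\<^sup>2 \<partial>distr (\<mu> \<Otimes>\<^sub>M N) borel (\<lambda>(x, z). x + z))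
      \<le> (R + t) * (\<integral>x. (G' x)\<^sup>2 \<partial>distr (\<mu> \<Otimes>\<^sub>M N) borel (\<lambda>(x, z). x + z))"
    by (simp add: c_def \<nu>_def distrib_right)
qed

section \<open>Heat flow\<close>

abbreviation hk :: "real \<Rightarrow> real \<Rightarrow> real" where "hk t z \<equiv> normal_density 0 (sqrt t) z"

lemma abs_le_one_plus_square: "\<bar>q\<bar> \<le> 1 + q\<^sup>2" for q :: real
proof -
  have "0 \<le> (\<bar>q\<bar> - 1)\<^sup>2" by simp
  then have "2 * \<bar>q\<bar> \<le> 1 + q\<^sup>2" by (simp add: power2_diff)
  then show ?thesis using abs_ge_zero[of q] by linarith
qed

lemma hk_measurable_comp[measurable]:
  assumes [measurable]: "a \<in> borel_measurable M" "b \<in> borel_measurable M"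
  shows "(\<lambda>w. hk (a w) (b w)) \<in> borel_measurable M"
  unfolding normal_density_def by measurable

lemma hk_le: "0 < t \<Longrightarrow> hk t z \<le> 1 / sqrt (2 * pi * t)"
  by (simp add: normal_density_def divide_right_mono)

lemma hk_deriv1:
  assumes "0 < t"
  shows "((\<lambda>y. hk t (y - x)) has_real_derivative - ((y - x) / t) * hk t (y - x)) (at y)"
proof -
  have d: "((\<lambda>y. y - x) has_real_derivative 1) (at y)" by (auto intro!: derivative_eq_intros)
  show ?thesis using DERIV_chain2[OF normal_density_deriv[OF assms] d] by simp
qed

lemma hk_deriv2:
  assumes "0 < t"
  shows "((\<lambda>y. - ((y - x) / t) * hk t (y - x)) has_real_derivative (((y - x) / t)\<^sup>2 - 1 / t) * hk t (y - x)) (at y)"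
proof -
  have d: "((\<lambda>y. - ((y - x) / t)) has_real_derivative - (1 / t)) (at y)"
    using assms by (auto intro!: derivative_eq_intros)
  show ?thesis
    by (rule DERIV_cong[OF DERIV_mult[OF d hk_deriv1[OF assms]]])
      (use assms in \<open>simp add: power2_eq_square field_simps\<close>)
qed

text \<open>The heat equation, with the factor 1/2 that comes from using the variance as
  time.\<close>

lemma hk_deriv_t:
  assumes t: "0 < t"
  shows "((\<lambda>t. hk t z) has_real_derivative ((z / t)\<^sup>2 - 1 / t) * hk t z / 2) (at t)"
proof -
  have D: "((\<lambda>t. 1 / sqrt (2 * pi * t) * exp (- z\<^sup>2 / (2 * t))) has_real_derivative
     ((z / t)\<^sup>2 - 1 / t) * (1 / sqrt (2 * pi * t) * exp (- z\<^sup>2 / (2 * t))) / 2) (at t)"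
  proof -
    have s: "sqrt (2 * pi * t) \<noteq> 0" "sqrt (2 * pi * t) * sqrt (2 * pi * t) = 2 * pi * t" using t by auto
    have d1: "((\<lambda>t. sqrt (2 * pi * t)) has_real_derivative (2 * pi) * (inverse (sqrt (2 * pi * t)) / 2)) (at t)"
    proof -
      have lin: "((\<lambda>t. 2 * pi * t) has_real_derivative 2 * pi) (at t)" by (auto intro!: derivative_eq_intros)
      have "2 * pi * t > 0" using t by simp
      from DERIV_chain2[where f=sqrt and g="\<lambda>t. 2 * pi * t" and x=t, OF DERIV_real_sqrt[OF this] lin] show ?thesis
        by (simp add: mult.commute)
    qed
    have d2: "((\<lambda>t. 1 / sqrt (2 * pi * t)) has_real_derivative - (1 / (2 * t)) * (1 / sqrt (2 * pi * t))) (at t)"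
      by (rule derivative_eq_intros d1 s | simp)+ (use t s in \<open>simp add: field_simps\<close>)
    have d3: "((\<lambda>t. exp (- z\<^sup>2 / (2 * t))) has_real_derivative exp (- z\<^sup>2 / (2 * t)) * (z\<^sup>2 / (2 * t\<^sup>2))) (at t)"
      using t by (auto intro!: derivative_eq_intros simp: power2_eq_square field_simps)
    show ?thesis
      using DERIV_mult[OF d2 d3] t by (simp add: field_simps power2_eq_square)
  qed
  have "\<forall>\<^sub>F t in nhds t. hk t z = 1 / sqrt (2 * pi * t) * exp (- z\<^sup>2 / (2 * t))"
    using t eventually_nhds_in_open[of "{0<..}" t] by (auto elim!: eventually_mono simp: normal_density_def)
  then show ?thesis
    using D t by (subst DERIV_cong_ev[OF refl _ refl]) (auto simp: normal_density_def)
qed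

text \<open>Uniformly for \<open>t\<close> in \<open>[a, b]\<close>, the Gaussian kernel and its first two derivatives are at most \<open>hC a b\<close>
  times the kernel of variance \<open>2 b\<close>: the wider kernel absorbs the polynomial factors.\<close>
definition hC :: "real \<Rightarrow> real \<Rightarrow> real" where "hC a b = (1 + 5 / a) * sqrt (2 * b / a)"

lemma hk_bounds:
  assumes a: "0 < a" "a \<le> t" "t \<le> b"
  shows "hk t z \<le> hC a b * hk (2 * b) z" "\<bar>- (z / t) * hk t z\<bar> \<le> hC a b * hk (2 * b) z"
    "\<bar>((z / t)\<^sup>2 - 1 / t) * hk t z\<bar> \<le> hC a b * hk (2 * b) z"
proof -
  \<comment> \<open>The exponent of the kernel is \<open>- 2 * w\<close>. One factor
    \<open>exp (- w)\<close> is spent on the polynomial terms, and the other, since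
    \<open>t \<le> b\<close>, is bounded by the exponential in the kernel of variance
    \<open>2 * b\<close>.\<close>
  define w where "w = z\<^sup>2 / (4 * t)"
  have t: "0 < t" "0 < b" using a by auto
  have w0: "0 \<le> w" using t by (simp add: w_def)
  have we: "w * exp (- w) \<le> 1"
  proof -
    have "w \<le> exp w" using exp_ge_add_one_self[of w] by linarith
    then show ?thesis by (simp add: exp_minus field_simps)
  qed
  have e1: "exp (- w) \<le> 1" using w0 by simp
  have zt: "(z / t)\<^sup>2 = 4 * w / t" using t by (simp add: w_def power2_eq_square)
  have it: "1 / t \<le> 1 / a" using a by (simp add: frac_le)
  have c2: "(z / t)\<^sup>2 * exp (- w) \<le> 4 / a"
  proof -
    have "(z / t)\<^sup>2 * exp (- w) = 4 * (1 / t) * (w * exp (- w))" by (simp add: zt)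
    also have "\<dots> \<le> 4 * (1 / t) * 1" using we t by (intro mult_left_mono) auto
    also have "\<dots> \<le> 4 / a" using it by simp
    finally show ?thesis .
  qed
  have main: "hk t z \<le> exp (- w) * (sqrt (2 * b / a) * hk (2 * b) z)"
  proof -
    have "hk t z = exp (- w) * (1 / sqrt (2 * pi * t) * exp (- w))"
      using t by (simp add: normal_density_def w_def mult_exp_exp field_simps)
    also have "\<dots> \<le> exp (- w) * (1 / sqrt (2 * pi * a) * exp (- z\<^sup>2 / (4 * b)))"
    proof (intro mult_left_mono mult_mono)
      show "1 / sqrt (2 * pi * t) \<le> 1 / sqrt (2 * pi * a)" using a by (intro divide_left_mono) auto
      have "z\<^sup>2 / (4 * b) \<le> z\<^sup>2 / (4 * t)" using a t by (intro divide_left_mono) auto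
      then show "exp (- w) \<le> exp (- z\<^sup>2 / (4 * b))" by (simp add: w_def)
    qed (use a in auto)
    also have "1 / sqrt (2 * pi * a) * exp (- z\<^sup>2 / (4 * b)) = sqrt (2 * b / a) * hk (2 * b) z"
    proof -
      have "1 / sqrt (2 * pi * a) = sqrt (2 * b / a) * (1 / sqrt (2 * pi * (2 * b)))"
        using a t by (simp add: real_sqrt_mult real_sqrt_divide field_simps)
      then show ?thesis using t by (simp add: normal_density_def)
    qed
    finally show ?thesis .
  qed
  define K where "K = sqrt (2 * b / a) * hk (2 * b) z"
  have K0: "0 \<le> K" using a t by (simp add: K_def)
  have hk0: "0 \<le> hk t z" by simp
  have gen: "c * hk t z \<le> hC a b * hk (2 * b) z" if c: "0 \<le> c" "c * exp (- w) \<le> 1 + 5 / a" for c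
  proof -
    have "c * hk t z \<le> c * (exp (- w) * K)" using main c by (intro mult_left_mono) (auto simp: K_def)
    also have "\<dots> = (c * exp (- w)) * K" by simp
    also have "\<dots> \<le> (1 + 5 / a) * K" using c K0 by (intro mult_right_mono) auto
    finally show ?thesis by (simp add: hC_def K_def mult_ac)
  qed
  \<comment> \<open>The number \<open>4 / a\<close> bounds the square term and \<open>1 / a\<close>
    bounds \<open>1 / t\<close>, giving \<open>5 / a\<close> for the second derivative; the added 1
    covers the kernel and the first derivative.\<close>
  have a5: "0 < 5 / a" "4 / a < 5 / a" "4 / a + 1 / a * 1 \<le> 1 + 5 / a"
    using a by (auto simp: divide_strict_right_mono add_divide_distrib[symmetric])
  show "hk t z \<le> hC a b * hk (2 * b) z" using gen[of 1] e1 a5 by simp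
  have "\<bar>z / t\<bar> * exp (- w) \<le> (1 + (z / t)\<^sup>2) * exp (- w)"
    by (intro mult_right_mono abs_le_one_plus_square) auto
  also have "\<dots> \<le> 1 + 4 / a" using e1 c2 by (simp only: distrib_right mult_1)
  also have "\<dots> \<le> 1 + 5 / a" using a5 by linarith
  finally show "\<bar>- (z / t) * hk t z\<bar> \<le> hC a b * hk (2 * b) z"
    using gen[of "\<bar>z / t\<bar>"] by (simp add: abs_mult)
  have "\<bar>(z / t)\<^sup>2 - 1 / t\<bar> \<le> (z / t)\<^sup>2 + 1 / t" using t by (simp add: abs_le_iff)
  then have "\<bar>(z / t)\<^sup>2 - 1 / t\<bar> * exp (- w) \<le> ((z / t)\<^sup>2 + 1 / t) * exp (- w)" by (intro mult_right_mono) auto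
  also have "\<dots> \<le> 4 / a + 1 / a * 1"
    unfolding distrib_right using c2 e1 it t a by (intro add_mono mult_mono) auto
  also have "\<dots> \<le> 1 + 5 / a" by (rule a5(3))
  finally show "\<bar>((z / t)\<^sup>2 - 1 / t) * hk t z\<bar> \<le> hC a b * hk (2 * b) z"
    using gen[of "\<bar>(z / t)\<^sup>2 - 1 / t\<bar>"] by (simp add: abs_mult)
qed

lemma hC_nonneg: "0 < a \<Longrightarrow> a \<le> b \<Longrightarrow> 0 \<le> hC a b"
  by (simp add: hC_def)

text \<open>The density of \<open>X + sqrt t N\<close> for \<open>X\<close> with law \<open>\<mu>\<close>, and its first two space derivatives.\<close>
definition heat :: "real measure \<Rightarrow> real \<Rightarrow> real \<Rightarrow> real" where
  "heat \<mu> t y = (\<integral>x. hk t (y - x) \<partial>\<mu>)"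

definition heat1 :: "real measure \<Rightarrow> real \<Rightarrow> real \<Rightarrow> real" where
  "heat1 \<mu> t y = (\<integral>x. - ((y - x) / t) * hk t (y - x) \<partial>\<mu>)"

definition heat2 :: "real measure \<Rightarrow> real \<Rightarrow> real \<Rightarrow> real" where
  "heat2 \<mu> t y = (\<integral>x. (((y - x) / t)\<^sup>2 - 1 / t) * hk t (y - x) \<partial>\<mu>)"

definition fisher :: "real measure \<Rightarrow> real \<Rightarrow> real" where
  "fisher \<mu> t = (\<integral>y. (heat1 \<mu> t y)\<^sup>2 / heat \<mu> t y \<partial>lborel)"

locale heat_flow =
  fixes \<mu> :: "real measure"
  assumes prob: "prob_space \<mu>" and sets_eq[measurable_cong, simp]: "sets \<mu> = sets borel"
    and sq_int: "integrable \<mu> (\<lambda>x. x\<^sup>2)"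
begin

sublocale prob_space \<mu> by (rule prob)

lemma space_eq[simp]: "space \<mu> = UNIV" using sets_eq_imp_space_eq[OF sets_eq] by simp

definition M2 where "M2 = (\<integral>x. x\<^sup>2 \<partial>\<mu>)"
definition mean where "mean = (\<integral>x. x \<partial>\<mu>)"
definition var where "var = (\<integral>x. (x - mean)\<^sup>2 \<partial>\<mu>)"

lemma lin_int: "integrable \<mu> (\<lambda>x. x)"
  using square_integrable_imp_integrable[OF _ sq_int] by simp

lemma meas_heat[measurable]:
  "(\<lambda>w. heat \<mu> (fst w) (snd w)) \<in> borel_measurable (borel \<Otimes>\<^sub>M borel)"
  "(\<lambda>w. heat1 \<mu> (fst w) (snd w)) \<in> borel_measurable (borel \<Otimes>\<^sub>M borel)"
  "(\<lambda>w. heat2 \<mu> (fst w) (snd w)) \<in> borel_measurable (borel \<Otimes>\<^sub>M borel)"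
  unfolding heat_def heat1_def heat2_def by measurable

lemma meas_heat'[measurable]: "heat \<mu> t \<in> borel_measurable borel" "heat1 \<mu> t \<in> borel_measurable borel"
  "heat2 \<mu> t \<in> borel_measurable borel"
  unfolding heat_def[abs_def] heat1_def[abs_def] heat2_def[abs_def] by measurable

lemma kernel_const_bounds:
  assumes "0 < a" "a \<le> t" "t \<le> b"
  shows "\<bar>hk t z\<bar> \<le> hC a b * (1 / sqrt (2 * pi * (2 * b)))" "\<bar>- (z / t) * hk t z\<bar> \<le> hC a b * (1 / sqrt (2 * pi * (2 * b)))"
    "\<bar>((z / t)\<^sup>2 - 1 / t) * hk t z\<bar> \<le> hC a b * (1 / sqrt (2 * pi * (2 * b)))"
proof -
  have "hC a b * hk (2 * b) z \<le> hC a b * (1 / sqrt (2 * pi * (2 * b)))"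
    using assms by (intro mult_left_mono hk_le hC_nonneg) auto
  note le = order_trans[OF _ this]
  show "\<bar>hk t z\<bar> \<le> hC a b * (1 / sqrt (2 * pi * (2 * b)))"
    using hk_bounds(1)[OF assms, of z] by (intro le) simp
  show "\<bar>- (z / t) * hk t z\<bar> \<le> hC a b * (1 / sqrt (2 * pi * (2 * b)))"
    by (intro le hk_bounds assms)
  show "\<bar>((z / t)\<^sup>2 - 1 / t) * hk t z\<bar> \<le> hC a b * (1 / sqrt (2 * pi * (2 * b)))"
    by (intro le hk_bounds assms)
qed

lemma kernel_int:
  assumes t: "0 < t"
  shows "integrable \<mu> (\<lambda>x. hk t (y - x))" "integrable \<mu> (\<lambda>x. - ((y - x) / t) * hk t (y - x))"
    "integrable \<mu> (\<lambda>x. (((y - x) / t)\<^sup>2 - 1 / t) * hk t (y - x))"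
proof -
  note b = kernel_const_bounds[OF t order.refl order.refl]
  show "integrable \<mu> (\<lambda>x. hk t (y - x))" by (rule integrable_const_bound[OF AE_I2[OF b(1)[folded real_norm_def]]]) measurable
  show "integrable \<mu> (\<lambda>x. - ((y - x) / t) * hk t (y - x))" by (rule integrable_const_bound[OF AE_I2[OF b(2)[folded real_norm_def]]]) measurable
  show "integrable \<mu> (\<lambda>x. (((y - x) / t)\<^sup>2 - 1 / t) * hk t (y - x))" by (rule integrable_const_bound[OF AE_I2[OF b(3)[folded real_norm_def]]]) measurable
qed

lemma heat_deriv_y:
  assumes t: "0 < t"
  shows "(heat \<mu> t has_real_derivative heat1 \<mu> t y) (at y)" "(heat1 \<mu> t has_real_derivative heat2 \<mu> t y) (at y)"
proof -
  note b = kernel_const_bounds[OF t order.refl order.refl]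
  show "(heat \<mu> t has_real_derivative heat1 \<mu> t y) (at y)"
    unfolding heat_def[abs_def] heat1_def
  proof (rule has_derivative_integral_bounded[where l="y - 1" and u="y + 1" and \<phi>="\<lambda>y x. hk t (y - x)", OF finite_measure_axioms])
    show "((\<lambda>s. hk t (s - x)) has_real_derivative - ((s - x) / t) * hk t (s - x)) (at s)" for x s
      by (rule hk_deriv1[OF t])
    show "\<bar>- ((s - x) / t) * hk t (s - x)\<bar> \<le> hC t t * (1 / sqrt (2 * pi * (2 * t)))" for x s by (rule b(2))
    show "integrable \<mu> (\<lambda>x. hk t (s - x))" for s by (rule kernel_int(1)[OF t])
  qed simp_all
  show "(heat1 \<mu> t has_real_derivative heat2 \<mu> t y) (at y)"
    unfolding heat1_def[abs_def] heat2_def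
  proof (rule has_derivative_integral_bounded[where l="y - 1" and u="y + 1" and \<phi>="\<lambda>y x. - ((y - x) / t) * hk t (y - x)", OF finite_measure_axioms])
    show "((\<lambda>s. - ((s - x) / t) * hk t (s - x)) has_real_derivative (((s - x) / t)\<^sup>2 - 1 / t) * hk t (s - x)) (at s)" for x s
      by (rule hk_deriv2[OF t])
    show "\<bar>(((s - x) / t)\<^sup>2 - 1 / t) * hk t (s - x)\<bar> \<le> hC t t * (1 / sqrt (2 * pi * (2 * t)))" for x s by (rule b(3))
    show "integrable \<mu> (\<lambda>x. - ((s - x) / t) * hk t (s - x))" for s by (rule kernel_int(2)[OF t])
  qed simp_all
qed

lemma heat_deriv_t:
  assumes t: "0 < t"
  shows "((\<lambda>t. heat \<mu> t y) has_real_derivative heat2 \<mu> t y / 2) (at t)"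
proof -
  have b: "\<bar>((z / s)\<^sup>2 - 1 / s) * hk s z / 2\<bar> \<le> hC (t / 2) (2 * t) * (1 / sqrt (2 * pi * (2 * (2 * t)))) / 2"
    if "t / 2 < s" "s < 2 * t" for s z
  proof -
    have "\<bar>((z / s)\<^sup>2 - 1 / s) * hk s z\<bar> / 2 \<le> hC (t / 2) (2 * t) * (1 / sqrt (2 * pi * (2 * (2 * t)))) / 2"
      using kernel_const_bounds(3)[of "t / 2" s "2 * t" z] that t by (intro divide_right_mono) auto
    then show ?thesis by simp
  qed
  have "((\<lambda>t. heat \<mu> t y) has_real_derivative (\<integral>x. (((y - x) / t)\<^sup>2 - 1 / t) * hk t (y - x) / 2 \<partial>\<mu>)) (at t)"
    unfolding heat_def
  proof (rule has_derivative_integral_bounded[where l="t / 2" and u="2 * t" and \<phi>="\<lambda>t x. hk t (y - x)", OF finite_measure_axioms])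
    show "\<bar>(((y - x) / s)\<^sup>2 - 1 / s) * hk s (y - x) / 2\<bar> \<le> hC (t / 2) (2 * t) * (1 / sqrt (2 * pi * (2 * (2 * t)))) / 2"
      if "t / 2 < s" "s < 2 * t" for x s by (rule b[OF that])
    show "((\<lambda>t. hk t (y - x)) has_real_derivative (((y - x) / s)\<^sup>2 - 1 / s) * hk s (y - x) / 2) (at s)" if "t / 2 < s" for x s
      using that t by (intro hk_deriv_t) simp
    show "integrable \<mu> (\<lambda>x. hk s (y - x))" if "t / 2 < s" for s using that t by (intro kernel_int(1)) simp
  qed (use t in simp_all)
  then show ?thesis by (simp add: heat2_def)
qed

lemma heat_cont_y:
  assumes t: "0 < t"
  shows "continuous_on UNIV (heat \<mu> t)" "continuous_on UNIV (heat1 \<mu> t)" "continuous_on UNIV (heat2 \<mu> t)"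
proof -
  show "continuous_on UNIV (heat \<mu> t)" "continuous_on UNIV (heat1 \<mu> t)"
    using heat_deriv_y[OF t] by (meson DERIV_isCont continuous_at_imp_continuous_on)+
  have "isCont (heat2 \<mu> t) y" for y
    unfolding isCont_def heat2_def[abs_def]
  proof (rule tendsto_integral_bounded[OF finite_measure_axioms])
    show "((\<lambda>s. (((s - x) / t)\<^sup>2 - 1 / t) * hk t (s - x)) \<longlongrightarrow> (((y - x) / t)\<^sup>2 - 1 / t) * hk t (y - x)) (at y)" for x
    proof -
      have "isCont (\<lambda>s. hk t (s - x)) y" using hk_deriv1[OF t] DERIV_isCont by blast
      then have "isCont (\<lambda>s. (((s - x) / t)\<^sup>2 - 1 / t) * hk t (s - x)) y" using t by (intro continuous_intros) auto
      then show ?thesis by (simp add: isCont_def)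
    qed
    show "\<bar>(((s - x) / t)\<^sup>2 - 1 / t) * hk t (s - x)\<bar> \<le> hC t t * (1 / sqrt (2 * pi * (2 * t)))" for x s
      by (rule kernel_const_bounds(3)[OF t order.refl order.refl])
  qed auto
  then show "continuous_on UNIV (heat2 \<mu> t)" by (simp add: continuous_at_imp_continuous_on)
qed

lemma heat2_cont_t:
  assumes a: "0 < a"
  shows "continuous_on {a..b} (\<lambda>t. heat2 \<mu> t y)"
  unfolding continuous_on_def heat2_def
proof
  fix t0 assume t0: "t0 \<in> {a..b}"
  show "((\<lambda>t. \<integral>x. (((y - x) / t)\<^sup>2 - 1 / t) * hk t (y - x) \<partial>\<mu>) \<longlongrightarrow> (\<integral>x. (((y - x) / t0)\<^sup>2 - 1 / t0) * hk t0 (y - x) \<partial>\<mu>)) (at t0 within {a..b})"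
  proof (rule tendsto_integral_bounded[OF finite_measure_axioms])
    fix x
    have "isCont (\<lambda>t. hk t (y - x)) t0" using hk_deriv_t[of t0] a t0 DERIV_isCont by force
    then have "isCont (\<lambda>t. (((y - x) / t)\<^sup>2 - 1 / t) * hk t (y - x)) t0"
      using a t0 by (intro continuous_intros) auto
    then show "((\<lambda>t. (((y - x) / t)\<^sup>2 - 1 / t) * hk t (y - x)) \<longlongrightarrow> (((y - x) / t0)\<^sup>2 - 1 / t0) * hk t0 (y - x)) (at t0 within {a..b})"
      by (auto simp: isCont_def intro: tendsto_within_subset)
  next
    show "\<bar>(((y - x) / t)\<^sup>2 - 1 / t) * hk t (y - x)\<bar> \<le> hC a b * (1 / sqrt (2 * pi * (2 * b)))" if "t \<in> {a..b}" for x t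
      using that a by (intro kernel_const_bounds(3)) auto
  qed auto
qed

lemma heat_dominated:
  assumes a: "0 < a" "a \<le> t" "t \<le> b"
  shows "heat \<mu> t y \<le> hC a b * heat \<mu> (2 * b) y" "\<bar>heat1 \<mu> t y\<bar> \<le> hC a b * heat \<mu> (2 * b) y"
    "\<bar>heat2 \<mu> t y\<bar> \<le> hC a b * heat \<mu> (2 * b) y"
proof -
  have t: "0 < t" "0 < 2 * b" using a by auto
  have e: "hC a b * heat \<mu> (2 * b) y = (\<integral>x. hC a b * hk (2 * b) (y - x) \<partial>\<mu>)" by (simp add: heat_def)
  have i: "integrable \<mu> (\<lambda>x. hC a b * hk (2 * b) (y - x))" using kernel_int(1)[OF t(2)] by simp
  show "heat \<mu> t y \<le> hC a b * heat \<mu> (2 * b) y"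
    unfolding e heat_def[of \<mu> t] by (rule integral_mono[OF kernel_int(1)[OF t(1)] i hk_bounds(1)[OF a]])
  show "\<bar>heat1 \<mu> t y\<bar> \<le> hC a b * heat \<mu> (2 * b) y"
    unfolding e heat1_def
    by (rule order_trans[OF integral_abs_bound integral_mono[OF integrable_abs[OF kernel_int(2)[OF t(1)]] i hk_bounds(2)[OF a]]])
  show "\<bar>heat2 \<mu> t y\<bar> \<le> hC a b * heat \<mu> (2 * b) y"
    unfolding e heat2_def
    by (rule order_trans[OF integral_abs_bound integral_mono[OF integrable_abs[OF kernel_int(3)[OF t(1)]] i hk_bounds(3)[OF a]]])
qed

text \<open>Jensen's inequality for \<open>exp\<close>, by its tangent at the mean \<open>m\<close>
  of the exponent, together with \<open>(y - x)^2 \<le> 2 * y^2 + 2 * x^2\<close>. The Gaussian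
  shape of the bound keeps the logarithm of the smoothed density of at most quadratic
  growth.\<close>

lemma heat_lower:
  assumes t: "0 < t"
  shows "exp (- ((y\<^sup>2 + M2) / t)) / sqrt (2 * pi * t) \<le> heat \<mu> t y"
proof -
  define u where "u x = - (y - x)\<^sup>2 / (2 * t)" for x
  have sq: "integrable \<mu> (\<lambda>x. (y - x)\<^sup>2)" using sq_int lin_int by (simp add: power2_diff)
  have u: "integrable \<mu> u" unfolding u_def[abs_def] using sq by simp
  define m where "m = (\<integral>x. u x \<partial>\<mu>)"
  have m_ge: "- ((y\<^sup>2 + M2) / t) \<le> m"
  proof -
    have "(\<integral>x. (y - x)\<^sup>2 \<partial>\<mu>) \<le> (\<integral>x. 2 * y\<^sup>2 + 2 * x\<^sup>2 \<partial>\<mu>)"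
    proof (rule integral_mono[OF sq])
      show "(y - x)\<^sup>2 \<le> 2 * y\<^sup>2 + 2 * x\<^sup>2" for x
      proof -
        have "0 \<le> (y + x)\<^sup>2" by simp
        then show ?thesis by (simp add: power2_eq_square algebra_simps)
      qed
    qed (use sq_int in simp)
    also have "\<dots> = 2 * (y\<^sup>2 + M2)" using sq_int prob_space by (simp add: M2_def)
    finally have "(\<integral>x. (y - x)\<^sup>2 \<partial>\<mu>) / (2 * t) \<le> (y\<^sup>2 + M2) / t" using t by (simp add: field_simps)
    moreover have "m = - ((\<integral>x. (y - x)\<^sup>2 \<partial>\<mu>) / (2 * t))" by (simp add: m_def u_def)
    ultimately show ?thesis by simp
  qed
  have eu: "hk t (y - x) = exp (u x) / sqrt (2 * pi * t)" for x using t by (simp add: normal_density_def u_def)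
  have ei: "integrable \<mu> (\<lambda>x. exp (u x))"
  proof -
    have "integrable \<mu> (\<lambda>x. sqrt (2 * pi * t) * hk t (y - x))" using kernel_int(1)[OF t] by simp
    then show ?thesis using t by (simp add: eu)
  qed
  have "exp m = (\<integral>x. exp m * (1 + u x - m) \<partial>\<mu>)" using u prob_space by (simp add: m_def)
  also have "\<dots> \<le> (\<integral>x. exp (u x) \<partial>\<mu>)"
  proof (rule integral_mono[OF _ ei])
    show "exp m * (1 + u x - m) \<le> exp (u x)" for x
    proof -
      have "exp m * (1 + (u x - m)) \<le> exp m * exp (u x - m)" by (intro mult_left_mono exp_ge_add_one_self) auto
      then show ?thesis by (simp add: exp_diff add_diff_eq)
    qed
  qed (use u in simp)
  finally have "exp (- ((y\<^sup>2 + M2) / t)) \<le> (\<integral>x. exp (u x) \<partial>\<mu>)" using m_ge by (meson exp_le_cancel_iff order_trans)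
  then show ?thesis using t by (simp add: heat_def eu divide_right_mono)
qed

lemma heat_pos: "0 < t \<Longrightarrow> 0 < heat \<mu> t y"
  by (rule less_le_trans[OF _ heat_lower]) auto

lemma heat_upper: "0 < t \<Longrightarrow> heat \<mu> t y \<le> 1 / sqrt (2 * pi * t)"
  unfolding heat_def using integral_mono[OF kernel_int(1), of t "\<lambda>_. 1 / sqrt (2 * pi * t)" y] hk_le[of t] prob_space by simp

definition lnC :: "real \<Rightarrow> real \<Rightarrow> real" where
  "lnC a b = (\<bar>ln (2 * pi * a)\<bar> + \<bar>ln (2 * pi * b)\<bar>) / 2 + (1 + M2) / a"

lemma M2_nonneg: "0 \<le> M2" by (simp add: M2_def)

text \<open>Uniformity over \<open>{a..b}\<close> and quadratic growth in \<open>y\<close> are what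
  the second moment can dominate; every entropy integral along the flow is made finite by this
  estimate.\<close>

lemma ln_heat_bound:
  assumes a: "0 < a" "a \<le> t" "t \<le> b"
  shows "\<bar>ln (heat \<mu> t y)\<bar> \<le> lnC a b * (1 + y\<^sup>2)"
proof -
  have t: "0 < t" using a by simp
  have p: "0 < heat \<mu> t y" using t by (rule heat_pos)
  have "ln (heat \<mu> t y) \<le> ln (1 / sqrt (2 * pi * t))" using heat_upper[OF t, of y] p by (intro ln_mono) auto
  then have up: "ln (heat \<mu> t y) \<le> - ln (2 * pi * t) / 2" using t by (simp add: ln_divide_pos ln_sqrt)
  have "ln (exp (- ((y\<^sup>2 + M2) / t)) / sqrt (2 * pi * t)) \<le> ln (heat \<mu> t y)"
    using heat_lower[OF t, of y] p t by (intro ln_mono) auto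
  then have lo: "- ((y\<^sup>2 + M2) / t) - ln (2 * pi * t) / 2 \<le> ln (heat \<mu> t y)"
    using t by (subst (asm) ln_divide_pos) (auto simp: ln_sqrt)
  have l: "ln (2 * pi * a) \<le> ln (2 * pi * t)" "ln (2 * pi * t) \<le> ln (2 * pi * b)" using a by (auto intro!: ln_mono)
  then have L: "\<bar>ln (2 * pi * t)\<bar> \<le> \<bar>ln (2 * pi * a)\<bar> + \<bar>ln (2 * pi * b)\<bar>" by linarith
  have q: "(y\<^sup>2 + M2) / t \<le> (y\<^sup>2 + M2) / a" using a M2_nonneg by (intro divide_left_mono) auto
  have "0 \<le> (y\<^sup>2 + M2) / t" using t M2_nonneg by simp
  have "\<bar>ln (heat \<mu> t y)\<bar> \<le> (\<bar>ln (2 * pi * a)\<bar> + \<bar>ln (2 * pi * b)\<bar>) / 2 + (y\<^sup>2 + M2) / a"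
  proof -
    define S where "S = \<bar>ln (2 * pi * a)\<bar> + \<bar>ln (2 * pi * b)\<bar>"
    have "ln (2 * pi * t) \<le> S" "- ln (2 * pi * t) \<le> S" using L by (auto simp: S_def)
    then show ?thesis using up lo q \<open>0 \<le> (y\<^sup>2 + M2) / t\<close> unfolding S_def[symmetric] by (intro abs_leI) linarith+
  qed
  also have "\<dots> \<le> lnC a b * (1 + y\<^sup>2)"
  proof -
    have "(y\<^sup>2 + M2) / a \<le> (1 + M2) / a * (1 + y\<^sup>2)"
    proof -
      have "0 \<le> M2 * y\<^sup>2" using M2_nonneg by simp
      then have "y\<^sup>2 + M2 \<le> (1 + M2) * (1 + y\<^sup>2)" by (simp add: algebra_simps)
      then show ?thesis using a by (simp add: divide_right_mono)
    qed
    moreover have "(\<bar>ln (2 * pi * a)\<bar> + \<bar>ln (2 * pi * b)\<bar>) / 2 \<le> (\<bar>ln (2 * pi * a)\<bar> + \<bar>ln (2 * pi * b)\<bar>) / 2 * (1 + y\<^sup>2)"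
      by (simp add: algebra_simps)
    ultimately show ?thesis unfolding lnC_def distrib_right by linarith
  qed
  finally show ?thesis .
qed

end

section \<open>De Bruijn's identity\<close>

context heat_flow
begin

context
  fixes t :: real
  assumes t: "0 < t"
begin

interpretation N: prob_space "normal_measure t" using t by (rule prob_normal_measure)
interpretation MN: pair_prob_space \<mu> "normal_measure t" ..
interpretation MB: pair_sigma_finite \<mu> lborel ..

lemma heat_nn: "ennreal (heat \<mu> t y) = (\<integral>\<^sup>+x. ennreal (hk t (y - x)) \<partial>\<mu>)"
  unfolding heat_def using kernel_int(1)[OF t] by (subst nn_integral_eq_integral) auto

lemma heat_law: "density lborel (\<lambda>y. ennreal (heat \<mu> t y)) = distr (\<mu> \<Otimes>\<^sub>M normal_measure t) borel (\<lambda>(x, z). x + z)"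
proof (rule measure_eqI)
  fix A assume "A \<in> sets (density lborel (\<lambda>y. ennreal (heat \<mu> t y)))"
  then have A[measurable]: "A \<in> sets borel" by simp
  have "emeasure (density lborel (\<lambda>y. ennreal (heat \<mu> t y))) A = (\<integral>\<^sup>+y. ennreal (heat \<mu> t y) * indicator A y \<partial>lborel)"
    by (subst emeasure_density) auto
  also have "\<dots> = (\<integral>\<^sup>+y. \<integral>\<^sup>+x. ennreal (hk t (y - x)) * indicator A y \<partial>\<mu> \<partial>lborel)"
    by (intro nn_integral_cong) (simp add: heat_nn nn_integral_multc)
  also have "\<dots> = (\<integral>\<^sup>+x. \<integral>\<^sup>+y. ennreal (hk t (y - x)) * indicator A y \<partial>lborel \<partial>\<mu>)"
    by (rule MB.Fubini') measurable
  also have "\<dots> = (\<integral>\<^sup>+x. \<integral>\<^sup>+z. indicator A (x + z) \<partial>normal_measure t \<partial>\<mu>)"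
  proof (rule nn_integral_cong)
    fix x
    have "(\<integral>\<^sup>+y. ennreal (hk t (y - x)) * indicator A y \<partial>lborel) = (\<integral>\<^sup>+z. ennreal (hk t z) * indicator A (x + z) \<partial>lborel)"
      by (subst nn_integral_real_affine[where c=1 and t=x]) auto
    also have "\<dots> = (\<integral>\<^sup>+z. indicator A (x + z) \<partial>normal_measure t)"
      unfolding normal_measure_def by (subst nn_integral_density) auto
    finally show "(\<integral>\<^sup>+y. ennreal (hk t (y - x)) * indicator A y \<partial>lborel) = (\<integral>\<^sup>+z. indicator A (x + z) \<partial>normal_measure t)" .
  qed
  also have "\<dots> = (\<integral>\<^sup>+w. indicator A (fst w + snd w) \<partial>(\<mu> \<Otimes>\<^sub>M normal_measure t))"
    by (subst N.nn_integral_fst[symmetric]) auto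
  also have "\<dots> = emeasure (distr (\<mu> \<Otimes>\<^sub>M normal_measure t) borel (\<lambda>(x, z). x + z)) A"
    by (subst nn_integral_indicator[symmetric], simp, subst nn_integral_distr) (auto simp: case_prod_beta')
  finally show "emeasure (density lborel (\<lambda>y. ennreal (heat \<mu> t y))) A = emeasure (distr (\<mu> \<Otimes>\<^sub>M normal_measure t) borel (\<lambda>(x, z). x + z)) A" .
qed simp

lemma heat_nonneg: "0 \<le> heat \<mu> t y" using heat_pos[OF t, of y] by simp

lemma heat_int: "integrable lborel (heat \<mu> t)" "(\<integral>y. heat \<mu> t y \<partial>lborel) = 1"
proof -
  have "prob_space (density lborel (\<lambda>y. ennreal (heat \<mu> t y)))"
    unfolding heat_law by (rule MN.prob_space_distr) measurable
  then show "integrable lborel (heat \<mu> t)" "(\<integral>y. heat \<mu> t y \<partial>lborel) = 1"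
    by (simp_all add: prob_density_integral heat_nonneg)
qed

lemma heat_expectation:
  fixes k :: "real \<Rightarrow> real"
  assumes [measurable]: "k \<in> borel_measurable borel" and k: "integrable (\<mu> \<Otimes>\<^sub>M normal_measure t) (\<lambda>(x, z). k (x + z))"
  shows "integrable lborel (\<lambda>y. heat \<mu> t y * k y)"
    "(\<integral>y. heat \<mu> t y * k y \<partial>lborel) = (\<integral>x. \<integral>z. k (x + z) \<partial>normal_measure t \<partial>\<mu>)"
proof -
  have k': "integrable (distr (\<mu> \<Otimes>\<^sub>M normal_measure t) borel (\<lambda>(x, z). x + z)) k"
    using k by (subst integrable_distr_eq) (auto simp: case_prod_beta')
  then have "integrable (density lborel (\<lambda>y. ennreal (heat \<mu> t y))) k" by (simp only: heat_law)
  then show "integrable lborel (\<lambda>y. heat \<mu> t y * k y)"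
    by (subst (asm) integrable_density) (auto simp: heat_nonneg)
  have "(\<integral>y. heat \<mu> t y * k y \<partial>lborel) = (\<integral>y. k y \<partial>density lborel (\<lambda>y. ennreal (heat \<mu> t y)))"
    by (subst integral_density) (auto simp: heat_nonneg)
  also have "\<dots> = (\<integral>w. (case w of (x, z) \<Rightarrow> k (x + z)) \<partial>(\<mu> \<Otimes>\<^sub>M normal_measure t))"
    unfolding heat_law by (subst integral_distr) (auto simp: case_prod_beta')
  also have "\<dots> = (\<integral>x. \<integral>z. k (x + z) \<partial>normal_measure t \<partial>\<mu>)"
    using MN.integral_fst'[OF k] by simp
  finally show "(\<integral>y. heat \<mu> t y * k y \<partial>lborel) = (\<integral>x. \<integral>z. k (x + z) \<partial>normal_measure t \<partial>\<mu>)" .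
qed

lemma pair_sq_int: "integrable (\<mu> \<Otimes>\<^sub>M normal_measure t) (\<lambda>(x, z). (x + z - c)\<^sup>2)"
  by (intro integrable_pair_sum_square prob N.prob_space_axioms sets_eq sets_normal_measure sq_int normal_measure_moments(1)[OF t])

lemma pair_lin_int: "integrable (\<mu> \<Otimes>\<^sub>M normal_measure t) (\<lambda>(x, z). x + z)"
  using MN.square_integrable_imp_integrable[of "\<lambda>(x, z). x + z"] pair_sq_int[of 0] by (simp add: case_prod_beta')

lemma heat_mean: "integrable lborel (\<lambda>y. heat \<mu> t y * y)" "(\<integral>y. heat \<mu> t y * y \<partial>lborel) = mean"
proof -
  show "integrable lborel (\<lambda>y. heat \<mu> t y * y)" by (rule heat_expectation(1)[OF _ pair_lin_int]) simp
  have "(\<integral>y. heat \<mu> t y * y \<partial>lborel) = (\<integral>x. \<integral>z. x + z \<partial>normal_measure t \<partial>\<mu>)"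
    by (rule heat_expectation(2)[OF _ pair_lin_int]) simp
  also have "(\<lambda>x. \<integral>z. x + z \<partial>normal_measure t) = (\<lambda>x. x)"
    using normal_measure_moments[OF t] N.prob_space by (intro ext) simp
  finally show "(\<integral>y. heat \<mu> t y * y \<partial>lborel) = mean" by (simp add: mean_def)
qed

lemma heat_sq_int: "integrable lborel (\<lambda>y. heat \<mu> t y * (y - c)\<^sup>2)"
  by (rule heat_expectation(1)[OF _ pair_sq_int]) measurable

lemma heat_var: "(\<integral>y. heat \<mu> t y * (y - mean)\<^sup>2 \<partial>lborel) = var + t"
proof -
  note mom = normal_measure_moments[OF t]
  have "(\<integral>y. heat \<mu> t y * (y - mean)\<^sup>2 \<partial>lborel) = (\<integral>x. \<integral>z. (x + z - mean)\<^sup>2 \<partial>normal_measure t \<partial>\<mu>)"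
    by (rule heat_expectation(2)[OF _ pair_sq_int]) measurable
  also have "\<dots> = (\<integral>x. (x - mean)\<^sup>2 + t \<partial>\<mu>)"
  proof (rule Bochner_Integration.integral_cong[OF refl])
    fix x
    have "(\<lambda>z. (x + z - mean)\<^sup>2) = (\<lambda>z. (x - mean)\<^sup>2 + 2 * (x - mean) * z + z\<^sup>2)"
      by (rule ext) (simp add: power2_eq_square algebra_simps)
    then show "(\<integral>z. (x + z - mean)\<^sup>2 \<partial>normal_measure t) = (x - mean)\<^sup>2 + t"
      using mom N.prob_space by simp
  qed
  also have "\<dots> = var + t" using sq_int lin_int prob_space by (simp add: var_def power2_diff)
  finally show ?thesis .
qed

lemma heat_weight_int: "integrable lborel (\<lambda>y. (1 + y\<^sup>2) * heat \<mu> t y)"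
proof -
  have "(\<lambda>y. (1 + y\<^sup>2) * heat \<mu> t y) = (\<lambda>y. heat \<mu> t y + heat \<mu> t y * (y - 0)\<^sup>2)"
    by (rule ext) (simp add: algebra_simps)
  then show ?thesis using heat_int(1) heat_sq_int[of 0] by simp
qed

end

lemma dominated_int:
  fixes k :: "real \<Rightarrow> real"
  assumes b: "0 < b" and [measurable]: "k \<in> borel_measurable borel"
    and le: "\<And>y. \<bar>k y\<bar> \<le> C * ((1 + y\<^sup>2) * heat \<mu> b y)"
  shows "integrable lborel k"
proof (rule Bochner_Integration.integrable_bound)
  show "integrable lborel (\<lambda>y. C * ((1 + y\<^sup>2) * heat \<mu> b y))" using heat_weight_int[OF b] by simp
  show "AE y in lborel. norm (k y) \<le> norm (C * ((1 + y\<^sup>2) * heat \<mu> b y))"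
    using le by (intro AE_I2) (auto intro: order_trans[OF _ abs_ge_self])
qed measurable

lemma weight_ge: "0 < b \<Longrightarrow> heat \<mu> b y \<le> (1 + y\<^sup>2) * heat \<mu> b y"
  using heat_nonneg[of b y] by (simp add: distrib_right)

context
  fixes t :: real
  assumes t: "0 < t"
begin

lemma double_pos: "0 < 2 * t" using t by simp

lemma hC_diag_nonneg: "0 \<le> hC t t" using t by (simp add: hC_nonneg)

lemma heat1_int: "integrable lborel (heat1 \<mu> t)" and heat2_int: "integrable lborel (heat2 \<mu> t)"
proof -
  have "\<bar>heat1 \<mu> t y\<bar> \<le> hC t t * ((1 + y\<^sup>2) * heat \<mu> (2 * t) y)" for y
    using heat_dominated(2)[OF t order.refl order.refl, of y] mult_left_mono[OF weight_ge[OF double_pos] hC_diag_nonneg, of y] by linarith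
  then show "integrable lborel (heat1 \<mu> t)" by (intro dominated_int[OF double_pos]) auto
  have "\<bar>heat2 \<mu> t y\<bar> \<le> hC t t * ((1 + y\<^sup>2) * heat \<mu> (2 * t) y)" for y
    using heat_dominated(3)[OF t order.refl order.refl, of y] mult_left_mono[OF weight_ge[OF double_pos] hC_diag_nonneg, of y] by linarith
  then show "integrable lborel (heat2 \<mu> t)" by (intro dominated_int[OF double_pos]) auto
qed

lemma y_heat1_int: "integrable lborel (\<lambda>y. y * heat1 \<mu> t y)"
proof (rule dominated_int[OF double_pos])
  fix y
  have "\<bar>y * heat1 \<mu> t y\<bar> = \<bar>y\<bar> * \<bar>heat1 \<mu> t y\<bar>" by (simp add: abs_mult)
  also have "\<dots> \<le> (1 + y\<^sup>2) * (hC t t * heat \<mu> (2 * t) y)"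
    by (intro mult_mono abs_le_one_plus_square heat_dominated(2)[OF t order.refl order.refl]) auto
  finally show "\<bar>y * heat1 \<mu> t y\<bar> \<le> hC t t * ((1 + y\<^sup>2) * heat \<mu> (2 * t) y)" by (simp add: mult_ac)
qed measurable

text \<open>With \<open>k x\<close> the square root of the kernel, \<open>heat1\<close> is the
  scalar product of \<open>k\<close> and \<open>l\<close>, where
  \<open>l x = - ((y - x) / t) * k x\<close>. The squared norms are \<open>heat\<close> and
  \<open>heat2 + heat / t\<close>, so Cauchy-Schwarz applies, and the right side is integrable in
  \<open>y\<close>.\<close>

lemma fisher_bound: "(heat1 \<mu> t y)\<^sup>2 / heat \<mu> t y \<le> heat2 \<mu> t y + heat \<mu> t y / t"
proof -
  define k where "k x = sqrt (hk t (y - x))" for x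
  have [measurable]: "k \<in> borel_measurable borel" unfolding k_def[abs_def] by measurable
  have k2: "(k x)\<^sup>2 = hk t (y - x)" for x by (simp add: k_def)
  define l where "l x = - ((y - x) / t) * k x" for x
  have [measurable]: "l \<in> borel_measurable borel" unfolding l_def[abs_def] by measurable
  have l2: "(l x)\<^sup>2 = (((y - x) / t)\<^sup>2 - 1 / t) * hk t (y - x) + hk t (y - x) / t" for x
    by (simp only: l_def power_mult_distrib power2_minus k2) (simp add: left_diff_distrib)
  have ki: "integrable \<mu> (\<lambda>x. (k x)\<^sup>2)" unfolding k2 by (rule kernel_int(1)[OF t])
  have li: "integrable \<mu> (\<lambda>x. (l x)\<^sup>2)" unfolding l2 using kernel_int[OF t] by simp
  have "l x * k x = - ((y - x) / t) * hk t (y - x)" for x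
    by (simp add: l_def k2[symmetric] power2_eq_square)
  then have "heat1 \<mu> t y = (\<integral>x. l x * k x \<partial>\<mu>)" by (simp add: heat1_def)
  moreover have "heat \<mu> t y = (\<integral>x. (k x)\<^sup>2 \<partial>\<mu>)" by (simp add: heat_def k2)
  moreover have "heat2 \<mu> t y + heat \<mu> t y / t = (\<integral>x. (l x)\<^sup>2 \<partial>\<mu>)"
    unfolding l2 heat2_def heat_def using kernel_int[OF t] by simp
  ultimately have "(heat1 \<mu> t y)\<^sup>2 \<le> (heat2 \<mu> t y + heat \<mu> t y / t) * heat \<mu> t y"
    using Cauchy_Schwarz_integral[of l \<mu> k] ki li by simp
  then show ?thesis using heat_pos[OF t, of y] by (simp add: field_simps)
qed

lemma fisher_int: "integrable lborel (\<lambda>y. (heat1 \<mu> t y)\<^sup>2 / heat \<mu> t y)"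
proof (rule Bochner_Integration.integrable_bound)
  show "integrable lborel (\<lambda>y. heat2 \<mu> t y + heat \<mu> t y / t)" using heat2_int heat_int(1)[OF t] by simp
  have "\<bar>(heat1 \<mu> t y)\<^sup>2 / heat \<mu> t y\<bar> \<le> \<bar>heat2 \<mu> t y + heat \<mu> t y / t\<bar>" for y
    using fisher_bound[of y] heat_nonneg[OF t, of y] by simp
  then show "AE y in lborel. norm ((heat1 \<mu> t y)\<^sup>2 / heat \<mu> t y) \<le> norm (heat2 \<mu> t y + heat \<mu> t y / t)"
    by simp
qed measurable

lemma heat1_bdd: "\<bar>heat1 \<mu> t y\<bar> \<le> hC t t * (1 / sqrt (2 * pi * (2 * t)))"
proof -
  have "\<bar>heat1 \<mu> t y\<bar> \<le> hC t t * heat \<mu> (2 * t) y" by (rule heat_dominated(2)[OF t order.refl order.refl])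
  also have "\<dots> \<le> hC t t * (1 / sqrt (2 * pi * (2 * t)))" by (intro mult_left_mono heat_upper double_pos hC_diag_nonneg)
  finally show ?thesis .
qed

lemma score_density_heat: "score_density (heat \<mu> t) (heat1 \<mu> t) (hC t t * (1 / sqrt (2 * pi * (2 * t))))"
proof
  show "integrable lborel (\<lambda>y. y\<^sup>2 * heat \<mu> t y)" using heat_sq_int[OF t, of 0] by (simp add: mult.commute)
  show "\<bar>heat1 \<mu> t y\<bar> \<le> hC t t * (1 / sqrt (2 * pi * (2 * t)))" for y by (rule heat1_bdd)
qed (auto intro!: heat_pos heat_deriv_y heat_cont_y heat_int heat1_int fisher_int y_heat1_int t)

lemma score_density_heat_consts:
  "score_density.Q (heat \<mu> t) = distr (\<mu> \<Otimes>\<^sub>M normal_measure t) borel (\<lambda>(x, z). x + z)"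
  "score_density.m (heat \<mu> t) = mean" "score_density.v (heat \<mu> t) = var + t"
  "score_density.J (heat \<mu> t) (heat1 \<mu> t) = fisher \<mu> t"
proof -
  interpret S: score_density "heat \<mu> t" "heat1 \<mu> t" "hC t t * (1 / sqrt (2 * pi * (2 * t)))"
    by (rule score_density_heat)
  show "S.Q = distr (\<mu> \<Otimes>\<^sub>M normal_measure t) borel (\<lambda>(x, z). x + z)" unfolding S.Q_def by (rule heat_law[OF t])
  show m: "S.m = mean" unfolding S.m_def by (subst S.integral_Q) (simp_all add: heat_mean[OF t])
  show "S.v = var + t" unfolding S.v_def m by (subst S.integral_Q) (simp_all add: heat_var[OF t])
  show "S.J = fisher \<mu> t" by (simp add: S.J_def fisher_def)
qed

lemma entropy_heat_int: "integrable lborel (\<lambda>y. heat \<mu> t y * ln (heat \<mu> t y))"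
proof (rule dominated_int[OF t])
  fix y
  have "\<bar>heat \<mu> t y * ln (heat \<mu> t y)\<bar> = heat \<mu> t y * \<bar>ln (heat \<mu> t y)\<bar>" using heat_nonneg[OF t, of y] by (simp add: abs_mult)
  also have "\<dots> \<le> heat \<mu> t y * (lnC t t * (1 + y\<^sup>2))"
    by (intro mult_left_mono ln_heat_bound heat_nonneg t order.refl)
  finally show "\<bar>heat \<mu> t y * ln (heat \<mu> t y)\<bar> \<le> lnC t t * ((1 + y\<^sup>2) * heat \<mu> t y)" by (simp add: mult_ac)
qed measurable

end

lemma debruijn_dominated:
  assumes a: "0 < a" "a \<le> t" "t \<le> b"
  shows "\<bar>heat2 \<mu> t y * (1 + ln (heat \<mu> t y))\<bar> \<le> (1 + lnC a b) * hC a b * ((1 + y\<^sup>2) * heat \<mu> (2 * b) y)"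
    "\<bar>heat1 \<mu> t y * (1 + ln (heat \<mu> t y))\<bar> \<le> (1 + lnC a b) * hC a b * ((1 + y\<^sup>2) * heat \<mu> (2 * b) y)"
proof -
  have l: "\<bar>1 + ln (heat \<mu> t y)\<bar> \<le> (1 + lnC a b) * (1 + y\<^sup>2)"
  proof -
    have "\<bar>1 + ln (heat \<mu> t y)\<bar> \<le> 1 + lnC a b * (1 + y\<^sup>2)" using ln_heat_bound[OF a, of y] by linarith
    also have "\<dots> \<le> (1 + lnC a b) * (1 + y\<^sup>2)" by (simp add: algebra_simps)
    finally show ?thesis .
  qed
  have "\<bar>heat2 \<mu> t y\<bar> * \<bar>1 + ln (heat \<mu> t y)\<bar> \<le> (hC a b * heat \<mu> (2 * b) y) * ((1 + lnC a b) * (1 + y\<^sup>2))"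
    by (rule mult_mono[OF heat_dominated(3)[OF a] l]) (use heat_dominated(3)[OF a, of y] in auto)
  then show "\<bar>heat2 \<mu> t y * (1 + ln (heat \<mu> t y))\<bar> \<le> (1 + lnC a b) * hC a b * ((1 + y\<^sup>2) * heat \<mu> (2 * b) y)"
    by (simp add: abs_mult mult_ac)
  have "\<bar>heat1 \<mu> t y\<bar> * \<bar>1 + ln (heat \<mu> t y)\<bar> \<le> (hC a b * heat \<mu> (2 * b) y) * ((1 + lnC a b) * (1 + y\<^sup>2))"
    by (rule mult_mono[OF heat_dominated(2)[OF a] l]) (use heat_dominated(2)[OF a, of y] in auto)
  then show "\<bar>heat1 \<mu> t y * (1 + ln (heat \<mu> t y))\<bar> \<le> (1 + lnC a b) * hC a b * ((1 + y\<^sup>2) * heat \<mu> (2 * b) y)"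
    by (simp add: abs_mult mult_ac)
qed

text \<open>Integration by parts: the derivative of \<open>heat1 * (1 + ln heat)\<close> in
  \<open>y\<close> is the integrand plus the Fisher integrand, and it integrates to zero by
  \<open>integral_derivative_eq_0\<close>.\<close>

lemma entropy_production:
  assumes t: "0 < t"
  shows "(\<integral>y. heat2 \<mu> t y * (1 + ln (heat \<mu> t y)) \<partial>lborel) = - fisher \<mu> t"
proof -
  have t2: "0 < 2 * t" using t by simp
  have i2: "integrable lborel (\<lambda>y. heat2 \<mu> t y * (1 + ln (heat \<mu> t y)))"
    by (rule dominated_int[OF t2 _ debruijn_dominated(1)[OF t order.refl order.refl]]) measurable
  have i1: "integrable lborel (\<lambda>y. heat1 \<mu> t y * (1 + ln (heat \<mu> t y)))"
    by (rule dominated_int[OF t2 _ debruijn_dominated(2)[OF t order.refl order.refl]]) measurable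
  have ne: "heat \<mu> t y \<noteq> 0" for y using heat_pos[OF t, of y] by simp
  have "(\<integral>y. heat2 \<mu> t y * (1 + ln (heat \<mu> t y)) + (heat1 \<mu> t y)\<^sup>2 / heat \<mu> t y \<partial>lborel) = 0"
  proof (rule integral_derivative_eq_0)
    show "((\<lambda>y. heat1 \<mu> t y * (1 + ln (heat \<mu> t y))) has_real_derivative
        heat2 \<mu> t y * (1 + ln (heat \<mu> t y)) + (heat1 \<mu> t y)\<^sup>2 / heat \<mu> t y) (at y)" for y
    proof -
      have d: "((\<lambda>y. 1 + ln (heat \<mu> t y)) has_real_derivative (1 / heat \<mu> t y * heat1 \<mu> t y)) (at y)"
        using DERIV_add[OF DERIV_const[of 1] DERIV_chain2[OF DERIV_ln_divide[OF heat_pos[OF t]] heat_deriv_y(1)[OF t, of y]]] by simp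
      show ?thesis by (rule DERIV_cong[OF DERIV_mult[OF heat_deriv_y(2)[OF t] d]]) (simp add: power2_eq_square)
    qed
    show "continuous_on UNIV (\<lambda>y. heat2 \<mu> t y * (1 + ln (heat \<mu> t y)) + (heat1 \<mu> t y)\<^sup>2 / heat \<mu> t y)"
      using ne by (intro continuous_intros heat_cont_y[OF t]) auto
  qed (use i1 i2 fisher_int[OF t] in auto)
  then show ?thesis using i2 fisher_int[OF t] by (simp add: fisher_def)
qed

text \<open>The integrated form comes from computing one double integral in two orders. By the heat
  equation \<open>K t y\<close> is the time derivative of \<open>2 * heat * ln heat\<close>, so
  integrating over \<open>t\<close> first gives entropies; integrating over \<open>y\<close> first
  gives \<open>- fisher\<close>. A positive left end \<open>a\<close> provides a common dominating
  function.\<close>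

theorem de_bruijn:
  assumes a: "0 < a" "a \<le> b"
  shows "set_integrable lborel {a..b} (fisher \<mu>)"
    "diff_entropy (heat \<mu> b) - diff_entropy (heat \<mu> a) = (LINT t:{a..b}|lborel. fisher \<mu> t) / 2"
proof -
  have b: "0 < b" "0 < 2 * b" using a by auto
  define K where "K t y = heat2 \<mu> t y * (1 + ln (heat \<mu> t y))" for t y
  have Km[measurable]: "(\<lambda>w. K (fst w) (snd w)) \<in> borel_measurable (borel \<Otimes>\<^sub>M borel)"
    unfolding K_def by measurable
  define h where "h t y = indicat_real {a..b} t * K t y" for t y
  have hm[measurable]: "(\<lambda>(t, y). h t y) \<in> borel_measurable (borel \<Otimes>\<^sub>M borel)"
    unfolding h_def case_prod_beta' by measurable
  have Ki: "integrable lborel (K t)" if "t \<in> {a..b}" for t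
    unfolding K_def[abs_def] using that a
    by (intro dominated_int[OF b(2) _ debruijn_dominated(1)[of a t b]]) auto
  define D where "D = (1 + lnC a b) * hC a b * (\<integral>y. (1 + y\<^sup>2) * heat \<mu> (2 * b) y \<partial>lborel)"
  have KD: "(\<integral>y. \<bar>K t y\<bar> \<partial>lborel) \<le> D" if "t \<in> {a..b}" for t
  proof -
    have "(\<integral>y. \<bar>K t y\<bar> \<partial>lborel) \<le> (\<integral>y. (1 + lnC a b) * hC a b * ((1 + y\<^sup>2) * heat \<mu> (2 * b) y) \<partial>lborel)"
      using integrable_abs[OF Ki[OF that]] heat_weight_int[OF b(2)] debruijn_dominated(1)[of a t b, folded K_def] a that
      by (intro integral_mono) auto
    then show ?thesis by (simp add: D_def)
  qed
  have hi: "integrable (lborel \<Otimes>\<^sub>M lborel) (\<lambda>(t, y). h t y)"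
  proof (rule lborel_pair.Fubini_integrable)
    show "AE t in lborel. integrable lborel (\<lambda>y. case (t, y) of (t, y) \<Rightarrow> h t y)"
      using Ki by (intro AE_I2) (auto simp: h_def indicator_def)
    show "integrable lborel (\<lambda>t. \<integral>y. norm (case (t, y) of (t, y) \<Rightarrow> h t y) \<partial>lborel)"
    proof (rule Bochner_Integration.integrable_bound)
      show "integrable lborel (\<lambda>t. D * indicat_real {a..b} t)" by simp
      show "AE t in lborel. norm (\<integral>y. norm (case (t, y) of (t, y) \<Rightarrow> h t y) \<partial>lborel) \<le> norm (D * indicat_real {a..b} t)"
        using KD by (intro AE_I2) (auto simp: h_def indicator_def abs_mult intro!: order_trans[OF _ abs_ge_self])
    qed measurable
  qed measurable
  have fib: "(\<integral>y. h t y \<partial>lborel) = - (indicat_real {a..b} t * fisher \<mu> t)" for t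
    unfolding h_def using entropy_production[of t] a by (auto simp: K_def indicator_def)
  have "integrable lborel (\<lambda>t. \<integral>y. h t y \<partial>lborel)" using lborel_pair.integrable_fst'[OF hi] by simp
  then show "set_integrable lborel {a..b} (fisher \<mu>)" by (simp add: fib set_integrable_def)
  have col: "(\<integral>t. h t y \<partial>lborel) = 2 * (heat \<mu> b y * ln (heat \<mu> b y) - heat \<mu> a y * ln (heat \<mu> a y))" for y
  proof -
    have d: "((\<lambda>t. 2 * (heat \<mu> t y * ln (heat \<mu> t y))) has_real_derivative K t y) (at t)" if "a \<le> t" for t
    proof -
      have t: "0 < t" using that a by simp
      have p: "0 < heat \<mu> t y" by (rule heat_pos[OF t])
      have dl: "((\<lambda>t. ln (heat \<mu> t y)) has_real_derivative (1 / heat \<mu> t y * (heat2 \<mu> t y / 2))) (at t)"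
        by (rule DERIV_chain2[OF DERIV_ln_divide[OF p] heat_deriv_t[OF t]])
      show ?thesis
        by (rule DERIV_cong[OF DERIV_cmult[OF DERIV_mult[OF heat_deriv_t[OF t] dl], of 2]])
          (use p in \<open>simp add: K_def field_simps\<close>)
    qed
    have "continuous_on {a..b} (\<lambda>t. K t y)"
    proof -
      have "continuous_on {a..b} (\<lambda>t. heat \<mu> t y)"
        using a by (intro continuous_at_imp_continuous_on ballI DERIV_isCont[OF heat_deriv_t]) auto
      moreover have "heat \<mu> t y \<noteq> 0" if "t \<in> {a..b}" for t using heat_pos[of t y] that a by auto
      ultimately show ?thesis unfolding K_def by (intro continuous_intros heat2_cont_t a) auto
    qed
    then have "(LINT t:{a..b}|lborel. K t y) = 2 * (heat \<mu> b y * ln (heat \<mu> b y)) - 2 * (heat \<mu> a y * ln (heat \<mu> a y))"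
      using integral_FTC_Icc_cont(2)[OF a(2), of "\<lambda>t. 2 * (heat \<mu> t y * ln (heat \<mu> t y))" "\<lambda>t. K t y"] d by simp
    then show ?thesis by (simp add: h_def set_lebesgue_integral_def)
  qed
  have "2 * (diff_entropy (heat \<mu> a) - diff_entropy (heat \<mu> b)) = (\<integral>y. \<integral>t. h t y \<partial>lborel \<partial>lborel)"
    unfolding col diff_entropy_def using entropy_heat_int[OF a(1)] entropy_heat_int[OF b(1)] by simp
  also have "\<dots> = (\<integral>t. \<integral>y. h t y \<partial>lborel \<partial>lborel)" using lborel_pair.Fubini_integral[OF hi] by simp
  also have "\<dots> = - (LINT t:{a..b}|lborel. fisher \<mu> t)" by (simp add: fib set_lebesgue_integral_def)
  finally show "diff_entropy (heat \<mu> b) - diff_entropy (heat \<mu> a) = (LINT t:{a..b}|lborel. fisher \<mu> t) / 2" by simp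
qed

end

section \<open>Entropy along the heat flow\<close>

text \<open>Adding independent noise does not lower entropy. For every \<open>x\<close> the
  translate of \<open>P\<close> by \<open>x\<close> is again a density, so Gibbs' inequality bounds
  the integral of \<open>\<phi> z * ln (P (x + z))\<close> by that of
  \<open>\<phi> * ln \<phi>\<close>; averaging over \<nu> turns the left side into the integral of
  \<open>P * ln P\<close>.\<close>

lemma mixture_entropy:
  fixes \<phi> P :: "real \<Rightarrow> real" and \<nu> :: "real measure"
  assumes \<nu>: "prob_space \<nu>" "sets \<nu> = sets borel" "integrable \<nu> (\<lambda>x. x\<^sup>2)"
    and \<phi>: "\<phi> \<in> borel_measurable borel" "\<And>y. 0 \<le> \<phi> y" "integrable lborel \<phi>" "(\<integral>y. \<phi> y \<partial>lborel) = 1"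
      "integrable lborel (\<lambda>y. \<phi> y * ln (\<phi> y))" "integrable lborel (\<lambda>y. \<phi> y * y\<^sup>2)"
    and P: "P \<in> borel_measurable borel" "\<And>y. 0 < P y" "integrable lborel P" "(\<integral>y. P y \<partial>lborel) = 1"
      "\<And>y. \<bar>ln (P y)\<bar> \<le> A * (1 + y\<^sup>2)"
    and law: "density lborel (\<lambda>y. ennreal (P y)) = distr (\<nu> \<Otimes>\<^sub>M density lborel (\<lambda>y. ennreal (\<phi> y))) borel (\<lambda>(x, z). x + z)"
  shows "diff_entropy \<phi> \<le> diff_entropy P"
proof -
  define \<Phi> where "\<Phi> = density lborel (\<lambda>y. ennreal (\<phi> y))"
  note \<phi>(1)[measurable] P(1)[measurable] \<nu>(2)[measurable_cong]
  have [simp, measurable_cong]: "sets \<Phi> = sets borel" by (simp add: \<Phi>_def)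
  interpret V: prob_space \<nu> by fact
  have "(\<integral>\<^sup>+y. ennreal (\<phi> y) \<partial>lborel) = 1" using \<phi> by (simp add: nn_integral_eq_integral)
  then interpret F: prob_space \<Phi> by (intro prob_spaceI) (simp add: \<Phi>_def emeasure_density)
  interpret VF: pair_prob_space \<nu> \<Phi> ..
  have sF: "integrable \<Phi> (\<lambda>y. y\<^sup>2)" unfolding \<Phi>_def using \<phi> by (subst integrable_density) auto
  have \<phi>int: "integrable lborel (\<lambda>z. \<phi> z * k z)" if "integrable \<Phi> k" for k :: "real \<Rightarrow> real"
  proof -
    have [measurable]: "k \<in> borel_measurable borel" using that by (simp add: \<Phi>_def)
    show ?thesis using that unfolding \<Phi>_def using \<phi> by (subst (asm) integrable_density) auto
  qed
  have x2: "integrable (\<nu> \<Otimes>\<^sub>M \<Phi>) (\<lambda>(x, z). x\<^sup>2)" "integrable (\<nu> \<Otimes>\<^sub>M \<Phi>) (\<lambda>(x, z). z\<^sup>2)"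
    using integrable_pair_marginal(1)[OF \<nu>(1) F.prob_space_axioms \<nu>(3)] integrable_pair_marginal(2)[OF F.prob_space_axioms \<nu>(1) sF] .
  have lb: "\<bar>ln (P (x + z))\<bar> \<le> \<bar>A\<bar> * (1 + 2 * x\<^sup>2 + 2 * z\<^sup>2)" for x z
  proof -
    have "A * (1 + (x + z)\<^sup>2) \<le> \<bar>A\<bar> * (1 + (x + z)\<^sup>2)" by (intro mult_right_mono) auto
    also have "\<dots> \<le> \<bar>A\<bar> * (1 + 2 * x\<^sup>2 + 2 * z\<^sup>2)"
      using sum_squares_bound[of x z] by (intro mult_left_mono) (auto simp: power2_sum)
    finally show ?thesis using P(5)[of "x + z"] by linarith
  qed
  have li: "integrable (\<nu> \<Otimes>\<^sub>M \<Phi>) (\<lambda>(x, z). ln (P (x + z)))"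
  proof (rule Bochner_Integration.integrable_bound)
    show "integrable (\<nu> \<Otimes>\<^sub>M \<Phi>) (\<lambda>(x, z). \<bar>A\<bar> * (1 + 2 * x\<^sup>2 + 2 * z\<^sup>2))" using x2 by (simp add: case_prod_beta')
    show "AE w in \<nu> \<Otimes>\<^sub>M \<Phi>. norm (case w of (x, z) \<Rightarrow> ln (P (x + z))) \<le> norm (case w of (x, z) \<Rightarrow> \<bar>A\<bar> * (1 + 2 * x\<^sup>2 + 2 * z\<^sup>2))"
      using lb by (intro AE_I2) (auto intro: order_trans[OF _ abs_ge_self])
  qed measurable
  have inner: "(\<integral>z. ln (P (x + z)) \<partial>\<Phi>) \<le> (\<integral>y. \<phi> y * ln (\<phi> y) \<partial>lborel)" for x
  proof -
    have i: "integrable \<Phi> (\<lambda>z. ln (P (x + z)))"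
    proof (rule Bochner_Integration.integrable_bound)
      show "integrable \<Phi> (\<lambda>z. \<bar>A\<bar> * (1 + 2 * x\<^sup>2 + 2 * z\<^sup>2))" using sF by simp
      show "AE z in \<Phi>. norm (ln (P (x + z))) \<le> norm (\<bar>A\<bar> * (1 + 2 * x\<^sup>2 + 2 * z\<^sup>2))"
        using lb[of x] by (intro AE_I2) (auto intro: order_trans[OF _ abs_ge_self])
    qed measurable
    have "(\<integral>z. ln (P (x + z)) \<partial>\<Phi>) = (\<integral>z. \<phi> z * ln (P (x + z)) \<partial>lborel)"
      unfolding \<Phi>_def using \<phi> by (subst integral_density) auto
    also have "\<dots> \<le> (\<integral>y. \<phi> y * ln (\<phi> y) \<partial>lborel)"
    proof (rule gibbs_inequality)
      show "integrable lborel (\<lambda>z. P (x + z))" using lborel_integrable_real_affine[OF P(3), of 1 x] by simp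
      have "(\<integral>z. P (x + z) \<partial>lborel) = 1"
        using lborel_integral_real_affine[of 1 P x] P(4) by simp
      then show "(\<integral>z. P (x + z) \<partial>lborel) \<le> (\<integral>z. \<phi> z \<partial>lborel)" using \<phi>(4) by simp
      show "integrable lborel (\<lambda>z. \<phi> z * ln (P (x + z)))" by (rule \<phi>int[OF i])
    qed (use \<phi> P in auto)
    finally show ?thesis .
  qed
  have "(\<integral>y. P y * ln (P y) \<partial>lborel) = (\<integral>y. ln (P y) \<partial>density lborel (\<lambda>y. ennreal (P y)))"
    using P(2) by (subst integral_density) (auto intro: less_imp_le)
  also have "\<dots> = (\<integral>w. (case w of (x, z) \<Rightarrow> ln (P (x + z))) \<partial>(\<nu> \<Otimes>\<^sub>M \<Phi>))"
    unfolding law \<Phi>_def[symmetric] by (subst integral_distr) (auto simp: case_prod_beta')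
  also have "\<dots> = (\<integral>x. \<integral>z. ln (P (x + z)) \<partial>\<Phi> \<partial>\<nu>)" using VF.integral_fst'[OF li] by simp
  also have "\<dots> \<le> (\<integral>x. (\<integral>y. \<phi> y * ln (\<phi> y) \<partial>lborel) \<partial>\<nu>)"
    using VF.integrable_fst'[OF li] inner by (intro integral_mono) auto
  also have "\<dots> = (\<integral>y. \<phi> y * ln (\<phi> y) \<partial>lborel)" using V.prob_space by simp
  finally show ?thesis by (simp add: diff_entropy_def)
qed

lemma ln_normal_density: "0 < s \<Longrightarrow> ln (normal_density m s x) = - ln (2 * pi * s\<^sup>2) / 2 - (x - m)\<^sup>2 / (2 * s\<^sup>2)"
  unfolding normal_density_def by (subst ln_mult_pos) (auto simp: ln_divide_pos ln_sqrt)

lemma entropy_normal: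
  assumes s: "0 < s"
  shows "has_entropy (normal_density m s)" "diff_entropy (normal_density m s) = (ln (2 * pi * s\<^sup>2) + 1) / 2"
proof -
  have i: "integrable lborel (\<lambda>x. normal_density m s x * (x - m)\<^sup>2)" using s by (rule integrable_normal_moment)
  have v: "(\<integral>x. normal_density m s x * (x - m)\<^sup>2 \<partial>lborel) = s\<^sup>2"
    using integral_normal_moment_even[OF s, of m 1] s by simp
  have e: "(\<lambda>x. normal_density m s x * ln (normal_density m s x)) =
    (\<lambda>x. (- ln (2 * pi * s\<^sup>2) / 2) * normal_density m s x - (1 / (2 * s\<^sup>2)) * (normal_density m s x * (x - m)\<^sup>2))"
    by (rule ext) (simp add: ln_normal_density[OF s] algebra_simps)
  show "has_entropy (normal_density m s)" unfolding has_entropy_def e using i s by simp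
  have "(\<integral>x. normal_density m s x * ln (normal_density m s x) \<partial>lborel) = - ln (2 * pi * s\<^sup>2) / 2 - 1 / (2 * s\<^sup>2) * s\<^sup>2"
    unfolding e using i s by (subst Bochner_Integration.integral_diff) (auto simp: v)
  then show "diff_entropy (normal_density m s) = (ln (2 * pi * s\<^sup>2) + 1) / 2"
    using s by (simp add: diff_entropy_def add_divide_distrib)
qed

lemma integral_ln_normal:
  fixes p :: "real \<Rightarrow> real"
  assumes V: "0 < V" and p: "integrable lborel p" "(\<integral>y. p y \<partial>lborel) = 1"
    "integrable lborel (\<lambda>y. p y * (y - m)\<^sup>2)" "(\<integral>y. p y * (y - m)\<^sup>2 \<partial>lborel) = V'"
  shows "integrable lborel (\<lambda>y. p y * ln (normal_density m (sqrt V) y))"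
    "(\<integral>y. p y * ln (normal_density m (sqrt V) y) \<partial>lborel) = - ln (2 * pi * V) / 2 - V' / (2 * V)"
proof -
  have e: "(\<lambda>y. p y * ln (normal_density m (sqrt V) y)) = (\<lambda>y. (- ln (2 * pi * V) / 2) * p y - (1 / (2 * V)) * (p y * (y - m)\<^sup>2))"
    using V by (intro ext) (simp add: ln_normal_density algebra_simps)
  show "integrable lborel (\<lambda>y. p y * ln (normal_density m (sqrt V) y))" unfolding e using p by simp
  show "(\<integral>y. p y * ln (normal_density m (sqrt V) y) \<partial>lborel) = - ln (2 * pi * V) / 2 - V' / (2 * V)"
    unfolding e using p by (subst Bochner_Integration.integral_diff) auto
qed

context heat_flow
begin

text \<open>The smoothed variable has at least the entropy of its Gaussian noise. At large times
  this nearly matches the Gaussian maximum and anchors the integration over time.\<close>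

lemma entropy_heat_ge_normal:
  assumes t: "0 < t"
  shows "(ln (2 * pi * t) + 1) / 2 \<le> diff_entropy (heat \<mu> t)"
proof -
  have st: "0 < sqrt t" using t by simp
  have "diff_entropy (normal_density 0 (sqrt t)) \<le> diff_entropy (heat \<mu> t)"
  proof (rule mixture_entropy[OF prob sets_eq sq_int])
    show "integrable lborel (\<lambda>y. hk t y * ln (hk t y))" using entropy_normal(1)[OF st] by (simp add: has_entropy_def)
    show "integrable lborel (\<lambda>y. hk t y * y\<^sup>2)" using integrable_normal_moment[OF st, of 0 2] by simp
    show "\<bar>ln (heat \<mu> t y)\<bar> \<le> lnC t t * (1 + y\<^sup>2)" for y by (rule ln_heat_bound[OF t order.refl order.refl])
    show "density lborel (\<lambda>y. ennreal (heat \<mu> t y)) = distr (\<mu> \<Otimes>\<^sub>M density lborel (\<lambda>y. ennreal (hk t y))) borel (\<lambda>(x, z). x + z)"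
      using heat_law[OF t] by (simp add: normal_measure_def)
  qed (use st in \<open>auto intro!: heat_pos[OF t] heat_int[OF t]\<close>)
  then show ?thesis using entropy_normal(2)[OF st, of 0] t by simp
qed

lemma var_nonneg: "0 \<le> var" by (simp add: var_def)

lemma entropy_heat_le_normal:
  assumes t: "0 < t"
  shows "diff_entropy (heat \<mu> t) \<le> (ln (2 * pi * (var + t)) + 1) / 2"
proof -
  have V: "0 < var + t" using t var_nonneg by simp
  note l = integral_ln_normal[OF V heat_int[OF t] heat_sq_int[OF t] heat_var[OF t]]
  have "(\<integral>y. heat \<mu> t y * ln (normal_density mean (sqrt (var + t)) y) \<partial>lborel) \<le> (\<integral>y. heat \<mu> t y * ln (heat \<mu> t y) \<partial>lborel)"
    using V by (intro gibbs_inequality heat_int[OF t] heat_nonneg[OF t] entropy_heat_int[OF t] l(1) normal_density_pos)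
      (auto simp: heat_int[OF t])
  moreover have "(var + t) / (2 * (var + t)) = 1 / 2" using V by simp
  ultimately have "- ln (2 * pi * (var + t)) / 2 - 1 / 2 \<le> (\<integral>y. heat \<mu> t y * ln (heat \<mu> t y) \<partial>lborel)"
    by (simp only: l(2))
  then show ?thesis unfolding diff_entropy_def by (simp add: field_simps)
qed

text \<open>The mixture inequality with the roles exchanged: the Gaussian is now the mixing law and
  \<open>f\<close> the mixed density.\<close>

lemma entropy_heat_ge:
  assumes t: "0 < t" and [measurable]: "f \<in> borel_measurable borel" and f: "\<And>x. 0 \<le> f x" and \<mu>: "\<mu> = density lborel (\<lambda>x. ennreal (f x))"
    and ent: "has_entropy f"
  shows "diff_entropy f \<le> diff_entropy (heat \<mu> t)"
proof (rule mixture_entropy[OF prob_normal_measure[OF t] sets_normal_measure normal_measure_moments(1)[OF t]])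
  show "integrable lborel f" "(\<integral>x. f x \<partial>lborel) = 1"
    using prob f unfolding \<mu> by (simp_all add: prob_density_integral)
  show "integrable lborel (\<lambda>y. f y * y\<^sup>2)" using sq_int unfolding \<mu> by (subst (asm) integrable_density) (auto simp: f)
  show "\<bar>ln (heat \<mu> t y)\<bar> \<le> lnC t t * (1 + y\<^sup>2)" for y by (rule ln_heat_bound[OF t order.refl order.refl])
  interpret N: prob_space "normal_measure t" by (rule prob_normal_measure[OF t])
  interpret NM: pair_sigma_finite "normal_measure t" \<mu> ..
  have "density lborel (\<lambda>y. ennreal (heat \<mu> t y)) = distr (\<mu> \<Otimes>\<^sub>M normal_measure t) borel (\<lambda>(x, z). x + z)" by (rule heat_law[OF t])
  also have "\<dots> = distr (normal_measure t \<Otimes>\<^sub>M \<mu>) borel (\<lambda>(x, z). x + z)"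
  proof -
    interpret MN: pair_sigma_finite \<mu> "normal_measure t" ..
    show ?thesis
      by (subst MN.distr_pair_swap, subst distr_distr) (auto simp: comp_def case_prod_beta' add.commute)
  qed
  finally show "density lborel (\<lambda>y. ennreal (heat \<mu> t y)) = distr (normal_measure t \<Otimes>\<^sub>M density lborel (\<lambda>y. ennreal (f y))) borel (\<lambda>(x, z). x + z)"
    by (simp only: \<mu>)
qed (use ent f in \<open>auto simp: has_entropy_def intro!: heat_pos[OF t] heat_int[OF t]\<close>)

end

context score_density_test
begin

text \<open>Here \<open>w'\<close> is the derivative of the density of the sum of two copies. The
  identity expresses the slope through the sum alone, so that a \<open>u\<close> built from the
  score of the sum produces its Fisher information.\<close>

lemma a_eq_integral:
  assumes w': "\<And>s. w' s = (\<integral>x. p' (s - x) \<partial>Q)"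
  shows "a = - (\<integral>s. u s * w' s \<partial>lborel)"
proof -
  interpret QL: pair_sigma_finite Q lborel ..
  have F: "integrable (Q \<Otimes>\<^sub>M lborel) (\<lambda>(x, s). u s * p' (s - x))"
    by (rule integrable_bounded_shift(2)[OF prob_Q _ _ u_bdd int_p']) simp_all
  have "a = - (\<integral>x. \<integral>s. u s * p' (s - x) \<partial>lborel \<partial>Q)" unfolding a_def \<gamma>_alt by simp
  also have "\<dots> = - (\<integral>s. \<integral>x. u s * p' (s - x) \<partial>Q \<partial>lborel)" using QL.Fubini_integral[OF F] by simp
  also have "\<dots> = - (\<integral>s. u s * w' s \<partial>lborel)" by (simp add: w')
  finally show ?thesis .
qed

end

section \<open>Contraction of the entropy deficit\<close>

context score_density_test
begin

lemma square_eq_integral: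
  assumes w: "\<And>s. w s = (\<integral>x. p (s - x) \<partial>Q)"
  shows "(\<integral>x. \<integral>y. (u (x + y))\<^sup>2 \<partial>Q \<partial>Q) = (\<integral>s. (u s)\<^sup>2 * w s \<partial>lborel)"
proof -
  interpret QL: pair_sigma_finite Q lborel ..
  have inner: "(\<integral>y. (u (x + y))\<^sup>2 \<partial>Q) = (\<integral>s. (u s)\<^sup>2 * p (s - x) \<partial>lborel)" for x
  proof -
    have "(\<integral>s. (u s)\<^sup>2 * p (s - x) \<partial>lborel) = (\<integral>y. (u (x + y))\<^sup>2 * p y \<partial>lborel)"
      by (subst lborel_integral_real_affine[where c=1 and t=x]) auto
    then show ?thesis by (subst integral_Q) (auto simp: mult.commute)
  qed
  have "\<bar>(u s)\<^sup>2\<bar> \<le> Bu\<^sup>2" for s using square_le_of_abs_le[OF u_bdd] by simp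
  then have F: "integrable (Q \<Otimes>\<^sub>M lborel) (\<lambda>(x, s). (u s)\<^sup>2 * p (s - x))"
    by (intro integrable_bounded_shift(2)[OF prob_Q _ _ _ int_p]) simp_all
  have "(\<integral>x. \<integral>y. (u (x + y))\<^sup>2 \<partial>Q \<partial>Q) = (\<integral>s. \<integral>x. (u s)\<^sup>2 * p (s - x) \<partial>Q \<partial>lborel)"
    unfolding inner using QL.Fubini_integral[OF F] by simp
  then show ?thesis by (simp add: w)
qed

end

context heat_flow
begin

definition \<mu>2 where "\<mu>2 = distr (\<mu> \<Otimes>\<^sub>M \<mu>) borel (\<lambda>(x, y). x + y)"

interpretation MM: pair_prob_space \<mu> \<mu> ..

lemma sets_\<mu>2[simp, measurable_cong]: "sets \<mu>2 = sets borel" by (simp add: \<mu>2_def)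

lemma heat_flow_\<mu>2: "heat_flow \<mu>2"
proof (rule heat_flow.intro)
  show "prob_space \<mu>2" unfolding \<mu>2_def by (rule MM.prob_space_distr) measurable
  show "integrable \<mu>2 (\<lambda>x. x\<^sup>2)" 
    unfolding \<mu>2_def using integrable_pair_sum_square[OF prob prob sets_eq sets_eq sq_int sq_int, of 0]
    by (subst integrable_distr_eq) (auto simp: case_prod_beta')
qed simp

interpretation H2: heat_flow \<mu>2 by (rule heat_flow_\<mu>2)

context
  fixes t :: real
  assumes t: "0 < t"
begin

interpretation S: score_density "heat \<mu> t" "heat1 \<mu> t" "hC t t * (1 / sqrt (2 * pi * (2 * t)))"
  by (rule score_density_heat[OF t])
interpretation N: prob_space "normal_measure t" using t by (rule prob_normal_measure)

lemma hk_semigroup: "(\<integral>\<^sup>+z. ennreal (hk t (s - z)) \<partial>normal_measure t) = ennreal (hk (2 * t) s)"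
proof -
  have "(\<integral>\<^sup>+z. ennreal (hk t (s - z)) \<partial>normal_measure t) = (\<integral>\<^sup>+z. ennreal (hk t (s - z) * hk t z) \<partial>lborel)"
    unfolding normal_measure_def by (subst nn_integral_density) (auto simp: ennreal_mult' mult.commute)
  also have "\<dots> = ennreal (normal_density 0 (sqrt ((sqrt t)\<^sup>2 + (sqrt t)\<^sup>2)) s)"
    using fun_cong[OF conv_normal_density_zero_mean[of "sqrt t" "sqrt t"], of s] t by simp
  finally show ?thesis using t by (simp flip: mult_2)
qed

text \<open>Two copies smoothed with variance \<open>t\<close> each have a sum smoothed with
  variance \<open>2 * t\<close>, by the semigroup property of the kernel. The right side is the
  convolution density of that sum.\<close>

lemma heat_doubling: "heat \<mu>2 (2 * t) s = (\<integral>y. heat \<mu> t (s - y) \<partial>S.Q)"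
proof -
  interpret NM: pair_sigma_finite "normal_measure t" \<mu> ..
  interpret MN: pair_sigma_finite \<mu> "normal_measure t" ..
  have t2: "0 < 2 * t" using t by simp
  have bd: "\<bar>heat \<mu> t y\<bar> \<le> 1 / sqrt (2 * pi * t)" for y using heat_upper[OF t, of y] heat_nonneg[OF t, of y] by simp
  have i: "integrable S.Q (\<lambda>y. heat \<mu> t (s - y))"
    using bd by (intro S.Q.integrable_const_bound[of _ "1 / sqrt (2 * pi * t)"]) auto
  have "ennreal (heat \<mu>2 (2 * t) s) = (\<integral>\<^sup>+z. ennreal (hk (2 * t) (s - z)) \<partial>\<mu>2)" by (rule H2.heat_nn[OF t2])
  also have "\<dots> = (\<integral>\<^sup>+w. ennreal (hk (2 * t) (s - (fst w + snd w))) \<partial>(\<mu> \<Otimes>\<^sub>M \<mu>))"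
    unfolding \<mu>2_def by (subst nn_integral_distr) (auto simp: case_prod_beta')
  also have "\<dots> = (\<integral>\<^sup>+x'. \<integral>\<^sup>+x. ennreal (hk (2 * t) (s - (x' + x))) \<partial>\<mu> \<partial>\<mu>)"
    by (subst nn_integral_fst[symmetric]) auto
  also have "\<dots> = (\<integral>\<^sup>+x'. \<integral>\<^sup>+x. \<integral>\<^sup>+z. ennreal (hk t (s - (x' + x) - z)) \<partial>normal_measure t \<partial>\<mu> \<partial>\<mu>)"
    by (simp add: hk_semigroup)
  also have "\<dots> = (\<integral>\<^sup>+x'. \<integral>\<^sup>+z. \<integral>\<^sup>+x. ennreal (hk t (s - (x' + x) - z)) \<partial>\<mu> \<partial>normal_measure t \<partial>\<mu>)"
    by (intro nn_integral_cong NM.Fubini') measurable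
  also have "\<dots> = (\<integral>\<^sup>+x'. \<integral>\<^sup>+z. ennreal (heat \<mu> t (s - (x' + z))) \<partial>normal_measure t \<partial>\<mu>)"
    by (simp add: heat_nn[OF t] algebra_simps)
  also have "\<dots> = (\<integral>\<^sup>+w. ennreal (heat \<mu> t (s - (fst w + snd w))) \<partial>(\<mu> \<Otimes>\<^sub>M normal_measure t))"
    by (subst N.nn_integral_fst[symmetric]) auto
  also have "\<dots> = (\<integral>\<^sup>+y. ennreal (heat \<mu> t (s - y)) \<partial>S.Q)"
    unfolding score_density_heat_consts(1)[OF t] by (subst nn_integral_distr) (auto simp: case_prod_beta')
  also have "\<dots> = ennreal (\<integral>y. heat \<mu> t (s - y) \<partial>S.Q)"
    using i heat_nonneg[OF t] by (intro nn_integral_eq_integral) auto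
  finally show ?thesis using H2.heat_nonneg[OF t2, of s] heat_nonneg[OF t] by (subst (asm) ennreal_inj) auto
qed

lemma heat1_doubling: "heat1 \<mu>2 (2 * t) s = (\<integral>y. heat1 \<mu> t (s - y) \<partial>S.Q)"
proof -
  have t2: "0 < 2 * t" using t by simp
  have bd: "\<bar>heat \<mu> t y\<bar> \<le> 1 / sqrt (2 * pi * t)" for y using heat_upper[OF t, of y] heat_nonneg[OF t, of y] by simp
  have "((\<lambda>s. \<integral>y. heat \<mu> t (s - y) \<partial>S.Q) has_real_derivative (\<integral>y. heat1 \<mu> t (s - y) \<partial>S.Q)) (at s)"
  proof (rule has_derivative_integral_bounded[where l="s - 1" and u="s + 1" and \<phi>="\<lambda>s y. heat \<mu> t (s - y)", OF S.Q.finite_measure_axioms])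
    show "integrable S.Q (\<lambda>y. heat \<mu> t (s - y))" for s
      using bd by (intro S.Q.integrable_const_bound[of _ "1 / sqrt (2 * pi * t)"]) auto
    show "((\<lambda>s. heat \<mu> t (s - y)) has_real_derivative heat1 \<mu> t (s - y)) (at s)" for y s
    proof -
      have d: "((\<lambda>s. s - y) has_real_derivative 1) (at s)" by (auto intro!: derivative_eq_intros)
      show ?thesis using DERIV_chain2[OF heat_deriv_y(1)[OF t] d] by simp
    qed
    show "\<bar>heat1 \<mu> t (s - y)\<bar> \<le> hC t t * (1 / sqrt (2 * pi * (2 * t)))" for s y by (rule heat1_bdd[OF t])
  qed simp_all
  then have "(heat \<mu>2 (2 * t) has_real_derivative (\<integral>y. heat1 \<mu> t (s - y) \<partial>S.Q)) (at s)"
    by (simp add: heat_doubling[abs_def])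
  then show ?thesis using H2.heat_deriv_y(1)[OF t2] DERIV_unique by blast
qed

text \<open>Take \<open>u\<close> to be \<open>2 * (w' / w)\<close>, the conditional expectation of
  the sum of the two scores given the sum of the variables. Then \<open>a\<close> is
  \<open>-2\<close> times and the second moment of \<open>u\<close> is \<open>4\<close> times the
  Fisher information of the sum, and \<open>projection_gap\<close> becomes the claim
  doubled.\<close>

lemma fisher_doubling:
  assumes R: "poincare_bound \<mu> R" "0 < R"
  shows "((var + t) * fisher \<mu> t - 1) / (2 * (R + t) + (var + t)) \<le> fisher \<mu> t - 2 * fisher \<mu>2 (2 * t)"
proof -
  have t2: "0 < 2 * t" using t by simp
  define w where "w = heat \<mu>2 (2 * t)"
  define w' where "w' = heat1 \<mu>2 (2 * t)"
  have [measurable]: "w \<in> borel_measurable borel" "w' \<in> borel_measurable borel" unfolding w_def w'_def by measurable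
  have wpos: "0 < w s" for s unfolding w_def by (rule H2.heat_pos[OF t2])
  have Fint: "integrable lborel (\<lambda>s. (w' s)\<^sup>2 / w s)" unfolding w_def w'_def by (rule H2.fisher_int[OF t2])
  have pb: "poincare_bound S.Q (R + t)"
    unfolding score_density_heat_consts(1)[OF t]
    by (rule poincare_bound_convolution[OF prob sets_eq sq_int prob_normal_measure[OF t] sets_normal_measure normal_measure_moments(1)[OF t] R(1) poincare_bound_normal[OF t]])
      (use t in simp)
  \<comment> \<open>Test functions must be bounded, so the score of the sum is cut off where it
    exceeds \<open>n\<close>; dominated convergence restores the full Fisher information
    \<open>I\<close>.\<close>
  define A where "A n = {s. \<bar>w' s / w s\<bar> \<le> real n}" for n
  have [measurable]: "A n \<in> sets borel" for n unfolding A_def by measurable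
  define I where "I n = (\<integral>s. (w' s)\<^sup>2 / w s * indicator (A n) s \<partial>lborel)" for n
  have step: "2 * ((var + t) * fisher \<mu> t - 1) / (2 * (R + t) + (var + t)) \<le> 2 * fisher \<mu> t - 4 * I n" for n
  proof -
    define u where "u s = 2 * (w' s / w s) * indicator (A n) s" for s
    have um: "u \<in> borel_measurable borel" unfolding u_def[abs_def] by measurable
    have ub: "\<bar>u s\<bar> \<le> 2 * real n" for s by (auto simp: u_def A_def indicator_def)
    interpret T: score_density_test "heat \<mu> t" "heat1 \<mu> t" "hC t t * (1 / sqrt (2 * pi * (2 * t)))" u "2 * real n"
      by unfold_locales (fact um, fact ub)
    have "T.a = - (\<integral>s. u s * w' s \<partial>lborel)" by (rule T.a_eq_integral) (simp add: w'_def heat1_doubling)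
    also have "(\<lambda>s. u s * w' s) = (\<lambda>s. 2 * ((w' s)\<^sup>2 / w s * indicator (A n) s))"
      by (rule ext) (simp add: u_def power2_eq_square)
    finally have a: "T.a = - 2 * I n" by (simp only: I_def integral_mult_right_zero mult_minus_left)
    have "(\<integral>x. \<integral>y. (u (x + y))\<^sup>2 \<partial>S.Q \<partial>S.Q) = (\<integral>s. (u s)\<^sup>2 * w s \<partial>lborel)"
      by (rule T.square_eq_integral) (simp add: w_def heat_doubling)
    also have "(\<lambda>s. (u s)\<^sup>2 * w s) = (\<lambda>s. 4 * ((w' s)\<^sup>2 / w s * indicator (A n) s))"
    proof
      fix s show "(u s)\<^sup>2 * w s = 4 * ((w' s)\<^sup>2 / w s * indicator (A n) s)"
        using wpos[of s] by (auto simp: u_def indicator_def power2_eq_square)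
    qed
    finally have b: "(\<integral>x. \<integral>y. (u (x + y))\<^sup>2 \<partial>S.Q \<partial>S.Q) = 4 * I n" by (simp only: I_def integral_mult_right_zero)
    show ?thesis
      using T.projection_gap[OF pb] R(2) t by (simp add: a b score_density_heat_consts(3,4)[OF t])
  qed
  have "I \<longlonglongrightarrow> (\<integral>s. (w' s)\<^sup>2 / w s \<partial>lborel)" unfolding I_def
  proof (rule integral_dominated_convergence[where w="\<lambda>s. (w' s)\<^sup>2 / w s"])
    show "AE s in lborel. (\<lambda>n. (w' s)\<^sup>2 / w s * indicator (A n) s) \<longlonglongrightarrow> (w' s)\<^sup>2 / w s"
    proof (intro AE_I2 tendsto_eventually)
      fix s
      obtain n0 :: nat where n0: "\<bar>w' s / w s\<bar> \<le> real n0" using real_arch_simple by blast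
      show "\<forall>\<^sub>F n in sequentially. (w' s)\<^sup>2 / w s * indicator (A n) s = (w' s)\<^sup>2 / w s"
        using eventually_ge_at_top[of n0]
      proof eventually_elim
        case (elim n)
        then have "s \<in> A n" using n0 unfolding A_def by (simp add: order_trans[OF n0])
        then show ?case by simp
      qed
    qed
    show "AE s in lborel. norm ((w' s)\<^sup>2 / w s * indicator (A n) s) \<le> (w' s)\<^sup>2 / w s" for n
      using wpos by (intro AE_I2) (auto simp: indicator_def less_imp_le)
  qed (use Fint in auto)
  then have "(\<lambda>n. 2 * fisher \<mu> t - 4 * I n) \<longlonglongrightarrow> 2 * fisher \<mu> t - 4 * fisher \<mu>2 (2 * t)"
    by (intro tendsto_intros) (simp add: fisher_def w_def w'_def)
  then have "2 * ((var + t) * fisher \<mu> t - 1) / (2 * (R + t) + (var + t)) \<le> 2 * fisher \<mu> t - 4 * fisher \<mu>2 (2 * t)"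
    by (rule LIMSEQ_le_const) (use step in blast)
  then have "2 * (((var + t) * fisher \<mu> t - 1) / (2 * (R + t) + (var + t))) \<le> 2 * fisher \<mu> t - 4 * fisher \<mu>2 (2 * t)"
    by (simp only: times_divide_eq_right)
  then show ?thesis by linarith
qed

lemma fisher_ge: "1 / (var + t) \<le> fisher \<mu> t"
  using S.cramer_rao S.v_pos by (simp add: score_density_heat_consts[OF t] field_simps)

end

lemma poincare_ge_var:
  assumes "poincare_bound \<mu> R" shows "var \<le> R"
proof -
  have "abs_cont_deriv (\<lambda>x. x) (\<lambda>x. 1)"
    unfolding abs_cont_deriv_def by (auto simp: set_integrable_def set_lebesgue_integral_def)
  then have "(\<integral>x. (x - (\<integral>y. y \<partial>\<mu>))\<^sup>2 \<partial>\<mu>) \<le> R * (\<integral>x. 1\<^sup>2 \<partial>\<mu>)"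
    using assms[unfolded poincare_bound_def, rule_format, of "\<lambda>x. x" "\<lambda>x. 1" 1] by simp
  then show ?thesis using prob_space by (simp add: var_def mean_def)
qed

text \<open>Here \<open>c s\<close> is the entropy of a Gaussian of variance \<open>var + s\<close>.
  Formally, twice the derivative of \<Lambda> is \<open>1 / V - 2 * fisher \<mu>2 (2 * s) - \<kappa>
  * (1 / V - fisher \<mu> s)\<close> with \<open>V = var + s\<close>, and
  \<open>fisher_doubling\<close> shows it to be nonnegative. De Bruijn's identity gives the
  integrated version.\<close>

lemma entropy_deficit_mono:
  assumes R: "poincare_bound \<mu> R" "0 < var" and ab: "0 < a" "a \<le> b"
    and \<kappa>: "\<kappa> = 2 * R / (2 * R + var)"
    and c: "\<And>s. c s = (ln (2 * pi * (var + s)) + 1) / 2"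
    and \<Lambda>: "\<And>s. \<Lambda> s = (c s - diff_entropy (heat \<mu>2 (2 * s))) - \<kappa> * (c s - diff_entropy (heat \<mu> s))"
  shows "\<Lambda> a \<le> \<Lambda> b"
proof -
  have Rv: "var \<le> R" "0 < R" using poincare_ge_var[OF R(1)] R(2) by auto
  have cs: "(LINT s:{a..b}|lborel. 1 / (var + s)) = 2 * (c b - c a)" and ci: "set_integrable lborel {a..b} (\<lambda>s. 1 / (var + s))"
  proof -
    have d: "((\<lambda>s. ln (2 * pi * (var + s))) has_real_derivative 1 / (var + s)) (at s)" if "a \<le> s" for s
    proof -
      have "0 < var + s" using that ab R(2) by simp
      then show ?thesis by (auto intro!: derivative_eq_intros)
    qed
    have k: "continuous_on {a..b} (\<lambda>s. 1 / (var + s))" using ab R(2) by (intro continuous_intros) auto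
    show "set_integrable lborel {a..b} (\<lambda>s. 1 / (var + s))" using integral_FTC_Icc_cont(1)[OF ab(2) d k] by simp
    show "(LINT s:{a..b}|lborel. 1 / (var + s)) = 2 * (c b - c a)"
      using integral_FTC_Icc_cont(2)[OF ab(2) d k] by (simp add: c field_simps)
  qed
  have f1: "set_integrable lborel {a..b} (fisher \<mu>)" "(LINT s:{a..b}|lborel. fisher \<mu> s) = 2 * (diff_entropy (heat \<mu> b) - diff_entropy (heat \<mu> a))"
    using de_bruijn[OF ab] by simp_all
  have g1: "set_integrable lborel {2 * a..2 * b} (fisher \<mu>2)"
     "(LINT s:{2 * a..2 * b}|lborel. fisher \<mu>2 s) = 2 * (diff_entropy (heat \<mu>2 (2 * b)) - diff_entropy (heat \<mu>2 (2 * a)))"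
    using H2.de_bruijn[of "2 * a" "2 * b"] ab by simp_all
  have ind: "indicator {2 * a..2 * b} (2 * s) = indicat_real {a..b} s" for s by (auto simp: indicator_def)
  have f2: "set_integrable lborel {a..b} (\<lambda>s. fisher \<mu>2 (2 * s))"
    using lborel_integrable_real_affine[OF g1(1)[unfolded set_integrable_def], of 2 0] by (simp add: set_integrable_def ind)
  have f2': "(LINT s:{a..b}|lborel. fisher \<mu>2 (2 * s)) = diff_entropy (heat \<mu>2 (2 * b)) - diff_entropy (heat \<mu>2 (2 * a))"
    using g1(2) lborel_integral_real_affine[of 2 "\<lambda>s. indicator {2 * a..2 * b} s *\<^sub>R fisher \<mu>2 s" 0]
    by (simp add: set_lebesgue_integral_def ind)
  have "0 \<le> (LINT s:{a..b}|lborel. 1 / (var + s) - 2 * fisher \<mu>2 (2 * s) - \<kappa> * (1 / (var + s) - fisher \<mu> s))"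
  proof (unfold set_lebesgue_integral_def, rule integral_nonneg_AE, intro AE_I2)
    fix s
    have pw: "0 \<le> 1 / (var + s) - 2 * fisher \<mu>2 (2 * s) - \<kappa> * (1 / (var + s) - fisher \<mu> s)" if s: "s \<in> {a..b}"
    proof -
      have s0: "0 < s" using s ab by simp
      define V where "V = var + s"
      define F where "F = fisher \<mu> s"
      have V: "0 < V" using s0 R(2) by (simp add: V_def)
      have F: "1 / V \<le> F" unfolding V_def F_def by (rule fisher_ge[OF s0])
      have g: "(V * F - 1) / (2 * (R + s) + V) \<le> F - 2 * fisher \<mu>2 (2 * s)"
        unfolding V_def F_def by (rule fisher_doubling[OF s0 R(1) Rv(2)])
      \<comment> \<open>The right side is \<open>(var + s) / (2 * R + var + 3 * s)\<close>: passing
        from time zero to \<open>s\<close> moves the ratio towards 1/3, and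
        \<open>var \<le> R\<close> means that it starts at or below 1/3.\<close>
      have fr: "1 - \<kappa> \<le> V / (2 * (R + s) + V)"
      proof -
        have "1 - \<kappa> = var / (2 * R + var)" using Rv R(2) by (simp add: \<kappa> field_simps)
        also have "\<dots> \<le> V / (2 * (R + s) + V)"
        proof -
          have "var * (2 * (R + s) + V) \<le> V * (2 * R + var)"
            unfolding V_def using mult_left_mono[OF Rv(1), of s] s0 by (simp add: algebra_simps)
          then show ?thesis using Rv R(2) s0 V by (simp add: divide_le_eq le_divide_eq field_simps)
        qed
        finally show ?thesis .
      qed
      have "(1 - \<kappa>) * (F - 1 / V) \<le> V / (2 * (R + s) + V) * (F - 1 / V)" using fr F by (intro mult_right_mono) auto
      also have "\<dots> = (V * (F - 1 / V)) / (2 * (R + s) + V)" by simp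
      also have "V * (F - 1 / V) = V * F - 1" using V by (simp add: right_diff_distrib)
      also note g
      finally have le: "(1 - \<kappa>) * (F - 1 / V) \<le> F - 2 * fisher \<mu>2 (2 * s)" .
      have "(1 - \<kappa>) * (F - i) = F - i - \<kappa> * (F - i)" for i by (simp add: algebra_simps)
      moreover have "\<kappa> * (F - i) = - (\<kappa> * (i - F))" for i by (simp add: algebra_simps)
      ultimately have "0 \<le> 1 / V - 2 * fisher \<mu>2 (2 * s) - \<kappa> * (1 / V - F)" using le by simp
      then show ?thesis by (simp only: V_def F_def)
    qed
    then show "0 \<le> indicator {a..b} s *\<^sub>R (1 / (var + s) - 2 * fisher \<mu>2 (2 * s) - \<kappa> * (1 / (var + s) - fisher \<mu> s))"
      by (auto simp: indicator_def)
  qed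
  also have "\<dots> = (LINT s:{a..b}|lborel. 1 / (var + s)) - 2 * (LINT s:{a..b}|lborel. fisher \<mu>2 (2 * s))
      - \<kappa> * ((LINT s:{a..b}|lborel. 1 / (var + s)) - (LINT s:{a..b}|lborel. fisher \<mu> s))"
    using ci f1(1) f2 by (simp add: set_integral_diff set_integral_mult_right)
  also have "\<dots> = 2 * (\<Lambda> b - \<Lambda> a)" unfolding cs f1(2) f2' \<Lambda> by (simp add: algebra_simps)
  finally show ?thesis by simp
qed

text \<open>Since \<Lambda> increases, it is bounded by its behaviour at large \<open>T\<close>.
  There the entropy of the sum is at least that of its noise of variance \<open>2 * T\<close> and
  the \<kappa>-term is nonnegative, so \<open>\<Lambda> T + ln 2 / 2\<close> is at most
  \<open>ln ((var + T) / T) / 2\<close>, which tends to zero. The shift \<open>ln 2 / 2\<close> is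
  the effect of dividing the sum by \<open>sqrt 2\<close>.\<close>

lemma entropy_deficit_contraction:
  assumes R: "poincare_bound \<mu> R" "0 < var" and s: "0 < s"
  shows "(ln (2 * pi * (var + s)) + 1) / 2 - (diff_entropy (heat \<mu>2 (2 * s)) - ln 2 / 2)
      \<le> 2 * R / (2 * R + var) * ((ln (2 * pi * (var + s)) + 1) / 2 - diff_entropy (heat \<mu> s))"
proof -
  define \<kappa> where "\<kappa> = 2 * R / (2 * R + var)"
  define c where "c s = (ln (2 * pi * (var + s)) + 1) / 2" for s
  define \<Lambda> where "\<Lambda> s = (c s - diff_entropy (heat \<mu>2 (2 * s))) - \<kappa> * (c s - diff_entropy (heat \<mu> s))" for s
  have Rv: "var \<le> R" using poincare_ge_var[OF R(1)] .
  have k0: "0 \<le> \<kappa>" using Rv R(2) by (simp add: \<kappa>_def)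
  have up: "\<Lambda> T + ln 2 / 2 \<le> ln ((var + T) / T) / 2" if T: "0 < T" for T
  proof -
    have "(ln (2 * pi * (2 * T)) + 1) / 2 \<le> diff_entropy (heat \<mu>2 (2 * T))" using T by (intro H2.entropy_heat_ge_normal) simp
    moreover have "diff_entropy (heat \<mu> T) \<le> c T" unfolding c_def by (rule entropy_heat_le_normal[OF T])
    then have "0 \<le> \<kappa> * (c T - diff_entropy (heat \<mu> T))" using k0 by simp
    moreover have "ln (2 * pi * (2 * T)) = ln (2 * pi) + (ln 2 + ln T)"
      using ln_mult_pos[of "2 * pi" "2 * T"] ln_mult_pos[of 2 T] T by simp
    moreover have "ln (2 * pi * (var + T)) = ln (2 * pi) + ln (var + T)" using T R(2) by (intro ln_mult_pos) auto
    moreover have "ln ((var + T) / T) = ln (var + T) - ln T" using T R(2) by (simp add: ln_divide_pos)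
    ultimately show ?thesis unfolding \<Lambda>_def c_def by argo
  qed
  have "((\<lambda>T. ln ((var + T) / T) / 2) \<longlongrightarrow> 0) at_top" using R(2) by real_asymp
  moreover have "\<forall>\<^sub>F T in at_top. \<Lambda> s + ln 2 / 2 \<le> ln ((var + T) / T) / 2"
    using eventually_ge_at_top[of s]
  proof eventually_elim
    case (elim T)
    have "\<Lambda> s \<le> \<Lambda> T" by (rule entropy_deficit_mono[OF R s elim \<kappa>_def c_def \<Lambda>_def])
    then show ?case using up[of T] s elim by simp
  qed
  ultimately have "\<Lambda> s + ln 2 / 2 \<le> 0"
    by (intro tendsto_lowerbound[of "\<lambda>T. ln ((var + T) / T) / 2" 0 at_top]) auto
  then show ?thesis by (simp add: \<Lambda>_def c_def \<kappa>_def)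
qed

end

section \<open>Lower semicontinuity of entropy\<close>

text \<open>Truncate \<open>g\<close> in height and support first. Continuous functions converging
  almost everywhere to the truncation, clipped to \<open>[0, k]\<close> and multiplied by the cutoff
  \<open>cut\<close>, are then dominated by an integrable step function.\<close>

lemma L1_continuous_approx:
  fixes g :: "real \<Rightarrow> real"
  assumes [measurable]: "g \<in> borel_measurable borel" and g0: "\<And>x. 0 \<le> g x" and gi: "integrable lborel g" and e: "0 < e"
  obtains c K where "continuous_on UNIV c" "\<And>x. 0 \<le> c x" "\<And>x. c x \<le> K" "integrable lborel c" "(\<integral>x. \<bar>g x - c x\<bar> \<partial>lborel) < e"
proof -
  define G where "G k x = min (g x) (real k) * indicator {- real k..real k} x" for k :: nat and x
  have Gm[measurable]: "G k \<in> borel_measurable borel" for k unfolding G_def[abs_def] by measurable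
  have G0: "0 \<le> G k x" "G k x \<le> g x" "G k x \<le> real k * indicator {- real k..real k} x" for k x
    using g0[of x] by (auto simp: G_def indicator_def)
  have Gi: "integrable lborel (G k)" for k
    by (rule Bochner_Integration.integrable_bound[OF gi]) (use G0 g0 in auto)
  have "(\<lambda>k. \<integral>x. \<bar>g x - G k x\<bar> \<partial>lborel) \<longlonglongrightarrow> (\<integral>x. 0 \<partial>(lborel :: real measure))"
  proof (rule integral_dominated_convergence[where w=g and f="\<lambda>_. 0::real"])
    show "AE x in lborel. (\<lambda>k. \<bar>g x - G k x\<bar>) \<longlonglongrightarrow> 0"
    proof (intro AE_I2 tendsto_eventually)
      fix x
      obtain k0 :: nat where k0: "max (g x) \<bar>x\<bar> \<le> real k0" using real_arch_simple by blast
      show "\<forall>\<^sub>F k in sequentially. \<bar>g x - G k x\<bar> = 0"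
        using eventually_ge_at_top[of k0]
      proof eventually_elim
        case (elim k)
        then have "max (g x) \<bar>x\<bar> \<le> real k" using k0 by (meson of_nat_le_iff order_trans)
        then have "g x \<le> real k" "x \<in> {- real k..real k}" by auto
        then show ?case by (simp add: G_def)
      qed
    qed
    show "AE x in lborel. norm \<bar>g x - G k x\<bar> \<le> g x" for k using G0 by (intro AE_I2) (auto simp: abs_le_iff)
  qed (use gi in auto)
  then have "\<forall>\<^sub>F k in sequentially. (\<integral>x. \<bar>g x - G k x\<bar> \<partial>lborel) < e / 2"
    using e by (intro order_tendstoD(2)) auto
  then obtain k where k: "(\<integral>x. \<bar>g x - G k x\<bar> \<partial>lborel) < e / 2" by (auto simp: eventually_sequentially)
  have "G k measurable_on UNIV"
    by (rule lebesgue_measurable_imp_measurable_on_real) (auto intro: measurable_completion)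
  then obtain N h where N: "negligible N" and h: "\<And>n. continuous_on UNIV (h n)" "\<And>x. x \<notin> N \<Longrightarrow> (\<lambda>n. h n x) \<longlonglongrightarrow> G k x"
    unfolding measurable_on_def by auto
  define cut where "cut x = max 0 (min 1 (real k + 1 - \<bar>x\<bar>))" for x :: real
  define d where "d n x = max 0 (min (h n x) (real k)) * cut x" for n x
  have dc: "continuous_on UNIV (d n)" for n
    unfolding d_def[abs_def] cut_def[abs_def] by (intro continuous_intros h)
  have [measurable]: "d n \<in> borel_measurable borel" for n using dc by (rule borel_measurable_continuous_onI)
  have cut: "0 \<le> cut x" "cut x \<le> indicator {- (real k + 1)..real k + 1} x" for x
    by (auto simp: cut_def indicator_def)
  have d0: "0 \<le> d n x" "d n x \<le> real k * indicator {- (real k + 1)..real k + 1} x" for n x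
  proof -
    show "0 \<le> d n x" using cut by (simp add: d_def)
    show "d n x \<le> real k * indicator {- (real k + 1)..real k + 1} x"
      unfolding d_def using cut[of x] by (intro mult_mono) auto
  qed
  have dk: "d n x \<le> real k" for n x
    using d0(2)[of n x] by (rule order_trans) (simp add: indicator_def)
  have bi: "integrable lborel (\<lambda>x. real k * indicat_real {- (real k + 1)..real k + 1} x)" by simp
  have di: "integrable lborel (d n)" for n
    by (rule Bochner_Integration.integrable_bound[OF bi]) (use d0 in \<open>auto intro!: order_trans[OF _ abs_ge_self]\<close>)
  have "(\<lambda>n. \<integral>x. \<bar>G k x - d n x\<bar> \<partial>lborel) \<longlonglongrightarrow> (\<integral>x. 0 \<partial>(lborel :: real measure))"
  proof (rule integral_dominated_convergence[where f="\<lambda>_. 0::real" and w="\<lambda>x. 2 * (real k * indicat_real {- (real k + 1)..real k + 1} x)"])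
    have "AE x in lebesgue. x \<notin> N" using N by (intro AE_not_in) (simp add: negligible_iff_null_sets)
    then have "AE x in lborel. x \<notin> N" by (simp add: AE_completion_iff)
    then show "AE x in lborel. (\<lambda>n. \<bar>G k x - d n x\<bar>) \<longlonglongrightarrow> 0"
    proof eventually_elim
      case (elim x)
      have "(\<lambda>n. max 0 (min (h n x) (real k)) * cut x) \<longlonglongrightarrow> max 0 (min (G k x) (real k)) * cut x"
        by (intro tendsto_intros h elim)
      moreover have "max 0 (min (G k x) (real k)) * cut x = G k x"
        using G0[of k x] g0[of x] by (auto simp: cut_def G_def indicator_def abs_le_iff)
      ultimately have "(\<lambda>n. d n x) \<longlonglongrightarrow> G k x" unfolding d_def by (simp only:)
      then have "(\<lambda>n. \<bar>G k x - d n x\<bar>) \<longlonglongrightarrow> \<bar>G k x - G k x\<bar>" by (intro tendsto_intros)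
      then show ?case by simp
    qed
    have Gb: "G k x \<le> real k * indicat_real {- (real k + 1)..real k + 1} x" for x
      using G0(3)[of k x] by (rule order_trans) (auto simp: indicator_def)
    have "\<bar>G k x - d n x\<bar> \<le> 2 * (real k * indicat_real {- (real k + 1)..real k + 1} x)" for n x
      using Gb[of x] G0(1)[of k x] d0[of n x] by (intro abs_leI) linarith+
    then show "AE x in lborel. norm \<bar>G k x - d n x\<bar> \<le> 2 * (real k * indicat_real {- (real k + 1)..real k + 1} x)" for n by simp
  qed auto
  then have "\<forall>\<^sub>F n in sequentially. (\<integral>x. \<bar>G k x - d n x\<bar> \<partial>lborel) < e / 2"
    using e by (intro order_tendstoD(2)) auto
  then obtain n where n: "(\<integral>x. \<bar>G k x - d n x\<bar> \<partial>lborel) < e / 2" by (auto simp: eventually_sequentially)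
  have "(\<integral>x. \<bar>g x - d n x\<bar> \<partial>lborel) \<le> (\<integral>x. \<bar>g x - G k x\<bar> + \<bar>G k x - d n x\<bar> \<partial>lborel)"
    using gi Gi di by (intro integral_mono) auto
  also have "\<dots> < e" using gi Gi[of k] di[of n] n k by simp
  finally show ?thesis using that[OF dc d0(1) dk di] by blast
qed

text \<open>The same smoothing as \<open>heat\<close>, but for functions of any sign: the
  approximation argument applies it to a difference of densities.\<close>

definition gconv :: "(real \<Rightarrow> real) \<Rightarrow> real \<Rightarrow> real \<Rightarrow> real" where
  "gconv k t y = (\<integral>x. hk t (y - x) * k x \<partial>lborel)"

lemma gconv_meas[measurable]:
  assumes [measurable]: "k \<in> borel_measurable borel"
  shows "gconv k t \<in> borel_measurable borel"
  unfolding gconv_def[abs_def] by measurable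

lemma gconv_kernel_int:
  assumes t: "0 < t" and k: "integrable lborel k"
  shows "integrable lborel (\<lambda>x. hk t (y - x) * k x)"
proof (rule Bochner_Integration.integrable_bound)
  have [measurable]: "k \<in> borel_measurable borel" using k by simp
  show "integrable lborel (\<lambda>x. 1 / sqrt (2 * pi * t) * k x)" using k by simp
  show "AE x in lborel. norm (hk t (y - x) * k x) \<le> norm (1 / sqrt (2 * pi * t) * k x)"
    using hk_le[OF t] t unfolding norm_mult
    by (intro AE_I2 mult_right_mono) (auto intro: order_trans[OF _ abs_ge_self])
  show "(\<lambda>x. hk t (y - x) * k x) \<in> borel_measurable lborel" by measurable
qed

lemma gconv_L1:
  assumes t: "0 < t" and k: "integrable lborel k"
  shows "(\<integral>\<^sup>+y. ennreal \<bar>gconv k t y\<bar> \<partial>lborel) \<le> (\<integral>\<^sup>+x. ennreal \<bar>k x\<bar> \<partial>lborel)" "integrable lborel (gconv k t)"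
    "(\<integral>y. \<bar>gconv k t y\<bar> \<partial>lborel) \<le> (\<integral>x. \<bar>k x\<bar> \<partial>lborel)"
proof -
  have [measurable]: "k \<in> borel_measurable borel" using k by simp
  have one: "(\<integral>\<^sup>+y. ennreal (hk t (y - x)) \<partial>lborel) = 1" for x
  proof -
    have "(\<integral>\<^sup>+y. ennreal (hk t (y - x)) \<partial>lborel) = (\<integral>\<^sup>+y. ennreal (hk t y) \<partial>lborel)"
      by (subst nn_integral_real_affine[where c=1 and t=x]) auto
    then show ?thesis using t by (simp add: nn_integral_eq_integral)
  qed
  have "(\<integral>\<^sup>+y. ennreal \<bar>gconv k t y\<bar> \<partial>lborel) \<le> (\<integral>\<^sup>+y. \<integral>\<^sup>+x. ennreal (hk t (y - x)) * ennreal \<bar>k x\<bar> \<partial>lborel \<partial>lborel)"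
  proof (rule nn_integral_mono)
    fix y
    have "\<bar>gconv k t y\<bar> \<le> (\<integral>x. \<bar>hk t (y - x) * k x\<bar> \<partial>lborel)" unfolding gconv_def by (rule integral_abs_bound)
    then have "ennreal \<bar>gconv k t y\<bar> \<le> ennreal (\<integral>x. \<bar>hk t (y - x) * k x\<bar> \<partial>lborel)" by (rule ennreal_leI)
    also have "\<dots> = (\<integral>\<^sup>+x. ennreal \<bar>hk t (y - x) * k x\<bar> \<partial>lborel)"
      using gconv_kernel_int[OF t k, of y] by (intro nn_integral_eq_integral[symmetric]) auto
    also have "\<dots> = (\<integral>\<^sup>+x. ennreal (hk t (y - x)) * ennreal \<bar>k x\<bar> \<partial>lborel)"
      by (intro nn_integral_cong) (simp add: abs_mult ennreal_mult)
    finally show "ennreal \<bar>gconv k t y\<bar> \<le> (\<integral>\<^sup>+x. ennreal (hk t (y - x)) * ennreal \<bar>k x\<bar> \<partial>lborel)" .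
  qed
  also have "\<dots> = (\<integral>\<^sup>+x. \<integral>\<^sup>+y. ennreal (hk t (y - x)) * ennreal \<bar>k x\<bar> \<partial>lborel \<partial>lborel)"
    by (rule lborel_pair.Fubini') measurable
  also have "\<dots> = (\<integral>\<^sup>+x. ennreal \<bar>k x\<bar> \<partial>lborel)" by (simp add: nn_integral_multc one)
  finally show le: "(\<integral>\<^sup>+y. ennreal \<bar>gconv k t y\<bar> \<partial>lborel) \<le> (\<integral>\<^sup>+x. ennreal \<bar>k x\<bar> \<partial>lborel)" .
  have fin: "(\<integral>\<^sup>+x. ennreal \<bar>k x\<bar> \<partial>lborel) = ennreal (\<integral>x. \<bar>k x\<bar> \<partial>lborel)" using k by (intro nn_integral_eq_integral) auto
  show i: "integrable lborel (gconv k t)"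
  proof (rule integrableI_bounded)
    show "(\<integral>\<^sup>+y. ennreal (norm (gconv k t y)) \<partial>lborel) < \<infinity>"
      using le unfolding fin by (simp add: le_less_trans[OF _ ennreal_less_top])
  qed simp
  have "(\<integral>\<^sup>+y. ennreal \<bar>gconv k t y\<bar> \<partial>lborel) = ennreal (\<integral>y. \<bar>gconv k t y\<bar> \<partial>lborel)" using i by (intro nn_integral_eq_integral) auto
  then show "(\<integral>y. \<bar>gconv k t y\<bar> \<partial>lborel) \<le> (\<integral>x. \<bar>k x\<bar> \<partial>lborel)" using le unfolding fin by simp
qed

lemma gconv_tendsto:
  assumes c: "continuous_on UNIV c" "\<And>x. \<bar>c x\<bar> \<le> K" and t: "\<And>n. 0 < t n" "t \<longlonglongrightarrow> 0"
  shows "(\<lambda>n. gconv c (t n) y) \<longlonglongrightarrow> c y"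
proof -
  have [measurable]: "c \<in> borel_measurable borel" using c(1) by (rule borel_measurable_continuous_onI)
  interpret N: prob_space "normal_measure 1" by (rule prob_normal_measure) simp
  have eq: "gconv c (t n) y = (\<integral>z. c (y + sqrt (t n) * z) \<partial>normal_measure 1)" for n
  proof -
    have s: "0 < sqrt (t n)" using t by simp
    have "gconv c (t n) y = \<bar>sqrt (t n)\<bar> *\<^sub>R (\<integral>z. hk (t n) (y - (y + sqrt (t n) * z)) * c (y + sqrt (t n) * z) \<partial>lborel)"
      unfolding gconv_def using s by (subst lborel_integral_real_affine[where c="sqrt (t n)" and t=y]) auto
    also have "\<dots> = (\<integral>z. hk 1 z * c (y + sqrt (t n) * z) \<partial>lborel)"
    proof -
      have "sqrt (t n) * hk (t n) (- (sqrt (t n) * z)) = hk 1 z" for z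
        using s t(1)[of n] by (simp add: normal_density_def power_mult_distrib real_sqrt_mult)
      then have "(\<lambda>z. hk 1 z * c (y + sqrt (t n) * z)) = (\<lambda>z. sqrt (t n) * (hk (t n) (- (sqrt (t n) * z)) * c (y + sqrt (t n) * z)))"
        by (simp add: mult.assoc[symmetric])
      then show ?thesis using s by simp
    qed
    also have "\<dots> = (\<integral>z. c (y + sqrt (t n) * z) \<partial>normal_measure 1)"
      unfolding normal_measure_def by (subst integral_density) auto
    finally show ?thesis .
  qed
  have "(\<lambda>n. \<integral>z. c (y + sqrt (t n) * z) \<partial>normal_measure 1) \<longlonglongrightarrow> (\<integral>z. c y \<partial>normal_measure 1)"
  proof (rule integral_dominated_convergence[where w="\<lambda>_. K"])
    show "AE z in normal_measure 1. (\<lambda>n. c (y + sqrt (t n) * z)) \<longlonglongrightarrow> c y"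
    proof (intro AE_I2)
      fix z
      have "(\<lambda>n. y + sqrt (t n) * z) \<longlonglongrightarrow> y + sqrt 0 * z" by (intro tendsto_intros t)
      then have l: "(\<lambda>n. y + sqrt (t n) * z) \<longlonglongrightarrow> y" by simp
      have "isCont c y" using c(1) by (simp add: continuous_on_eq_continuous_at)
      then show "(\<lambda>n. c (y + sqrt (t n) * z)) \<longlonglongrightarrow> c y" using l by (rule isCont_tendsto_compose)
    qed
  qed (use c in auto)
  then show ?thesis using N.prob_space by (simp add: eq)
qed

text \<open>For a bounded continuous integrable \<open>c\<close>, pointwise convergence and the fact
  that smoothing does not increase the \<open>L1\<close> norm give norm convergence by Scheffe's
  lemma. The same contraction property transfers it to \<open>g\<close> with an error of
  \<open>e / 3\<close> for each of three terms.\<close>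

lemma gconv_L1_tendsto:
  fixes g :: "real \<Rightarrow> real"
  assumes [measurable]: "g \<in> borel_measurable borel" and g0: "\<And>x. 0 \<le> g x" and gi: "integrable lborel g"
    and t: "\<And>n. 0 < t n" "t \<longlonglongrightarrow> 0"
  shows "(\<lambda>n. \<integral>y. \<bar>gconv g (t n) y - g y\<bar> \<partial>lborel) \<longlonglongrightarrow> 0"
proof (rule LIMSEQ_I)
  fix e :: real assume e: "0 < e"
  obtain c K where c: "continuous_on UNIV c" "\<And>x. 0 \<le> c x" "\<And>x. c x \<le> K" "integrable lborel c" "(\<integral>x. \<bar>g x - c x\<bar> \<partial>lborel) < e / 3"
    using L1_continuous_approx[OF assms(1) g0 gi, of "e / 3"] e by auto
  have [measurable]: "c \<in> borel_measurable borel" using c(4) by simp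
  have "\<bar>c x\<bar> \<le> K" for x using c(2,3)[of x] by simp
  then have pt: "(\<lambda>n. gconv c (t n) y) \<longlonglongrightarrow> c y" for y by (intro gconv_tendsto[OF c(1) _ t])
  have "(\<lambda>n. \<integral>\<^sup>+y. norm (gconv c (t n) y - c y) \<partial>lborel) \<longlonglongrightarrow> 0"
  proof (rule Scheffe_lemma2)
    show "(\<integral>\<^sup>+y. ennreal (norm (gconv c (t n) y)) \<partial>lborel) \<le> (\<integral>\<^sup>+y. ennreal (norm (c y)) \<partial>lborel)" for n
      using gconv_L1(1)[OF t(1) c(4)] by simp
  qed (use pt c(4) in auto)
  moreover have "(\<integral>\<^sup>+y. norm (gconv c (t n) y - c y) \<partial>lborel) = ennreal (\<integral>y. \<bar>gconv c (t n) y - c y\<bar> \<partial>lborel)" for n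
    using gconv_L1(2)[OF t(1) c(4)] c(4) by (subst nn_integral_eq_integral) auto
  ultimately have "(\<lambda>n. ennreal (\<integral>y. \<bar>gconv c (t n) y - c y\<bar> \<partial>lborel)) \<longlonglongrightarrow> ennreal 0" by simp
  then have "(\<lambda>n. \<integral>y. \<bar>gconv c (t n) y - c y\<bar> \<partial>lborel) \<longlonglongrightarrow> 0" by (subst (asm) tendsto_ennreal_iff) auto
  then have "\<forall>\<^sub>F n in sequentially. (\<integral>y. \<bar>gconv c (t n) y - c y\<bar> \<partial>lborel) < e / 3"
    using e by (intro order_tendstoD(2)) auto
  then obtain n0 where n0: "\<And>n. n \<ge> n0 \<Longrightarrow> (\<integral>y. \<bar>gconv c (t n) y - c y\<bar> \<partial>lborel) < e / 3" by (auto simp: eventually_sequentially)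
  have "(\<integral>y. \<bar>gconv g (t n) y - g y\<bar> \<partial>lborel) < e" if n: "n \<ge> n0" for n
  proof -
    have lin: "gconv g (t n) y - gconv c (t n) y = gconv (\<lambda>x. g x - c x) (t n) y" for y
      unfolding gconv_def using gconv_kernel_int[OF t(1) gi] gconv_kernel_int[OF t(1) c(4)] by (simp add: right_diff_distrib)
    have gci: "integrable lborel (\<lambda>x. g x - c x)" using gi c(4) by simp
    note i = gconv_L1(2)[OF t(1) gi, of n] gconv_L1(2)[OF t(1) c(4), of n]
    have "(\<integral>y. \<bar>gconv g (t n) y - g y\<bar> \<partial>lborel) \<le>
       (\<integral>y. \<bar>gconv g (t n) y - gconv c (t n) y\<bar> + \<bar>gconv c (t n) y - c y\<bar> + \<bar>g y - c y\<bar> \<partial>lborel)"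
      using i gi c(4) by (intro integral_mono) auto
    also have "\<dots> = (\<integral>y. \<bar>gconv (\<lambda>x. g x - c x) (t n) y\<bar> \<partial>lborel) + (\<integral>y. \<bar>gconv c (t n) y - c y\<bar> \<partial>lborel) + (\<integral>y. \<bar>g y - c y\<bar> \<partial>lborel)"
      using i gi c(4) by (simp add: lin[symmetric])
    also have "\<dots> < e" using gconv_L1(3)[OF t(1) gci, of n] c(5) n0[OF n] by simp
    finally show ?thesis .
  qed
  then show "\<exists>no. \<forall>n\<ge>no. norm ((\<integral>y. \<bar>gconv g (t n) y - g y\<bar> \<partial>lborel) - 0) < e" by auto
qed

lemma isCont_xlnx: "((\<lambda>x. x * ln x) \<longlongrightarrow> a * ln a) (at a within {0..})" if "0 \<le> a" for a :: real
proof (cases "a = 0")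
  case True
  have "((\<lambda>x::real. x * ln x) \<longlongrightarrow> 0) (at_right 0)" by real_asymp
  moreover have "at 0 within {0..} = at_right (0::real)"
  proof -
    have "{0..} - {0::real} = {0<..} - {0}" by auto
    then show ?thesis unfolding at_within_def by (simp only:)
  qed
  ultimately show ?thesis using True by simp
next
  case False
  then have "isCont (\<lambda>x. x * ln x) a" using that by (intro continuous_intros) auto
  then show ?thesis by (auto simp: isCont_def intro: tendsto_within_subset)
qed

lemma tendsto_xlnx:
  fixes X :: "nat \<Rightarrow> real"
  assumes "X \<longlonglongrightarrow> a" "\<And>n. 0 \<le> X n"
  shows "(\<lambda>n. X n * ln (X n)) \<longlonglongrightarrow> a * ln a"
proof -
  have a: "0 \<le> a" using assms by (intro LIMSEQ_le_const) auto
  have "continuous (at a within {0..}) (\<lambda>x. x * ln x)" using isCont_xlnx[OF a] by (simp add: continuous_within)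
  then show ?thesis using assms by (intro continuous_within_tendsto_compose[of a "{0..}" "\<lambda>x. x * ln x"]) auto
qed

context heat_flow
begin

text \<open>Lower semicontinuity of relative entropy reads as an upper bound on limits of entropies.
  Along a subsequence the smoothed densities converge almost everywhere; Fatou's lemma applies to
  the nonnegative integrand \<open>E\<close> of the relative entropy with respect to a normal
  density \<psi> of unit variance. The second moments in it are \<open>var + t n\<close>, which
  converge, so the bound passes to the entropies.\<close>

lemma entropy_lower_semicontinuous:
  assumes [measurable]: "g \<in> borel_measurable borel" and g0: "\<And>x. 0 \<le> g x" and \<mu>: "\<mu> = density lborel (\<lambda>x. ennreal (g x))"
    and ent: "has_entropy g" and t: "\<And>n. 0 < t n" "t \<longlonglongrightarrow> 0"
    and B: "\<And>n. B n \<le> diff_entropy (heat \<mu> (t n))" "B \<longlonglongrightarrow> b"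
  shows "b \<le> diff_entropy g"
proof -
  have gi: "integrable lborel g" and g1: "(\<integral>x. g x \<partial>lborel) = 1"
    using prob g0 unfolding \<mu> by (simp_all add: prob_density_integral)
  have gvi: "integrable lborel (\<lambda>y. g y * (y - mean)\<^sup>2)"
  proof -
    have "integrable \<mu> (\<lambda>x. (x - mean)\<^sup>2)" using sq_int lin_int by (simp add: power2_diff)
    then show ?thesis unfolding \<mu> by (subst (asm) integrable_density) (auto simp: g0)
  qed
  have gv: "(\<integral>y. g y * (y - mean)\<^sup>2 \<partial>lborel) = var"
  proof -
    have "var = (\<integral>x. (x - mean)\<^sup>2 \<partial>density lborel (\<lambda>x. ennreal (g x)))" using var_def by (simp only: \<mu>)
    also have "\<dots> = (\<integral>y. g y * (y - mean)\<^sup>2 \<partial>lborel)" by (subst integral_density) (auto simp: g0)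
    finally show ?thesis by simp
  qed
  have hg: "heat \<mu> s = gconv g s" for s
    unfolding heat_def[abs_def] gconv_def[abs_def] \<mu> by (intro ext, subst integral_density) (auto simp: g0 mult.commute)
  have "\<exists>r::nat\<Rightarrow>nat. strict_mono r \<and> (AE y in lborel. (\<lambda>n. gconv g (t (r n)) y - g y) \<longlonglongrightarrow> 0)"
    using tendsto_L1_AE_subseq[of lborel "\<lambda>n y. gconv g (t n) y - g y"] gconv_L1_tendsto[OF _ g0 gi t] gconv_L1(2)[OF t(1) gi] gi by simp
  then obtain r :: "nat \<Rightarrow> nat" where r: "strict_mono r" and ae: "AE y in lborel. (\<lambda>n. gconv g (t (r n)) y - g y) \<longlonglongrightarrow> 0" by blast
  define \<psi> where "\<psi> = normal_density mean 1"
  have \<psi>0: "0 < \<psi> y" for y by (simp add: \<psi>_def normal_density_pos)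
  have [measurable]: "\<psi> \<in> borel_measurable borel" by (simp add: \<psi>_def)
  define E where "E q y = q y * ln (q y) - q y * ln (\<psi> y) - q y + \<psi> y" for q y
  have E0: "0 \<le> E q y" if "0 \<le> q y" for q y
  proof (cases "q y = 0")
    case False
    then have p: "0 < q y" using that by simp
    have "ln (\<psi> y / q y) \<le> \<psi> y / q y - 1" using p \<psi>0 by (intro ln_le_minus_one) auto
    then have "q y * (ln (\<psi> y) - ln (q y)) \<le> q y * (\<psi> y / q y - 1)" using p \<psi>0[of y] by (intro mult_left_mono) (auto simp: ln_divide_pos)
    also have "\<dots> = \<psi> y - q y" using p by (simp add: right_diff_distrib)
    finally show ?thesis by (simp add: E_def right_diff_distrib)
  qed (use \<psi>0[of y] in \<open>simp add: E_def less_imp_le\<close>)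
  have Eint: "integrable lborel (E q)" "(\<integral>y. E q y \<partial>lborel) = - diff_entropy q + ln (2 * pi) / 2 + V / 2"
    if q: "integrable lborel q" "(\<integral>y. q y \<partial>lborel) = 1" "integrable lborel (\<lambda>y. q y * (y - mean)\<^sup>2)" "(\<integral>y. q y * (y - mean)\<^sup>2 \<partial>lborel) = V"
      "integrable lborel (\<lambda>y. q y * ln (q y))" for q V
  proof -
    note l = integral_ln_normal[of 1, OF _ q(1-4)]
    have \<psi>i: "integrable lborel \<psi>" "(\<integral>y. \<psi> y \<partial>lborel) = 1" by (simp_all add: \<psi>_def)
    have l1: "integrable lborel (\<lambda>y. q y * ln (\<psi> y))" using l(1) by (simp add: \<psi>_def)
    have l2: "(\<integral>y. q y * ln (\<psi> y) \<partial>lborel) = - ln (2 * pi) / 2 - V / 2" using l(2) by (simp add: \<psi>_def)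
    show "integrable lborel (E q)" unfolding E_def[abs_def] using q l1 \<psi>i by simp
    show "(\<integral>y. E q y \<partial>lborel) = - diff_entropy q + ln (2 * pi) / 2 + V / 2"
      unfolding E_def using q l1 \<psi>i by (simp add: l2 diff_entropy_def)
  qed
  have Eg: "integrable lborel (E g)" "(\<integral>y. E g y \<partial>lborel) = - diff_entropy g + ln (2 * pi) / 2 + var / 2"
    using Eint[OF gi g1 gvi gv] ent by (simp_all add: has_entropy_def)
  define h where "h n = heat \<mu> (t (r n))" for n
  have hp: "0 \<le> h n y" for n y using heat_nonneg[OF t(1)] by (simp add: h_def)
  have [measurable]: "h n \<in> borel_measurable borel" for n by (simp add: h_def)
  have Eh: "integrable lborel (E (h n))" "(\<integral>y. E (h n) y \<partial>lborel) = - diff_entropy (h n) + ln (2 * pi) / 2 + (var + t (r n)) / 2" for n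
    unfolding h_def by (rule Eint[OF heat_int[OF t(1)] heat_sq_int[OF t(1)] heat_var[OF t(1)] entropy_heat_int[OF t(1)]])+
  have [measurable]: "E g \<in> borel_measurable borel" "E (h n) \<in> borel_measurable borel" for n unfolding E_def[abs_def] by measurable
  define rhs where "rhs n = - B (r n) + ln (2 * pi) / 2 + (var + t (r n)) / 2" for n
  have lim_rhs: "rhs \<longlonglongrightarrow> - b + ln (2 * pi) / 2 + (var + 0) / 2"
    unfolding rhs_def
    by (intro tendsto_intros LIMSEQ_subseq_LIMSEQ[OF B(2) r, unfolded comp_def] LIMSEQ_subseq_LIMSEQ[OF t(2) r, unfolded comp_def]) simp_all
  have le_rhs: "(\<integral>y. E (h n) y \<partial>lborel) \<le> rhs n" for n
    using B(1)[of "r n"] unfolding Eh(2) rhs_def by (simp add: h_def)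
  have "ennreal (\<integral>y. E g y \<partial>lborel) = (\<integral>\<^sup>+y. ennreal (E g y) \<partial>lborel)"
    using Eg(1) E0 g0 by (intro nn_integral_eq_integral[symmetric]) auto
  also have "\<dots> = (\<integral>\<^sup>+y. liminf (\<lambda>n. ennreal (E (h n) y)) \<partial>lborel)"
  proof (rule nn_integral_cong_AE)
    show "AE y in lborel. ennreal (E g y) = liminf (\<lambda>n. ennreal (E (h n) y))"
      using ae
    proof eventually_elim
      case (elim y)
      have "(\<lambda>n. (gconv g (t (r n)) y - g y) + g y) \<longlonglongrightarrow> 0 + g y" by (intro tendsto_intros elim)
      then have l: "(\<lambda>n. h n y) \<longlonglongrightarrow> g y" by (simp add: h_def hg)
      have "(\<lambda>n. E (h n) y) \<longlonglongrightarrow> E g y" unfolding E_def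
        by (intro tendsto_intros tendsto_xlnx l hp)
      then have "(\<lambda>n. ennreal (E (h n) y)) \<longlonglongrightarrow> ennreal (E g y)" by (intro tendsto_ennrealI)
      then show ?case by (simp add: lim_imp_Liminf)
    qed
  qed
  also have "\<dots> \<le> liminf (\<lambda>n. \<integral>\<^sup>+y. ennreal (E (h n) y) \<partial>lborel)" by (rule nn_integral_liminf) simp
  also have "\<dots> = liminf (\<lambda>n. ennreal (\<integral>y. E (h n) y \<partial>lborel))"
    using Eh(1) E0 hp by (subst nn_integral_eq_integral) auto
  also have "\<dots> \<le> liminf (\<lambda>n. ennreal (rhs n))"
    by (intro Liminf_mono always_eventually allI ennreal_leI le_rhs)
  also have "\<dots> = ennreal (- b + ln (2 * pi) / 2 + (var + 0) / 2)"
    by (intro lim_imp_Liminf tendsto_ennrealI lim_rhs) simp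
  finally have fin: "ennreal (\<integral>y. E g y \<partial>lborel) \<le> ennreal (- b + ln (2 * pi) / 2 + (var + 0) / 2)" .
  \<comment> \<open>Conversion to \<open>ennreal\<close> sends negative numbers to 0, so the limit
    must be known to be nonnegative before the inequality can be read in the reals.\<close>
  have "0 \<le> (\<integral>y. E (h n) y \<partial>lborel)" for n using E0 hp by (intro integral_nonneg_AE AE_I2) auto
  then have "0 \<le> rhs n" for n using le_rhs order_trans by blast
  then have "0 \<le> - b + ln (2 * pi) / 2 + (var + 0) / 2" using lim_rhs by (intro LIMSEQ_le_const) auto
  then have "(\<integral>y. E g y \<partial>lborel) \<le> - b + ln (2 * pi) / 2 + (var + 0) / 2" using fin by (subst (asm) ennreal_le_iff) auto
  then show ?thesis unfolding Eg(2) by simp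
qed

end

section \<open>Pinsker's inequality\<close>

text \<open>The difference \<open>h\<close> of the two sides, after division by
  \<open>2 * x + 4\<close>, vanishes to first order at 1 and is convex: its second derivative is
  \<open>1 / x - 27 / (x + 2)^3\<close>, nonnegative because
  \<open>(x + 2)^3 - 27 * x = (x - 1)^2 * (x + 8)\<close>.\<close>

lemma pinsker_pointwise_unit:
  fixes u :: real
  assumes u: "0 < u"
  shows "3 * (u - 1)\<^sup>2 \<le> (2 * u + 4) * (u * ln u - u + 1)"
proof -
  define h' where "h' x = ln x - 3 / 2 * (1 - 9 * inverse ((x + 2)\<^sup>2))" for x :: real
  define h where "h x = x * ln x - x + 1 - 3 * (x - 1)\<^sup>2 / (2 * x + 4)" for x :: real
  have d': "(h' has_real_derivative 1 / x - 27 / (x + 2) ^ 3) (at x)" if "0 < x" for x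
  proof -
    have e: "3 / 2 * (0 - 9 * - (2 * y * inverse ((y\<^sup>2) ^ Suc (Suc 0)))) = 27 / y ^ 3" if "y \<noteq> 0" for y :: real
      using that by (simp add: field_simps eval_nat_numeral)
    have d1: "((\<lambda>x. (x + 2)\<^sup>2) has_real_derivative 2 * (x + 2)) (at x)" by (auto intro!: derivative_eq_intros)
    have d2: "((\<lambda>x. inverse ((x + 2)\<^sup>2)) has_real_derivative - (2 * (x + 2) * inverse (((x + 2)\<^sup>2) ^ Suc (Suc 0)))) (at x)"
      using that by (intro DERIV_inverse_fun d1) simp
    have hd: "(h' has_real_derivative 1 / x - 3 / 2 * (0 - 9 * - (2 * (x + 2) * inverse (((x + 2)\<^sup>2) ^ Suc (Suc 0))))) (at x)"
      unfolding h'_def[abs_def] by (intro DERIV_diff DERIV_ln_divide that DERIV_cmult DERIV_const d2)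
    have ne: "x + 2 \<noteq> 0" using that by simp
    show ?thesis using hd unfolding e[OF ne] .
  qed
  have dd: "0 \<le> 1 / x - 27 / (x + 2) ^ 3" if "0 < x" for x :: real
  proof -
    have "(x + 2) ^ 3 - 27 * x = (x - 1)\<^sup>2 * (x + 8)" by (simp add: power2_eq_square power3_eq_cube algebra_simps)
    also have "\<dots> \<ge> 0" using that by simp
    finally show ?thesis using that by (simp add: divide_simps)
  qed
  have h'1: "h' 1 = 0" by (simp add: h'_def power2_eq_square)
  have h'_mono: "h' a \<le> h' b" if "0 < a" "a \<le> b" for a b
    by (rule DERIV_nonneg_imp_nondecreasing[OF that(2)]) (use d' dd that in \<open>meson less_le_trans\<close>)
  have d: "(h has_real_derivative h' x) (at x)" if "0 < x" for x
  proof -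
    have hd: "(h has_real_derivative (ln x + 1) - 1 - (3 * (2 * (x - 1)) * (2 * x + 4) - 3 * (x - 1)\<^sup>2 * 2) / ((2 * x + 4) * (2 * x + 4))) (at x)"
      unfolding h_def[abs_def] using that by (auto intro!: derivative_eq_intros)
    have eq: "(3 * (2 * (x - 1)) * (2 * x + 4) - 3 * (x - 1)\<^sup>2 * 2) / ((2 * x + 4) * (2 * x + 4)) = 3 / 2 * (1 - 9 * inverse ((x + 2)\<^sup>2))"
      using that by (simp add: divide_simps) (simp add: power2_eq_square algebra_simps)
    have "(ln x + 1) - 1 - z = ln x - z" for z by simp
    with hd show ?thesis unfolding eq h'_def by (simp only:)
  qed
  have h1: "h 1 = 0" by (simp add: h_def)
  have "0 \<le> h u"
  proof (cases "1 \<le> u")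
    case True
    have "h 1 \<le> h u"
      by (rule DERIV_nonneg_imp_nondecreasing[OF True])
        (metis d h'_mono h'1 less_le_trans zero_less_one)
    then show ?thesis by (simp add: h1)
  next
    case False
    have "h 1 \<le> h u"
    proof (rule DERIV_nonpos_imp_nonincreasing[of u 1 h])
      fix x assume x: "u \<le> x" "x \<le> 1"
      then have "0 < x" using u by simp
      then show "\<exists>y. (h has_real_derivative y) (at x) \<and> y \<le> 0" using d h'_mono[of x 1] x h'1 by auto
    qed (use False in simp)
    then show ?thesis by (simp add: h1)
  qed
  then have "3 * (u - 1)\<^sup>2 / (2 * u + 4) \<le> u * ln u - u + 1" by (simp add: h_def)
  then show ?thesis using u by (simp add: divide_le_eq mult.commute)
qed

lemma pinsker_pointwise:
  fixes a b :: real
  assumes a: "0 \<le> a" and b: "0 < b"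
  shows "3 * (a - b)\<^sup>2 \<le> (2 * a + 4 * b) * (a * ln (a / b) - a + b)"
proof (cases "a = 0")
  case True
  then show ?thesis using b by (simp add: power2_eq_square)
next
  case False
  define u where "u = a / b"
  have u: "0 < u" and ab: "a = u * b" using False a b by (auto simp: u_def)
  have "b\<^sup>2 * (3 * (u - 1)\<^sup>2) \<le> b\<^sup>2 * ((2 * u + 4) * (u * ln u - u + 1))"
    by (intro mult_left_mono pinsker_pointwise_unit u) simp
  then show ?thesis unfolding ab using b by (simp add: power2_eq_square algebra_simps)
qed

text \<open>Cauchy-Schwarz with the weight \<open>w = (2 * f + 4 * q) / 3\<close>. The pointwise
  inequality bounds \<open>(f - q)^2 / w\<close> by the relative entropy integrand, and the total
  mass 2 of \<open>w\<close> is the source of the constant 1/2.\<close>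

theorem pinsker:
  fixes f q :: "real \<Rightarrow> real"
  assumes f: "integrable lborel f" "\<And>x. 0 \<le> f x" "(\<integral>x. f x \<partial>lborel) = 1"
    and q: "integrable lborel q" "\<And>x. 0 < q x" "(\<integral>x. q x \<partial>lborel) = 1"
    and fq: "integrable lborel (\<lambda>x. f x * ln (f x / q x))"
  shows "(1 / 2) * (L1_dist f q)\<^sup>2 \<le> rel_entropy f q"
proof -
  have [measurable]: "f \<in> borel_measurable borel" "q \<in> borel_measurable borel" using f q by auto
  define w where "w x = (2 * f x + 4 * q x) / 3" for x
  have w: "0 < w x" for x using f(2)[of x] q(2)[of x] by (simp add: w_def)
  have [measurable]: "w \<in> borel_measurable borel" unfolding w_def[abs_def] by measurable
  define E where "E x = f x * ln (f x / q x) - f x + q x" for x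
  have Ei: "integrable lborel E" unfolding E_def[abs_def] using f q fq by simp
  have E1: "(\<integral>x. E x \<partial>lborel) = rel_entropy f q" unfolding E_def rel_entropy_def using f q fq by simp
  have pt: "(\<bar>f x - q x\<bar> / sqrt (w x))\<^sup>2 \<le> E x" for x
  proof -
    have "3 * (f x - q x)\<^sup>2 \<le> (2 * f x + 4 * q x) * E x" unfolding E_def by (rule pinsker_pointwise[OF f(2) q(2)])
    then have "(f x - q x)\<^sup>2 \<le> w x * E x" by (simp add: w_def)
    then show ?thesis using w[of x] by (simp add: power_divide divide_le_eq mult.commute)
  qed
  have wi: "integrable lborel w" "(\<integral>x. w x \<partial>lborel) = 2" unfolding w_def[abs_def] using f q by simp_all
  have sw: "(sqrt (w x))\<^sup>2 = w x" for x using w[of x] by simp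
  have i2: "integrable lborel (\<lambda>x. (\<bar>f x - q x\<bar> / sqrt (w x))\<^sup>2)"
    by (rule Bochner_Integration.integrable_bound[OF Ei]) (use pt in \<open>auto intro!: order_trans[OF pt abs_ge_self]\<close>)
  have "L1_dist f q = (\<integral>x. sqrt (w x) * (\<bar>f x - q x\<bar> / sqrt (w x)) \<partial>lborel)"
    unfolding L1_dist_def using w by (intro Bochner_Integration.integral_cong) (auto simp: less_imp_neq[symmetric])
  then have "(L1_dist f q)\<^sup>2 \<le> (\<integral>x. (sqrt (w x))\<^sup>2 \<partial>lborel) * (\<integral>x. (\<bar>f x - q x\<bar> / sqrt (w x))\<^sup>2 \<partial>lborel)"
    using i2 wi(1) by (simp only:) (intro Cauchy_Schwarz_integral, auto simp: sw)
  also have "\<dots> = 2 * (\<integral>x. (\<bar>f x - q x\<bar> / sqrt (w x))\<^sup>2 \<partial>lborel)" by (simp only: sw wi(2))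
  also have "\<dots> \<le> 2 * (\<integral>x. E x \<partial>lborel)" by (intro mult_left_mono integral_mono i2 Ei pt) auto
  finally show ?thesis by (simp add: E1)
qed

section \<open>From the smoothed inequalities to the theorem\<close>

lemma diff_entropy_cong_density:
  fixes f h :: "real \<Rightarrow> real"
  assumes [measurable]: "f \<in> borel_measurable borel" "h \<in> borel_measurable borel"
    and nn: "\<And>x. 0 \<le> f x" "\<And>x. 0 \<le> h x"
    and eq: "density lborel (\<lambda>x. ennreal (f x)) = density lborel (\<lambda>x. ennreal (h x))"
  shows "diff_entropy f = diff_entropy h"
proof -
  have "AE x in lborel. ennreal (f x) = ennreal (h x)"
    using eq by (subst (asm) sigma_finite_measure.density_unique_iff[OF sigma_finite_lborel]) auto
  then have "AE x in lborel. f x = h x" using nn by (auto elim!: eventually_mono)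
  then have "(\<integral>x. f x * ln (f x) \<partial>lborel) = (\<integral>x. h x * ln (h x) \<partial>lborel)"
    by (intro integral_cong_AE) (auto elim!: eventually_mono)
  then show ?thesis by (simp add: diff_entropy_def)
qed

lemma (in heat_flow) var_pos_density:
  assumes [measurable]: "f \<in> borel_measurable borel" and \<mu>: "\<mu> = density lborel (\<lambda>x. ennreal (f x))"
  shows "0 < var"
proof (rule ccontr)
  assume "\<not> 0 < var"
  then have "var = 0" using var_nonneg by simp
  moreover have "integrable \<mu> (\<lambda>x. (x - mean)\<^sup>2)" using sq_int lin_int by (simp add: power2_diff)
  ultimately have "AE x in \<mu>. (x - mean)\<^sup>2 = 0" by (subst (asm) var_def, subst (asm) integral_nonneg_eq_0_iff_AE) auto
  then have "AE x in lborel. 0 < ennreal (f x) \<longrightarrow> x = mean" unfolding \<mu> by (subst (asm) AE_density) auto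
  then have "AE x in lborel. ennreal (f x) = 0"
    using AE_lborel_singleton[of mean] by eventually_elim (auto simp: zero_less_iff_neq_zero)
  then have "(\<integral>\<^sup>+x. ennreal (f x) \<partial>lborel) = 0" by (subst nn_integral_0_iff_AE) auto
  then show False using emeasure_space_1 by (simp add: \<mu> emeasure_density)
qed

text \<open>Let \<open>t n\<close> tend to zero in \<open>entropy_deficit_contraction\<close>. At
  each time the entropy of the smoothed \<open>X\<close> is replaced by the smaller
  \<open>diff_entropy f\<close>; the resulting lower bounds \<open>B n\<close> for the smoothed sum
  converge, and semicontinuity hands their limit to \<open>g\<close>.\<close>

lemma (in heat_flow) entropy_jump:
  assumes [measurable]: "f \<in> borel_measurable borel" "g \<in> borel_measurable borel" and nn: "\<And>x. 0 \<le> f x" "\<And>x. 0 \<le> g x"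
    and \<mu>: "\<mu> = density lborel (\<lambda>x. ennreal (f x))" and \<mu>2: "\<mu>2 = density lborel (\<lambda>x. ennreal (g x))"
    and ent: "has_entropy f" "has_entropy g" and R: "poincare_bound \<mu> R"
  shows "(ln (2 * pi * var) + 1) / 2 - diff_entropy f \<le> (2 * R / var + 1) * (diff_entropy g - diff_entropy f - ln 2 / 2)"
proof -
  interpret H2: heat_flow \<mu>2 by (rule heat_flow_\<mu>2)
  have v: "0 < var" by (rule var_pos_density[OF _ \<mu>]) simp
  have Rv: "var \<le> R" using poincare_ge_var[OF R] .
  define \<kappa> where "\<kappa> = 2 * R / (2 * R + var)"
  have k0: "0 \<le> \<kappa>" using v Rv by (simp add: \<kappa>_def)
  define c where "c s = (ln (2 * pi * (var + s)) + 1) / 2" for s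
  define t where "t n = 1 / real (Suc n)" for n
  have t: "0 < t n" for n by (simp add: t_def)
  have t0: "t \<longlonglongrightarrow> 0" unfolding t_def[abs_def] by (rule LIMSEQ_Suc[OF lim_1_over_n])
  define B where "B n = c (t n) + ln 2 / 2 - \<kappa> * (c (t n) - diff_entropy f)" for n
  have Ble: "B n \<le> diff_entropy (heat \<mu>2 (2 * t n))" for n
  proof -
    have "c (t n) - (diff_entropy (heat \<mu>2 (2 * t n)) - ln 2 / 2) \<le> \<kappa> * (c (t n) - diff_entropy (heat \<mu> (t n)))"
      unfolding c_def \<kappa>_def by (rule entropy_deficit_contraction[OF R v t])
    also have "\<dots> \<le> \<kappa> * (c (t n) - diff_entropy f)"
      using entropy_heat_ge[OF t _ nn(1) \<mu> ent(1)] k0 by (intro mult_left_mono) auto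
    finally show ?thesis by (simp add: B_def)
  qed
  have clim: "(\<lambda>n. c (t n)) \<longlonglongrightarrow> c 0"
    unfolding c_def using v by (intro tendsto_intros t0) auto
  have Blim: "B \<longlonglongrightarrow> c 0 + ln 2 / 2 - \<kappa> * (c 0 - diff_entropy f)"
    unfolding B_def by (intro tendsto_intros clim)
  have t2: "(\<lambda>n. 2 * t n) \<longlonglongrightarrow> 0" using tendsto_mult_left[OF t0, of 2] by simp
  have "c 0 + ln 2 / 2 - \<kappa> * (c 0 - diff_entropy f) \<le> diff_entropy g"
    by (rule H2.entropy_lower_semicontinuous[OF _ nn(2) \<mu>2 ent(2) _ t2 Ble Blim]) (simp_all add: t)
  then have main: "(1 - \<kappa>) * (c 0 - diff_entropy f) \<le> diff_entropy g - diff_entropy f - ln 2 / 2"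
    by (simp add: algebra_simps)
  \<comment> \<open>Solving for the deficit of \<open>f\<close> divides by
    \<open>1 - \<kappa> = var / (2 * R + var)\<close>, which produces the factor of the
    theorem.\<close>
  have f1: "(2 * R / var + 1) * (1 - \<kappa>) = 1"
  proof -
    have "1 - \<kappa> = var / (2 * R + var)" "2 * R / var + 1 = (2 * R + var) / var" using v Rv by (simp_all add: \<kappa>_def field_simps)
    then show ?thesis using v Rv by simp
  qed
  have "c 0 - diff_entropy f = (2 * R / var + 1) * ((1 - \<kappa>) * (c 0 - diff_entropy f))" by (simp add: f1 mult.assoc[symmetric])
  also have "\<dots> \<le> (2 * R / var + 1) * (diff_entropy g - diff_entropy f - ln 2 / 2)"
    using main v Rv by (intro mult_left_mono) auto
  finally show ?thesis by (simp add: c_def)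
qed

lemma sqrt2_eq_exp: "sqrt 2 = exp (ln 2 / 2)"
  by (simp add: ln_sqrt[symmetric])

theorem mainTheorem17:
  fixes M :: "'a measure" and X X' :: "'a \<Rightarrow> real" and f g :: "real \<Rightarrow> real"
  assumes "prob_space M"
    and "\<And>x. 0 \<le> f x" and "\<And>x. 0 \<le> g x"
    and "distributed M lborel X f"
    and "distributed M lborel X' f"
    and "prob_space.indep_var M borel X borel X'"
    and "distributed M lborel (\<lambda>\<omega>. X \<omega> + X' \<omega>) g"
    and "has_entropy f" and "has_entropy g"
  shows "doubling_const f g \<ge> sqrt 2
    \<and> (doubling_const f g = sqrt 2 \<longleftrightarrow>
         (\<exists>\<mu> s. 0 < s \<and> distributed M lborel X (normal_density \<mu> s)))
    \<and> (\<forall>C R. doubling_const f g \<le> C \<longrightarrow> integrable M (\<lambda>\<omega>. (X \<omega>)\<^sup>2) \<longrightarrow>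
          poincare_const M X = ennreal R \<longrightarrow>
          (let \<mu> = (\<integral>\<omega>. X \<omega> \<partial>M);
               v = (\<integral>\<omega>. (X \<omega> - \<mu>)\<^sup>2 \<partial>M);
               \<phi> = normal_density \<mu> (sqrt v)
           in (1/2) * (L1_dist f \<phi>)\<^sup>2 \<le> rel_entropy f \<phi>
              \<and> rel_entropy f \<phi> \<le> (2 * R / v + 1) * ln (C / sqrt 2)))"
proof -
  interpret M: prob_space M by fact
  note nn = assms(2,3) and dX = assms(4) and dX' = assms(5) and ind = assms(6) and dS = assms(7)
  have fm[measurable]: "f \<in> borel_measurable borel" using distributed_real_measurable[OF _ dX] nn by simp
  have gm[measurable]: "g \<in> borel_measurable borel" using distributed_real_measurable[OF _ dS] nn by simp
  have Xm[measurable]: "X \<in> borel_measurable M" "X' \<in> borel_measurable M"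
    using distributed_measurable[OF dX] distributed_measurable[OF dX'] by simp_all
  have law: "distr M borel Y = density lborel (\<lambda>x. ennreal (h x))" if "distributed M lborel Y h" for Y h
    using distributed_distr_eq_density[OF that] by (simp cong: distr_cong)
  note lX = law[OF dX] and lX' = law[OF dX'] and lS = law[OF dS]
  define \<mu>f where "\<mu>f = density lborel (\<lambda>x. ennreal (f x))"
  have fg: "distr (\<mu>f \<Otimes>\<^sub>M \<mu>f) borel (\<lambda>(x, y). x + y) = density lborel (\<lambda>x. ennreal (g x))"
  proof -
    have "\<mu>f \<Otimes>\<^sub>M \<mu>f = distr M (borel \<Otimes>\<^sub>M borel) (\<lambda>\<omega>. (X \<omega>, X' \<omega>))"
      using ind unfolding M.indep_var_distribution_eq by (simp add: lX lX' \<mu>f_def)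
    then have "distr (\<mu>f \<Otimes>\<^sub>M \<mu>f) borel (\<lambda>(x, y). x + y) = distr M borel (\<lambda>\<omega>. X \<omega> + X' \<omega>)"
      by (simp add: distr_distr comp_def)
    then show ?thesis by (simp add: lS)
  qed
  have prob: "prob_space (density lborel (\<lambda>x. ennreal (f x)))" "prob_space (density lborel (\<lambda>x. ennreal (g x)))"
    using M.prob_space_distr[of X borel] M.prob_space_distr[of "\<lambda>\<omega>. X \<omega> + X' \<omega>" borel] by (simp_all add: lX lS)
  interpret E: density_doubling f g
    by (rule density_doubling.intro) (use nn prob fg assms(8,9) in \<open>simp_all add: \<mu>f_def\<close>)
  define \<Delta> where "\<Delta> = diff_entropy g - diff_entropy f"
  have dc: "doubling_const f g = exp \<Delta>" by (simp add: doubling_const_def \<Delta>_def)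
  have epi: "ln 2 / 2 \<le> \<Delta>" unfolding \<Delta>_def by (rule E.entropy_power_doubling)
  have i: "doubling_const f g \<ge> sqrt 2" unfolding dc sqrt2_eq_exp using epi by simp
  have ii: "doubling_const f g = sqrt 2 \<longleftrightarrow> (\<exists>\<mu> s. 0 < s \<and> distributed M lborel X (normal_density \<mu> s))"
  proof
    assume "doubling_const f g = sqrt 2"
    then have "\<Delta> = ln 2 / 2" unfolding dc sqrt2_eq_exp by simp
    then obtain m s where ms: "0 < s" "density lborel (\<lambda>x. ennreal (f x)) = density lborel (\<lambda>x. ennreal (normal_density m s x))"
      using E.entropy_power_doubling_equality unfolding \<Delta>_def by blast
    have "distributed M lborel X (normal_density m s)"
      unfolding distributed_def using distributed_distr_eq_density[OF dX] ms(2) by simp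
    then show "\<exists>\<mu> s. 0 < s \<and> distributed M lborel X (normal_density \<mu> s)" using ms(1) by blast
  next
    assume "\<exists>\<mu> s. 0 < s \<and> distributed M lborel X (normal_density \<mu> s)"
    then obtain m s where s: "0 < s" and n: "distributed M lborel X (normal_density m s)" by blast
    have dens: "density lborel (\<lambda>x. ennreal (f x)) = density lborel (\<lambda>x. ennreal (normal_density m s x))"
      using lX law[OF n] by simp
    have n': "distributed M lborel X' (normal_density m s)"
      unfolding distributed_def using distributed_distr_eq_density[OF dX'] dens by simp
    have "distributed M lborel (\<lambda>\<omega>. X \<omega> + X' \<omega>) (normal_density (m + m) (sqrt (s\<^sup>2 + s\<^sup>2)))"
      by (rule M.add_indep_normal[OF ind s s n n'])
    from law[OF this] lS have dens2: "density lborel (\<lambda>x. ennreal (g x)) = density lborel (\<lambda>x. ennreal (normal_density (m + m) (sqrt (s\<^sup>2 + s\<^sup>2)) x))" by simp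
    have s2: "0 < sqrt (s\<^sup>2 + s\<^sup>2)" using s by (simp add: add_pos_pos)
    have "diff_entropy f = (ln (2 * pi * s\<^sup>2) + 1) / 2"
      using diff_entropy_cong_density[OF fm _ nn(1) _ dens] entropy_normal(2)[OF s] by simp
    moreover have "diff_entropy g = (ln (2 * pi * (s\<^sup>2 + s\<^sup>2)) + 1) / 2"
      using diff_entropy_cong_density[OF gm _ nn(2) _ dens2] entropy_normal(2)[OF s2] by simp
    moreover have "ln (2 * pi * (s\<^sup>2 + s\<^sup>2)) = ln (2 * pi * s\<^sup>2) + ln 2"
      using ln_mult_pos[of "2 * pi * s\<^sup>2" 2] s by (simp add: algebra_simps)
    ultimately have "\<Delta> = ln 2 / 2" by (simp add: \<Delta>_def add_divide_distrib)
    then show "doubling_const f g = sqrt 2" by (simp add: dc sqrt2_eq_exp)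
  qed
  have iii: "(let \<mu> = (\<integral>\<omega>. X \<omega> \<partial>M); v = (\<integral>\<omega>. (X \<omega> - \<mu>)\<^sup>2 \<partial>M); \<phi> = normal_density \<mu> (sqrt v)
           in (1/2) * (L1_dist f \<phi>)\<^sup>2 \<le> rel_entropy f \<phi> \<and> rel_entropy f \<phi> \<le> (2 * R / v + 1) * ln (C / sqrt 2))"
    if C: "doubling_const f g \<le> C" and X2: "integrable M (\<lambda>\<omega>. (X \<omega>)\<^sup>2)" and PC: "poincare_const M X = ennreal R" for C R
  proof -
    have sq: "integrable \<mu>f (\<lambda>x. x\<^sup>2)"
      using X2 unfolding \<mu>f_def lX[symmetric] by (subst integrable_distr_eq) auto
    interpret H: heat_flow \<mu>f
      by (rule heat_flow.intro) (use prob sq in \<open>simp_all add: \<mu>f_def\<close>)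
    have m: "(\<integral>\<omega>. X \<omega> \<partial>M) = H.mean"
      unfolding H.mean_def unfolding \<mu>f_def lX[symmetric] by (subst integral_distr) auto
    have v: "(\<integral>\<omega>. (X \<omega> - H.mean)\<^sup>2 \<partial>M) = H.var"
      unfolding H.var_def by (subst (2) \<mu>f_def, subst lX[symmetric], subst integral_distr) auto
    have vpos: "0 < H.var" by (rule H.var_pos_density[OF fm \<mu>f_def])
    \<comment> \<open>A negative \<open>R\<close> would satisfy the hypothesis on
      \<open>poincare_const\<close> with \<open>ennreal R = 0\<close>. Working with
      \<open>R'\<close> first, the bound of the positive variance by \<open>R'\<close> excludes this
      case and yields \<open>R' = R\<close>.\<close>
    define R' where "R' = max R 0"
    have "poincare_const M X = ennreal R'" using PC by (simp add: R'_def ennreal_neg max_def)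
    then have "poincare_bound (distr M borel X) R'"
      using X2 by (intro poincare_bound_of_const[OF M.prob_space_axioms]) (auto simp: R'_def)
    then have pb: "poincare_bound \<mu>f R'" by (simp add: \<mu>f_def lX)
    have "H.var \<le> R'" by (rule H.poincare_ge_var[OF pb])
    then have R: "R' = R" "0 < R" using vpos by (auto simp: R'_def max_def split: if_splits)
    have \<mu>2: "H.\<mu>2 = density lborel (\<lambda>x. ennreal (g x))" unfolding H.\<mu>2_def by (rule fg)
    have jump: "(ln (2 * pi * H.var) + 1) / 2 - diff_entropy f \<le> (2 * R / H.var + 1) * (\<Delta> - ln 2 / 2)"
      using H.entropy_jump[OF fm gm nn \<mu>f_def \<mu>2 assms(8,9) pb] by (simp add: R \<Delta>_def)
    have C0: "0 < C" using C dc exp_gt_zero[of \<Delta>] by linarith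
    have "\<Delta> \<le> ln C" using C C0 unfolding dc by (metis ln_exp ln_le_cancel_iff exp_gt_zero)
    then have lnC: "\<Delta> - ln 2 / 2 \<le> ln (C / sqrt 2)" using C0 by (simp add: ln_divide_pos ln_sqrt)
    note fi = prob_density_integral[OF prob(1) fm nn(1)]
    have fvi: "integrable lborel (\<lambda>y. f y * (y - H.mean)\<^sup>2)"
    proof -
      have "integrable \<mu>f (\<lambda>x. (x - H.mean)\<^sup>2)" using H.sq_int H.lin_int by (simp add: power2_diff)
      then show ?thesis unfolding \<mu>f_def by (subst (asm) integrable_density) (auto simp: nn)
    qed
    have int_f: "(\<integral>x. k x \<partial>\<mu>f) = (\<integral>x. f x * k x \<partial>lborel)" if "k \<in> borel_measurable borel" for k :: "real \<Rightarrow> real"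
      unfolding \<mu>f_def using that by (subst integral_density) (auto simp: nn)
    have fv: "(\<integral>y. f y * (y - H.mean)\<^sup>2 \<partial>lborel) = H.var"
      unfolding H.var_def by (subst int_f) auto
    define \<phi> where "\<phi> = normal_density H.mean (sqrt H.var)"
    have \<phi>: "integrable lborel \<phi>" "\<And>x. 0 < \<phi> x" "(\<integral>x. \<phi> x \<partial>lborel) = 1"
      using vpos by (simp_all add: \<phi>_def normal_density_pos)
    note l = integral_ln_normal[OF vpos fi fvi fv, folded \<phi>_def]
    have e: "(\<lambda>x. f x * ln (f x / \<phi> x)) = (\<lambda>x. f x * ln (f x) - f x * ln (\<phi> x))"
    proof
      fix x show "f x * ln (f x / \<phi> x) = f x * ln (f x) - f x * ln (\<phi> x)"
        using nn(1)[of x] \<phi>(2)[of x] by (cases "f x = 0") (auto simp: ln_divide_pos right_diff_distrib)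
    qed
    have fent: "integrable lborel (\<lambda>x. f x * ln (f x))" using assms(8) by (simp add: has_entropy_def)
    have rel: "rel_entropy f \<phi> = (ln (2 * pi * H.var) + 1) / 2 - diff_entropy f"
      unfolding rel_entropy_def e using fent l vpos by (simp add: diff_entropy_def add_divide_distrib)
    have pin: "(1/2) * (L1_dist f \<phi>)\<^sup>2 \<le> rel_entropy f \<phi>"
      using fent l(1) by (intro pinsker fi \<phi> nn(1)) (simp add: e)
    have "rel_entropy f \<phi> \<le> (2 * R / H.var + 1) * (\<Delta> - ln 2 / 2)" using jump by (simp add: rel)
    also have "\<dots> \<le> (2 * R / H.var + 1) * ln (C / sqrt 2)" using lnC R vpos by (intro mult_left_mono) auto
    finally show ?thesis using pin by (simp add: Let_def m v \<phi>_def)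
  qed
  show ?thesis using i ii iii by blast
qed

end
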